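(* Let $r\ge2$ and let $\mathbb{F}_r$ be the free group of rank $r$ with symmetric free generating set $F=\{a_i,a_i^{-1}:1\le i\le r\}$. Let $(X,\mu)$ be a standard Borel probability space with an ergodic probability-measure-preserving action of $\mathbb{F}_r$, and let $\mathcal{P}$ be a countable measurable partition of $X$ with $H(\mathcal{P})<\infty$ such that for some $\varepsilon_0>0$, $$\sum_{P\in\mathcal{P}}\mu(P)\,(-\log\mu(P))^{1+\varepsilon_0}<\infty .$$ Let $S_n\subset\mathbb{F}_r$ be the sphere of elements of word length $n$ with respect to $F$. Then for $\mu$-almost every $x\in X$ the limit $$\lim_{n\to\infty}\frac{1}{|S_n|}\sum_{\substack{g\in S_n\\ g=b_1b_2\cdots b_n}}\frac{\mathcal{J}\Big(\mathcal{P}\vee\bigvee_{j=1}^n b_1\cdots b_j\mathcal{P}\Big)(x)}{n+1}$$ exists, where $g=b_1\cdots b_n$ ($b_i\in F$) denotes the unique reduced expression of $g\in S_n$, and it equals the constant $$\mathfrak{h}_{\mathcal{P}}(\alpha,X)=\lim_{n\to\infty}\int_{\partial\mathbb{F}_r}\frac{1}{n+1}H\big(\mathcal{P}^{F_n(\xi)}\big)\,d\nu(\xi),$$ which is the $\nu\times\mu$-almost sure constant value of $\lim_{n\to\infty}\frac{1}{n+1}\mathcal{J}(\mathcal{P}^{F_n(\xi)})(x)$.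
   Context: $\partial\mathbb{F}_r$ is the space of infinite reduced words $\xi$ with letters $\xi_0,\xi_1,\dots\in F$, $\xi_{i+1}\neq\xi_i^{-1}$; $\nu$ is the probability measure on it giving each cylinder defined by a reduced prefix of length $n\ge1$ the mass $\frac{1}{2r(2r-1)^{n-1}}$. Set $F_n(\xi)=\{e,\xi_0,\xi_0\xi_1,\dots,\xi_0\cdots\xi_{n-1}\}$. For $\gamma\in\mathbb{F}_r$, $\gamma\mathcal{P}=\{\gamma A:A\in\mathcal{P}\}$; for a finite set $E$, $\mathcal{P}^E=\bigvee_{\gamma\in E}\gamma\mathcal{P}$. For a countable partition $\mathcal{Q}$, $H(\mathcal{Q})=-\sum_{Q}\mu(Q)\log\mu(Q)$ and $\mathcal{J}(\mathcal{Q})(x)=-\log\mu(\mathcal{Q}(x))$, where $\mathcal{Q}(x)$ is the atom containing $x$. *)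

theory Defs
  imports "HOL-Probability.Probability" "HOL-Algebra.Group_Action"
begin

section \<open>The free group of rank \<open>r\<close> as the group of reduced words\<close>

text \<open>The letter \<open>(i, True)\<close> stands for the generator \<open>a_i\<close> and \<open>(i, False)\<close> for its inverse.\<close>

type_synonym letter = "nat \<times> bool"

definition letters :: "nat \<Rightarrow> letter set" where
  "letters r = {1..r} \<times> UNIV"

definition inv_letter :: "letter \<Rightarrow> letter" where
  "inv_letter a = (fst a, \<not> snd a)"

definition reduced_words :: "nat \<Rightarrow> letter list set" where
  "reduced_words r = {w. set w \<subseteq> letters r \<and> successively (\<lambda>a b. b \<noteq> inv_letter a) w}"

fun letter_mult :: "letter \<Rightarrow> letter list \<Rightarrow> letter list" where
  "letter_mult a [] = [a]"
| "letter_mult a (b # w) = (if b = inv_letter a then w else a # b # w)"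

definition free_group :: "nat \<Rightarrow> letter list monoid" where
  "free_group r = \<lparr>carrier = reduced_words r, mult = (\<lambda>u v. foldr letter_mult u v), one = []\<rparr>"

definition generators :: "nat \<Rightarrow> letter list set" where
  "generators r = (\<lambda>a. [a]) ` letters r"

definition word_length :: "nat \<Rightarrow> letter list \<Rightarrow> nat" where
  "word_length r g = (LEAST n. \<exists>ss. set ss \<subseteq> generators r \<and> length ss = n \<and>
     foldr (mult (free_group r)) ss (one (free_group r)) = g)"

definition word_sphere :: "nat \<Rightarrow> nat \<Rightarrow> letter list set" where
  "word_sphere r n = {g \<in> carrier (free_group r). word_length r g = n}"

lemma inv_letter_simps [simp]:
  "inv_letter (inv_letter a) = a" "inv_letter a \<in> letters r \<longleftrightarrow> a \<in> letters r"
  "inv_letter a = inv_letter b \<longleftrightarrow> a = b" "inv_letter a \<noteq> a" "a \<noteq> inv_letter a"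
  by (cases a; cases b; auto simp: inv_letter_def letters_def mem_Times_iff)+

lemma letter_mult_reduced:
  assumes "a \<in> letters r" "w \<in> reduced_words r"
  shows "letter_mult a w \<in> reduced_words r"
  using assms by (cases w) (auto simp: reduced_words_def successively_Cons)

lemma foldr_letter_mult_reduced:
  assumes "set u \<subseteq> letters r" "w \<in> reduced_words r"
  shows "foldr letter_mult u w \<in> reduced_words r"
  using assms by (induction u) (auto intro: letter_mult_reduced)

lemma letter_mult_cancel:
  assumes "w \<in> reduced_words r"
  shows "letter_mult a (letter_mult (inv_letter a) w) = w"
proof (cases w)
  case (Cons b v)
  show ?thesis
    using assms unfolding Cons by (cases v) (auto simp: reduced_words_def)
qed simp

lemma foldr_letter_mult_Nil:
  "w \<in> reduced_words r \<Longrightarrow> foldr letter_mult w [] = w"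
proof (induction w)
  case (Cons a w)
  then show ?case
    by (cases w) (auto simp: reduced_words_def)
qed simp

lemma foldr_letter_mult_step:
  assumes "w \<in> reduced_words r" "set v \<subseteq> letters r"
  shows "foldr letter_mult (letter_mult a v) w = letter_mult a (foldr letter_mult v w)"
proof (cases v)
  case (Cons b v')
  have "foldr letter_mult v' w \<in> reduced_words r"
    using assms Cons by (auto intro: foldr_letter_mult_reduced)
  then show ?thesis
    using Cons by (auto simp: letter_mult_cancel)
qed simp

lemma foldr_letter_mult_assoc:
  assumes "set u \<subseteq> letters r" "v \<in> reduced_words r" "w \<in> reduced_words r"
  shows "foldr letter_mult (foldr letter_mult u v) w = foldr letter_mult u (foldr letter_mult v w)"
  using assms
proof (induction u)
  case (Cons a u)
  have "foldr letter_mult u v \<in> reduced_words r"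
    using Cons.prems by (intro foldr_letter_mult_reduced) auto
  then have "set (foldr letter_mult u v) \<subseteq> letters r"
    by (auto simp: reduced_words_def)
  then show ?case
    using Cons by (simp add: foldr_letter_mult_step)
qed simp

lemma letter_mult_left_inverse:
  assumes "set w \<subseteq> letters r" "v \<in> reduced_words r"
  shows "foldr letter_mult (rev (map inv_letter w)) (foldr letter_mult w v) = v"
  using assms
proof (induction w arbitrary: v)
  case (Cons a w)
  have "foldr letter_mult w v \<in> reduced_words r"
    using Cons.prems by (intro foldr_letter_mult_reduced) auto
  from letter_mult_cancel[OF this, of "inv_letter a"] show ?case
    using Cons by simp
qed simp

lemma group_free_group: "group (free_group r)"
proof (rule groupI)
  fix x assume "x \<in> carrier (free_group r)"
  then have x: "x \<in> reduced_words r" by (simp add: free_group_def)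
  let ?y = "rev (map inv_letter x)"
  have "successively (\<lambda>b a. b \<noteq> inv_letter a) x"
    using x unfolding reduced_words_def by (auto elim!: successively_mono)
  then have y: "?y \<in> reduced_words r"
    using x by (auto simp: reduced_words_def successively_map)
  show "\<exists>y\<in>carrier (free_group r). y \<otimes>\<^bsub>free_group r\<^esub> x = \<one>\<^bsub>free_group r\<^esub>"
    using letter_mult_left_inverse[of x r "[]"] x y foldr_letter_mult_Nil[OF x]
    by (intro bexI[of _ ?y]) (auto simp: free_group_def reduced_words_def)
next
  fix x y z
  assume "x \<in> carrier (free_group r)" "y \<in> carrier (free_group r)" "z \<in> carrier (free_group r)"
  then show "x \<otimes>\<^bsub>free_group r\<^esub> y \<otimes>\<^bsub>free_group r\<^esub> z
      = x \<otimes>\<^bsub>free_group r\<^esub> (y \<otimes>\<^bsub>free_group r\<^esub> z)"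
    using foldr_letter_mult_assoc[of x r y z] by (simp add: free_group_def reduced_words_def)
next
  fix x y
  assume "x \<in> carrier (free_group r)" "y \<in> carrier (free_group r)"
  then show "x \<otimes>\<^bsub>free_group r\<^esub> y \<in> carrier (free_group r)"
    using foldr_letter_mult_reduced[of x r y] by (simp add: free_group_def reduced_words_def)
qed (auto simp: free_group_def reduced_words_def)

lemma generators_inverse:
  assumes "a \<in> letters r"
  shows "[a] \<in> carrier (free_group r)" "inv\<^bsub>free_group r\<^esub> [a] = [inv_letter a]"
proof -
  interpret group "free_group r" by (rule group_free_group)
  show "[a] \<in> carrier (free_group r)"
    using assms by (auto simp: free_group_def reduced_words_def)
  then show "inv\<^bsub>free_group r\<^esub> [a] = [inv_letter a]"
    using assms by (intro inv_equality) (auto simp: free_group_def reduced_words_def)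
qed

text \<open>Each element of \<open>free_group r\<close> is its own reduced expression, hence \<open>b_1 \<cdots> b_j\<close> is \<open>take j g\<close>.\<close>

lemma foldr_mult_generators:
  "foldr (mult (free_group r)) (map (\<lambda>b. [b]) bs) (one (free_group r)) = foldr letter_mult bs []"
  by (induction bs) (auto simp: free_group_def)

lemma reduced_words_take: "g \<in> reduced_words r \<Longrightarrow> take j g \<in> reduced_words r"
  unfolding reduced_words_def
  by (auto dest: in_set_takeD simp: successively_conv_nth)

lemma prefix_product:
  assumes "g \<in> carrier (free_group r)"
  shows "foldr (mult (free_group r)) (map (\<lambda>b. [b]) (take j g)) (one (free_group r)) = take j g"
  using assms reduced_words_take[of g r j]
  unfolding foldr_mult_generators by (intro foldr_letter_mult_Nil) (simp add: free_group_def)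

lemma length_foldr_letter_mult: "length (foldr letter_mult bs w) \<le> length bs + length w"
proof (induction bs)
  case (Cons a bs)
  have "length (letter_mult a u) \<le> Suc (length u)" for u by (cases u) auto
  from this[of "foldr letter_mult bs w"] show ?case using Cons by simp
qed simp

lemma word_length_eq:
  assumes "g \<in> carrier (free_group r)"
  shows "word_length r g = length g"
  unfolding word_length_def
proof (rule Least_equality)
  have "set (map (\<lambda>b. [b]) g) \<subseteq> generators r"
    using assms by (auto simp: generators_def free_group_def reduced_words_def)
  then show "\<exists>ss. set ss \<subseteq> generators r \<and> length ss = length g \<and>
     foldr (mult (free_group r)) ss (one (free_group r)) = g"
    using prefix_product[OF assms, of "length g"] by (intro exI[of _ "map (\<lambda>b. [b]) g"]) simp
next
  fix n
  assume "\<exists>ss. set ss \<subseteq> generators r \<and> length ss = n \<and>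
     foldr (mult (free_group r)) ss (one (free_group r)) = g"
  then obtain ss where ss: "set ss \<subseteq> generators r" "length ss = n"
     "foldr (mult (free_group r)) ss (one (free_group r)) = g" by blast
  have "ss = map (\<lambda>b. [b]) (map hd ss)"
    using ss(1) by (induction ss) (auto simp: generators_def)
  then show "length g \<le> n"
    using ss length_foldr_letter_mult[of "map hd ss" "[]"] foldr_mult_generators[of r "map hd ss"]
    by simp
qed

section \<open>The boundary of the free group and its uniform measure\<close>

definition boundary :: "nat \<Rightarrow> (nat \<Rightarrow> letter) set" where
  "boundary r = {\<xi>. \<forall>i. \<xi> i \<in> letters r \<and> \<xi> (Suc i) \<noteq> inv_letter (\<xi> i)}"

definition cylinder :: "nat \<Rightarrow> letter list \<Rightarrow> (nat \<Rightarrow> letter) set" where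
  "cylinder r w = {\<xi> \<in> boundary r. \<forall>i<length w. \<xi> i = w ! i}"

definition is_boundary_measure :: "nat \<Rightarrow> (nat \<Rightarrow> letter) measure \<Rightarrow> bool" where
  "is_boundary_measure r \<nu> \<longleftrightarrow>
     prob_space \<nu> \<and> space \<nu> = boundary r \<and>
     sets \<nu> = sigma_sets (boundary r) (cylinder r ` (reduced_words r - {[]})) \<and>
     (\<forall>w \<in> reduced_words r - {[]}.
        measure \<nu> (cylinder r w) = 1 / (2 * real r * (2 * real r - 1) ^ (length w - 1)))"

definition boundary_measure :: "nat \<Rightarrow> (nat \<Rightarrow> letter) measure" where
  "boundary_measure r = (THE \<nu>. is_boundary_measure r \<nu>)"

definition word_prefixes :: "(nat \<Rightarrow> letter) \<Rightarrow> nat \<Rightarrow> letter list set" where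
  "word_prefixes \<xi> n = {map \<xi> [0..<k] |k. k \<le> n}"

lemma is_boundary_measure_unique:
  assumes M: "is_boundary_measure r M" and N: "is_boundary_measure r N"
  shows "M = N"
proof -
  let ?C = "cylinder r ` (reduced_words r - {[]})"
  let ?E = "insert {} (insert (boundary r) ?C)"
  interpret M: prob_space M using M by (simp add: is_boundary_measure_def)
  interpret N: prob_space N using N by (simp add: is_boundary_measure_def)
  have sp: "space M = boundary r" "space N = boundary r"
    using M N by (auto simp: is_boundary_measure_def)
  have "sigma_sets (boundary r) ?E = sigma_sets (boundary r) ?C"
    by (rule sigma_sets_eqI) (auto intro: sigma_sets.Basic sigma_sets_top sigma_sets.Empty)
  then have sets: "sets M = sigma_sets (boundary r) ?E" "sets N = sigma_sets (boundary r) ?E"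
    using M N by (auto simp: is_boundary_measure_def)
  have inter: "cylinder r u \<inter> cylinder r v = {} \<or> cylinder r u \<inter> cylinder r v = cylinder r u"
    if "length v \<le> length u" for u v
  proof (cases "\<forall>i<length v. u ! i = v ! i")
    case True
    then show ?thesis using that by (auto simp: cylinder_def)
  next
    case False
    then obtain i where i: "i < length v" "u ! i \<noteq> v ! i" by blast
    then have "i < length u" using that by simp
    then show ?thesis using i by (fastforce simp: cylinder_def)
  qed
  show ?thesis
  proof (rule measure_eqI_generator_eq[where E = ?E and \<Omega> = "boundary r" and A = "\<lambda>_. boundary r"])
    show "Int_stable ?E"
    proof (rule Int_stableI)
      fix A B assume A: "A \<in> ?E" and B: "B \<in> ?E"
      have sub: "X \<subseteq> boundary r" if "X \<in> ?E" for X
        using that by (auto simp: cylinder_def)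
      show "A \<inter> B \<in> ?E"
      proof (cases "A \<in> ?C \<and> B \<in> ?C")
        case True
        then obtain u v where uv: "u \<in> reduced_words r - {[]}" "A = cylinder r u"
          "v \<in> reduced_words r - {[]}" "B = cylinder r v" by blast
        have "A \<inter> B = {} \<or> A \<inter> B = A \<or> A \<inter> B = B"
          using inter[of u v] inter[of v u] uv(2,4) by (metis Int_commute nle_le)
        then show ?thesis using A B by auto
      next
        case False
        then have "A \<inter> B = {} \<or> A \<inter> B = A \<or> A \<inter> B = B"
          using A B sub[OF A] sub[OF B] by blast
        then show ?thesis using A B by auto
      qed
    qed
    show "emeasure M X = emeasure N X" if "X \<in> ?E" for X
    proof -
      have "X = {} \<or> X = boundary r \<or> X \<in> ?C" using that by simp
      then consider "X = {}" | "X = boundary r" | "X \<in> ?C" by metis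
      then show ?thesis
      proof cases
        case 2
        then show ?thesis using M.emeasure_space_1 N.emeasure_space_1 sp by simp
      next
        case 3
        then obtain w where "w \<in> reduced_words r - {[]}" "X = cylinder r w" by blast
        then have "measure M X = measure N X"
          using M N unfolding is_boundary_measure_def by metis
        then show ?thesis
          by (simp add: M.emeasure_eq_measure N.emeasure_eq_measure)
      qed simp
    qed
  qed (use sets in \<open>auto simp: cylinder_def\<close>)
qed

text \<open>Existence: the law of the non-backtracking walk driven by independent uniform choices.\<close>

lemma is_boundary_measure_exists:
  assumes "r \<ge> 1"
  shows "\<exists>\<nu>. is_boundary_measure r \<nu>"
proof -
  define K where "K i = (if i = 0 then {..<2 * r} else {..<2 * r - 1})" for i :: nat
  define N where "N = PiM UNIV (\<lambda>i. uniform_count_measure (K i))"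
  have finL: "finite (letters r)" and cardL: "card (letters r) = 2 * r"
    by (auto simp: letters_def card_cartesian_product)
  have "\<exists>g. bij_betw g {..<2 * r} (letters r)"
    using finL cardL by (metis ex_bij_betw_nat_finite lessThan_atLeast0)
  then obtain g where g: "bij_betw g {..<2 * r} (letters r)" by blast
  have "\<exists>f. bij_betw f {..<2 * r - 1} (letters r - {inv_letter a})" if "a \<in> letters r" for a
  proof -
    have "card (letters r - {inv_letter a}) = 2 * r - 1"
      using that finL cardL by (simp add: card_Diff_singleton)
    then show ?thesis
      using finL by (metis ex_bij_betw_nat_finite finite_Diff lessThan_atLeast0)
  qed
  then obtain f where f: "\<And>a. a \<in> letters r \<Longrightarrow>
      bij_betw (f a) {..<2 * r - 1} (letters r - {inv_letter a})" by metis
  define D :: "(nat \<Rightarrow> nat) \<Rightarrow> nat \<Rightarrow> letter" where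
    "D \<omega> = rec_nat (g (\<omega> 0)) (\<lambda>n a. f a (\<omega> (Suc n)))" for \<omega>
  have D0: "D \<omega> 0 = g (\<omega> 0)" and DS: "D \<omega> (Suc n) = f (D \<omega> n) (\<omega> (Suc n))" for \<omega> n
    by (simp_all add: D_def)
  have finK: "finite (K i)" and neK: "K i \<noteq> {}" for i
    using assms by (auto simp: K_def lessThan_empty_iff)
  interpret P: product_prob_space "\<lambda>i. uniform_count_measure (K i)" UNIV
    by (intro product_prob_spaceI prob_space_uniform_count_measure finK neK)
  have spN: "space N = {\<omega>. \<forall>i. \<omega> i \<in> K i}"
    by (auto simp: N_def space_PiM PiE_def Pi_def space_uniform_count_measure)
  have DL: "D \<omega> n \<in> letters r" if "\<omega> \<in> space N" for \<omega> n
  proof (induction n)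
    case 0
    have "\<omega> 0 \<in> {..<2 * r}" using that by (auto simp: spN K_def split: if_splits)
    then show ?case using g by (auto simp: D0 bij_betw_def)
  next
    case (Suc n)
    have "\<omega> (Suc n) \<in> {..<2 * r - 1}" using that by (auto simp: spN K_def dest: spec[of _ "Suc n"])
    then show ?case using f[OF Suc] by (auto simp: DS bij_betw_def)
  qed
  have KS: "\<omega> (Suc n) \<in> {..<2 * r - 1}" and K0: "\<omega> 0 \<in> {..<2 * r}" if "\<omega> \<in> space N" for \<omega> n
    using that by (auto simp: spN K_def dest: spec[of _ "Suc n"] spec[of _ 0])
  have DB: "D \<omega> \<in> boundary r" if "\<omega> \<in> space N" for \<omega>
  proof -
    have "D \<omega> (Suc i) \<in> letters r - {inv_letter (D \<omega> i)}" for i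
      using bij_betwE[OF f[OF DL[OF that]]] KS[OF that] unfolding DS by blast
    then show ?thesis using DL[OF that] by (auto simp: boundary_def)
  qed
  define \<nu> where
    "\<nu> = distr N (sigma (boundary r) (cylinder r ` (reduced_words r - {[]}))) D"
  have pre: "D -` cylinder r w \<inter> space N \<in> sets N \<and>
      emeasure N (D -` cylinder r w \<inter> space N)
        = ennreal (1 / (2 * real r * (2 * real r - 1) ^ (length w - 1)))"
    if w: "w \<in> reduced_words r" "w \<noteq> []" for w
  proof -
    have wl: "w ! i \<in> letters r" if "i < length w" for i
      using w that by (auto simp: reduced_words_def)
    have wr: "w ! Suc i \<in> letters r - {inv_letter (w ! i)}" if "Suc i < length w" for i
      using w that wl by (auto simp: reduced_words_def successively_conv_nth)
    define k where "k = (\<lambda>i. if i = 0 then inv_into {..<2 * r} g (w ! 0)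
        else inv_into {..<2 * r - 1} (f (w ! (i - 1))) (w ! i))"
    have k0: "k 0 \<in> {..<2 * r}" "g (k 0) = w ! 0"
    proof -
      have "w ! 0 \<in> g ` {..<2 * r}" using g wl[of 0] w by (simp add: bij_betw_def)
      then show "k 0 \<in> {..<2 * r}" "g (k 0) = w ! 0"
        using inv_into_into[of "w ! 0" g "{..<2 * r}"] f_inv_into_f[of "w ! 0" g "{..<2 * r}"]
        unfolding k_def by simp_all
    qed
    have kS: "k (Suc i) \<in> {..<2 * r - 1}" "f (w ! i) (k (Suc i)) = w ! Suc i"
      if "Suc i < length w" for i
    proof -
      have im: "f (w ! i) ` {..<2 * r - 1} = letters r - {inv_letter (w ! i)}"
        using f[of "w ! i"] wl[of i] that by (auto simp: bij_betw_def)
      have "w ! Suc i \<in> f (w ! i) ` {..<2 * r - 1}" using wr[OF that] im by simp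
      then show "k (Suc i) \<in> {..<2 * r - 1}" "f (w ! i) (k (Suc i)) = w ! Suc i"
        using inv_into_into[of "w ! Suc i" "f (w ! i)" "{..<2 * r - 1}"]
          f_inv_into_f[of "w ! Suc i" "f (w ! i)" "{..<2 * r - 1}"]
        unfolding k_def by simp_all
    qed
    have kK: "k i \<in> K i" if "i < length w" for i
      using k0 kS that by (cases i) (auto simp: K_def)
    have step: "(\<forall>i<n. D \<omega> i = w ! i) \<longleftrightarrow> (\<forall>i<n. \<omega> i = k i)"
      if "n \<le> length w" "\<omega> \<in> space N" for n \<omega>
      using that(1)
    proof (induction n)
      case (Suc n)
      have "D \<omega> n = w ! n \<longleftrightarrow> \<omega> n = k n" if *: "\<forall>i<n. D \<omega> i = w ! i"
      proof (cases n)
        case 0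
        have "inj_on g {..<2 * r}" using g by (simp add: bij_betw_def)
        then show ?thesis
          using 0 k0 K0[OF \<open>\<omega> \<in> space N\<close>] by (metis D0 inj_on_eq_iff)
      next
        case (Suc m)
        then have m: "Suc m < length w" "D \<omega> m = w ! m" using Suc.prems * by auto
        have "inj_on (f (w ! m)) {..<2 * r - 1}"
          using f[of "w ! m"] wl[of m] m by (simp add: bij_betw_def)
        then show ?thesis
          using Suc kS[OF m(1)] KS[OF \<open>\<omega> \<in> space N\<close>, of m] m(2) by (metis DS inj_on_eq_iff)
      qed
      then show ?case using Suc by (auto simp: less_Suc_eq)
    qed simp
    have eq: "D -` cylinder r w \<inter> space N
        = {\<omega> \<in> space N. \<forall>i\<in>{..<length w}. \<omega> i \<in> {k i}}"
      using step[of "length w"] DB by (auto simp: cylinder_def)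
    have meas: "{k i} \<in> sets (uniform_count_measure (K i))" if "i \<in> {..<length w}" for i
      using kK[of i] that by (simp add: sets_uniform_count_measure)
    have s: "D -` cylinder r w \<inter> space N \<in> sets N"
      unfolding eq unfolding N_def using meas
      by (intro sets.sets_Collect_finite_All sets_Collect_single')
        (auto simp: sets_uniform_count_measure space_uniform_count_measure)
    have "emeasure N (D -` cylinder r w \<inter> space N)
        = (\<Prod>i<length w. emeasure (uniform_count_measure (K i)) {k i})"
      unfolding eq unfolding N_def using meas by (intro P.emeasure_PiM_Collect) auto
    also have "\<dots> = (\<Prod>i<length w. ennreal (1 / card (K i)))"
      using kK finK by (intro prod.cong) (auto simp: emeasure_uniform_count_measure)
    also have "\<dots> = ennreal (\<Prod>i<length w. 1 / card (K i))"
      by (intro prod_ennreal) auto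
    also obtain m where m: "length w = Suc m" using w(2) by (cases w) auto
    have "(\<Prod>i<length w. 1 / card (K i)) = 1 / (2 * real r * (2 * real r - 1) ^ (length w - 1))"
      unfolding m prod.lessThan_Suc_shift using assms
      by (simp add: K_def of_nat_diff power_one_over)
    finally show ?thesis using s by simp
  qed
  have mD: "D \<in> measurable N (sigma (boundary r) (cylinder r ` (reduced_words r - {[]})))"
  proof (rule measurable_measure_of)
    show "cylinder r ` (reduced_words r - {[]}) \<subseteq> Pow (boundary r)"
      by (auto simp: cylinder_def)
    show "D \<in> space N \<rightarrow> boundary r" using DB by blast
    fix A assume "A \<in> cylinder r ` (reduced_words r - {[]})"
    then obtain w where "w \<in> reduced_words r" "w \<noteq> []" "A = cylinder r w" by blast
    then show "D -` A \<inter> space N \<in> sets N" using pre by blast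
  qed
  have Npr: "prob_space N" unfolding N_def by (rule P.prob_space_axioms)
  have CP: "cylinder r ` (reduced_words r - {[]}) \<subseteq> Pow (boundary r)"
    by (auto simp: cylinder_def)
  have "is_boundary_measure r \<nu>"
    unfolding is_boundary_measure_def
  proof (intro conjI ballI)
    show "prob_space \<nu>" unfolding \<nu>_def by (intro prob_space.prob_space_distr Npr mD)
    show "space \<nu> = boundary r" using CP by (simp add: \<nu>_def)
    show "sets \<nu> = sigma_sets (boundary r) (cylinder r ` (reduced_words r - {[]}))"
      using CP by (simp add: \<nu>_def)
    fix w assume w: "w \<in> reduced_words r - {[]}"
    have "cylinder r w \<in> sets (sigma (boundary r) (cylinder r ` (reduced_words r - {[]})))"
      using CP w by auto
    then have "emeasure \<nu> (cylinder r w) = ennreal (1 / (2 * real r * (2 * real r - 1) ^ (length w - 1)))"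
      using pre[of w] w mD by (simp add: \<nu>_def emeasure_distr)
    then show "measure \<nu> (cylinder r w) = 1 / (2 * real r * (2 * real r - 1) ^ (length w - 1))"
      using assms by (simp add: measure_def)
  qed
  then show ?thesis by blast
qed

lemma boundary_measure:
  assumes "r \<ge> 1"
  shows "is_boundary_measure r (boundary_measure r)"
  unfolding boundary_measure_def
  using is_boundary_measure_exists[OF assms] is_boundary_measure_unique by (metis theI)

section \<open>Actions, partitions and information\<close>

definition standard_borel_space :: "'x measure \<Rightarrow> bool" where
  "standard_borel_space M \<longleftrightarrow>
     (\<exists>T. topspace T = space M \<and> completely_metrizable_space T \<and> separable_space T \<and>
          sets M = sigma_sets (space M) {U. openin T U})"

definition pmp_action :: "('g, 'm) monoid_scheme \<Rightarrow> 'x measure \<Rightarrow> ('g \<Rightarrow> 'x \<Rightarrow> 'x) \<Rightarrow> bool" where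
  "pmp_action G M \<alpha> \<longleftrightarrow> group_action G (space M) \<alpha> \<and>
     (\<forall>g\<in>carrier G. \<alpha> g \<in> measurable M M \<and> distr M M (\<alpha> g) = M)"

definition ergodic_action :: "('g, 'm) monoid_scheme \<Rightarrow> 'x measure \<Rightarrow> ('g \<Rightarrow> 'x \<Rightarrow> 'x) \<Rightarrow> bool" where
  "ergodic_action G M \<alpha> \<longleftrightarrow>
     (\<forall>A\<in>sets M. (\<forall>g\<in>carrier G. \<alpha> g ` A = A) \<longrightarrow> measure M A = 0 \<or> measure M A = 1)"

definition countable_measurable_partition :: "'x measure \<Rightarrow> 'x set set \<Rightarrow> bool" where
  "countable_measurable_partition M P \<longleftrightarrow>
     countable P \<and> P \<subseteq> sets M \<and> partition_on (space M) P"

definition translate :: "('g \<Rightarrow> 'x \<Rightarrow> 'x) \<Rightarrow> 'g \<Rightarrow> 'x set set \<Rightarrow> 'x set set" where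
  "translate \<alpha> g P = (\<lambda>A. \<alpha> g ` A) ` P"

definition translates_join :: "('g \<Rightarrow> 'x \<Rightarrow> 'x) \<Rightarrow> 'x set set \<Rightarrow> 'g set \<Rightarrow> 'x set set" where
  "translates_join \<alpha> P E = common_refinement ((\<lambda>g. translate \<alpha> g P) ` E)"

text \<open>The value may be \<open>\<infinity>\<close>. A null atom contributes \<open>0\<close>, since \<open>ln 0 = 0\<close>.\<close>

definition partition_entropy :: "'x measure \<Rightarrow> 'x set set \<Rightarrow> ennreal" where
  "partition_entropy M Q = (\<Sum>\<^sub>\<infinity>A\<in>Q. ennreal (- (measure M A * ln (measure M A))))"

text \<open>On null atoms the value is \<open>0\<close> instead of \<open>\<infinity>\<close>; for a countable partition
  these atoms together form a null set.\<close>

definition information :: "'x measure \<Rightarrow> 'x set set \<Rightarrow> 'x \<Rightarrow> real" where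
  "information M Q x = - ln (measure M (THE A. A \<in> Q \<and> x \<in> A))"

end

theory Submission
  imports Defs
begin

text \<open>
  On \<open>Y = \<partial>F_r \<times> X\<close> consider the skew product \<open>T (\<xi>, x) = (shift \<xi>, \<xi>_0\<inverse> x)\<close>. The chain rule for
  information turns \<open>J_n (\<xi>, x) = J (P^(F_n \<xi>)) (x)\<close> into \<open>\<Sum>k\<le>n. g_(n - k) \<circ> T^k\<close>, where \<open>g_n (\<xi>, x)\<close>
  is the information of \<open>P\<close> given the translates of \<open>P\<close> by \<open>\<xi>_0, \<dots>, \<xi>_0 \<cdots> \<xi>_(n - 1)\<close>. For fixed
  \<open>\<xi>\<close> the conditional probabilities form a bounded martingale, so \<open>g_n\<close> converges, and the Chung-Neveu
  tail estimate with the moment hypothesis puts \<open>sup g_n\<close> into \<open>L^p\<close> with \<open>p = 1 + \<epsilon>\<^sub>0\<close>. As \<open>T\<close> is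
  ergodic, Breiman's argument gives \<open>J_n / (n + 1) \<longlonglongrightarrow> h\<close> almost everywhere, and by the maximal
  ergodic inequality these quotients are dominated by an integrable function on \<open>Y\<close>. Since the
  average of \<open>J_n (\<xi>, x)\<close> over \<open>\<xi>\<close> is the average over the sphere \<open>S_n\<close>, dominated convergence in
  \<open>\<xi>\<close> for almost every fixed \<open>x\<close>, and on all of \<open>Y\<close>, yields the two other limits.

  For ergodicity, the first-letter averages of a \<open>T\<close>-invariant set form a harmonic family on
  \<open>X\<close>; equality of \<open>L^2\<close> norms forces it to be independent of the letter and invariant under the
  group, hence constant.
\<close>

section \<open>Ergodic theorems for a single transformation\<close>

text \<open>Almost sure convergence of J_n / (n + 1) on Y does not by itself control spherical
  averages: at a fixed x the quotients must be integrated over \<xi>, which calls for a majorant,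
  uniform in n, whose section at x is \<nu>-integrable. The ergodic maximal function of an L^1
  function may fail to be integrable, while that of an L^p function with p > 1 is integrable. This
  is where the moment hypothesis is spent; Fubini then serves almost every x at once. The inverse
  letter in T splits the join along \<xi> at x into P and the pullback of the join along the shifted
  ray. Thus only forward orbits occur and T need not be invertible. The price is that the index n -
  k varies with the orbit point T^k, so Birkhoff's theorem does not apply directly. Martingale
  convergence is applied on each fibre over \<xi>; it is essential that the estimate of sup g_n has
  a bound independent of \<xi>. Single generators need not act ergodically, so ergodicity of T
  cannot be read off one fibre map; all letters have to be compared with each other.\<close>

locale pmp_map = prob_space M for M :: "'a measure" +
  fixes T :: "'a \<Rightarrow> 'a"
  assumes T_measurable [measurable]: "T \<in> measurable M M"
    and distr_T: "distr M M T = M"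
begin

section \<open>Birkhoff sums and maximal inequalities\<close>

definition bsum :: "('a \<Rightarrow> real) \<Rightarrow> nat \<Rightarrow> 'a \<Rightarrow> real" where
  "bsum f n y = (\<Sum>k<n. f ((T ^^ k) y))"

lemma bsum_0 [simp]: "bsum f 0 y = 0"
  by (simp add: bsum_def)

lemma bsum_Suc: "bsum f (Suc n) y = f y + bsum f n (T y)"
  unfolding bsum_def by (subst sum.lessThan_Suc_shift) (simp add: funpow_swap1)

lemma bsum_diff: "bsum (\<lambda>y. f y - g y) n y = bsum f n y - bsum g n y"
  by (simp add: bsum_def sum_subtractf)

lemma bsum_const: "bsum (\<lambda>y. c) n y = real n * c"
  by (simp add: bsum_def)

lemma T_space: "y \<in> space M \<Longrightarrow> T y \<in> space M"
  using T_measurable by (rule measurable_space)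

lemma T_pow_measurable [measurable]: "T ^^ k \<in> measurable M M"
  by (induction k) auto

lemma bsum_measurable [measurable]:
  "f \<in> borel_measurable M \<Longrightarrow> bsum f n \<in> borel_measurable M"
  unfolding bsum_def[abs_def]
  by (intro borel_measurable_sum) (rule measurable_compose[OF T_pow_measurable])

lemma integrable_T:
  fixes f :: "'a \<Rightarrow> real"
  assumes "integrable M f"
  shows "integrable M (\<lambda>y. f (T y))" "(\<integral>y. f (T y) \<partial>M) = (\<integral>y. f y \<partial>M)"
proof -
  have f: "f \<in> borel_measurable M" using assms by simp
  show "integrable M (\<lambda>y. f (T y))"
    using assms integrable_distr_eq[OF T_measurable f] by (simp add: distr_T)
  show "(\<integral>y. f (T y) \<partial>M) = (\<integral>y. f y \<partial>M)"
    using integral_distr[OF T_measurable f] by (simp add: distr_T)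
qed

lemma AE_T_pow: "AE y in M. Q y \<Longrightarrow> AE y in M. Q ((T ^^ k) y)"
proof (induction k arbitrary: Q)
  case (Suc k)
  have "AE y in distr M M T. Q y" unfolding distr_T by (rule Suc.prems)
  then have "AE y in M. Q (T y)" by (rule AE_distrD[OF T_measurable])
  from Suc.IH[OF this] show ?case by simp
qed simp

text \<open>The maximum of \<open>bsum f k y\<close> over k \<le> n, the empty sum included. The
  recursion along the orbit, instead of a \<open>Max\<close>, provides directly the identity on
  which Garsia's proof of the maximal ergodic theorem rests.\<close>

primrec bmax :: "('a \<Rightarrow> real) \<Rightarrow> nat \<Rightarrow> 'a \<Rightarrow> real" where
  "bmax f 0 y = 0"
| "bmax f (Suc n) y = max 0 (f y + bmax f n (T y))"

lemma bmax_nonneg: "0 \<le> bmax f n y"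
  by (cases n) auto

lemma bmax_mono: "bmax f n y \<le> bmax f (Suc n) y"
proof (induction n arbitrary: y)
  case (Suc n)
  from Suc[of "T y"] show ?case by (auto simp del: bmax.simps simp: bmax.simps(2)[of f] intro: max.mono)
qed simp

lemma bmax_mono_le: "m \<le> n \<Longrightarrow> bmax f m y \<le> bmax f n y"
  by (rule lift_Suc_mono_le[of "\<lambda>n. bmax f n y"]) (use bmax_mono in auto)

lemma bsum_le_bmax: "bsum f n y \<le> bmax f n y"
proof (induction n arbitrary: y)
  case (Suc n)
  from Suc[of "T y"] show ?case by (simp add: bsum_Suc)
qed simp

lemma bmax_eq_bsum: "\<exists>k\<le>n. bmax f n y = bsum f k y"
proof (induction n arbitrary: y)
  case (Suc n)
  obtain k where "k \<le> n" "bmax f n (T y) = bsum f k (T y)" using Suc by blast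
  then show ?case
    by (cases "0 \<le> f y + bmax f n (T y)")
      (auto simp: max_def bsum_Suc intro: exI[of _ "Suc k"] exI[of _ 0])
qed auto

lemma bmax_pos_iff: "0 < bmax f n y \<longleftrightarrow> (\<exists>k\<le>n. 0 < bsum f k y)"
  using bmax_eq_bsum[of n f y] bsum_le_bmax[of f _ y] bmax_mono_le[of _ n f y]
  by (metis order_less_le_trans)

lemma bmax_measurable [measurable]:
  "f \<in> borel_measurable M \<Longrightarrow> bmax f n \<in> borel_measurable M"
proof (induction n)
  case (Suc n)
  then have [measurable]: "bmax f n \<in> borel_measurable M" "f \<in> borel_measurable M" by auto
  have "(\<lambda>y. max 0 (f y + bmax f n (T y))) \<in> borel_measurable M" by measurable
  then show ?case by (simp cong: measurable_cong)
next
  case 0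
  have "bmax f 0 = (\<lambda>y. 0)" by (rule ext) simp
  then show ?case by simp
qed

lemma bmax_integrable:
  assumes "integrable M f"
  shows "integrable M (bmax f n)"
proof (induction n)
  case (Suc n)
  have "integrable M (\<lambda>y. max 0 (f y + bmax f n (T y)))"
    using integrable_T(1)[OF Suc] assms by auto
  then show ?case by (simp cong: integrable_cong)
next
  case 0
  show ?case by simp
qed

text \<open>Garsia's argument: where the maximum M_n is positive, f = M_n - M_(n-1) \<circ> T \<ge>
  M_n - M_n \<circ> T; elsewhere M_n = 0 and M_n - M_n \<circ> T \<le> 0. The difference M_n - M_n
  \<circ> T integrates to 0 by invariance.\<close>

lemma maximal_ergodic_finite:
  assumes f: "integrable M f"
  shows "0 \<le> (\<integral>y. f y * indicator {y. 0 < bmax f n y} y \<partial>M)"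
proof -
  have [measurable]: "f \<in> borel_measurable M" using f by simp
  have *: "bmax f n y - bmax f n (T y) \<le> f y * indicator {y. 0 < bmax f n y} y" for y
  proof (cases "0 < bmax f n y")
    case True
    then obtain m where m: "n = Suc m" by (cases n) auto
    have "bmax f n y = f y + bmax f m (T y)" using True by (simp add: m)
    then show ?thesis using True bmax_mono[of f m "T y"] m by simp
  next
    case False
    then show ?thesis using bmax_nonneg[of f n y] bmax_nonneg[of f n "T y"] by simp
  qed
  have int: "integrable M (bmax f n)" by (rule bmax_integrable[OF f])
  have "integrable M (\<lambda>y. f y * indicator ({y. 0 < bmax f n y} \<inter> space M) y)"
    by (intro integrable_real_mult_indicator f) measurable
  then have int2: "integrable M (\<lambda>y. f y * indicator {y. 0 < bmax f n y} y)"
    by (rule Bochner_Integration.integrable_cong[THEN iffD1, rotated 2]) (auto simp: indicator_def)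
  have "0 = (\<integral>y. bmax f n y - bmax f n (T y) \<partial>M)"
    using integrable_T[OF int] int by simp
  also have "\<dots> \<le> (\<integral>y. f y * indicator {y. 0 < bmax f n y} y \<partial>M)"
    using integrable_T[OF int] int int2 * by (intro integral_mono) auto
  finally show ?thesis .
qed

lemma maximal_ergodic:
  assumes f: "integrable M f"
  shows "0 \<le> (\<integral>y. f y * indicator {y. \<exists>n. 0 < bsum f n y} y \<partial>M)"
proof -
  have [measurable]: "f \<in> borel_measurable M" using f by simp
  have "(\<lambda>n. \<integral>y. f y * indicator {y. 0 < bmax f n y} y \<partial>M)
      \<longlonglongrightarrow> (\<integral>y. f y * indicator {y. \<exists>n. 0 < bsum f n y} y \<partial>M)"
  proof (rule integral_dominated_convergence[where w = "\<lambda>y. \<bar>f y\<bar>"])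
    show "AE y in M. (\<lambda>n. f y * indicator {y. 0 < bmax f n y} y)
        \<longlonglongrightarrow> f y * indicator {y. \<exists>n. 0 < bsum f n y} y"
    proof (rule AE_I2)
      fix y
      have "eventually (\<lambda>n. (indicator {y. 0 < bmax f n y} y :: real)
          = indicator {y. \<exists>n. 0 < bsum f n y} y) sequentially"
      proof (cases "\<exists>n. 0 < bsum f n y")
        case True
        then obtain n where "0 < bsum f n y" by blast
        then have "\<forall>m\<ge>n. 0 < bmax f m y" using bmax_pos_iff by blast
        then show ?thesis using True by (auto simp: eventually_sequentially indicator_def)
      next
        case False
        then show ?thesis by (auto simp: bmax_pos_iff indicator_def)
      qed
      then show "(\<lambda>n. f y * indicator {y. 0 < bmax f n y} y)
        \<longlonglongrightarrow> f y * indicator {y. \<exists>n. 0 < bsum f n y} y"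
        by (intro tendsto_mult tendsto_const tendsto_eventually)
    qed
  qed (use f in \<open>auto simp: indicator_def\<close>)
  then show ?thesis
    by (rule LIMSEQ_le_const) (use maximal_ergodic_finite[OF f] in auto)
qed

text \<open>This is \<open>maximal_ergodic\<close> for f - c, whose Birkhoff sums are positive
  exactly when those of f exceed c n. Nonnegativity of f allows the integral over the exceptional
  set to be enlarged to the whole space.\<close>

lemma weak_maximal_inequality:
  assumes f: "integrable M f" "\<And>y. 0 \<le> f y" and c: "0 < c"
  shows "c * prob {y \<in> space M. \<exists>n. c * real n < bsum f n y} \<le> (\<integral>y. f y \<partial>M)"
proof -
  have [measurable]: "f \<in> borel_measurable M" using f by simp
  let ?E = "{y \<in> space M. \<exists>n. c * real n < bsum f n y}"
  have E[measurable]: "?E \<in> sets M" by measurable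
  have iE: "integrable M (indicator ?E :: 'a \<Rightarrow> real)"
    by (rule integrable_real_indicator[OF E]) (simp add: emeasure_eq_measure)
  have "0 \<le> (\<integral>y. (f y - c) * indicator {y. \<exists>n. 0 < bsum (\<lambda>y. f y - c) n y} y \<partial>M)"
    by (rule maximal_ergodic) (use f in auto)
  also have "\<dots> = (\<integral>y. (f y - c) * indicator ?E y \<partial>M)"
    by (intro Bochner_Integration.integral_cong)
      (auto simp: bsum_diff bsum_const indicator_def mult.commute)
  also have "\<dots> \<le> (\<integral>y. f y - c * indicator ?E y \<partial>M)"
  proof (rule integral_mono)
    show "integrable M (\<lambda>y. (f y - c) * indicator ?E y)"
      using f E by (intro integrable_real_mult_indicator) auto
    show "integrable M (\<lambda>y. f y - c * indicator ?E y)"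
      using f(1) iE by (intro Bochner_Integration.integrable_diff integrable_mult_right)
  qed (use f in \<open>auto simp: indicator_def\<close>)
  also have "\<dots> = (\<integral>y. f y \<partial>M) - c * prob ?E"
    using f iE by (subst Bochner_Integration.integral_diff) (auto simp: Int_absorb2)
  finally show ?thesis by simp
qed

text \<open>Values of f up to c / 2 add at most c / 2 to any average, so the truncation
  \<open>h\<close> above c / 2 must exceed the level c / 2. There f \<le> f^p (2 / c)^(p - 1), which
  improves the decay from 1 / c to c^(-p). This is summable over integers c.\<close>

lemma maximal_function_tail:
  assumes f: "integrable M f" "\<And>y. 0 \<le> f y" and p: "1 < p"
    and fp: "integrable M (\<lambda>y. f y powr p)" and c: "0 < c"
  shows "prob {y \<in> space M. \<exists>n. c * real n < bsum f n y} \<le> (2 / c) powr p * (\<integral>y. f y powr p \<partial>M)"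
proof -
  have [measurable]: "f \<in> borel_measurable M" using f by simp
  define h where "h y = f y * indicator {y. c / 2 < f y} y" for y
  have h0: "0 \<le> h y" for y using f by (simp add: h_def)
  have [measurable]: "h \<in> borel_measurable M"
    unfolding h_def[abs_def] indicator_def by measurable
  have hint: "integrable M h"
    by (rule Bochner_Integration.integrable_bound[OF f(1)]) (auto simp: h_def indicator_def)
  have "f y \<le> h y + c / 2" for y
    using c by (simp add: h_def indicator_def)
  then have "bsum f n y \<le> (\<Sum>k<n. h ((T ^^ k) y) + c / 2)" for n y
    unfolding bsum_def by (intro sum_mono)
  then have le: "bsum f n y \<le> bsum h n y + real n * (c / 2)" for n y
    by (simp add: bsum_def sum.distrib)
  have "c / 2 * prob {y \<in> space M. \<exists>n. c * real n < bsum f n y}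
      \<le> c / 2 * prob {y \<in> space M. \<exists>n. c / 2 * real n < bsum h n y}"
  proof (intro mult_left_mono finite_measure_mono)
    show "{y \<in> space M. \<exists>n. c * real n < bsum f n y}
        \<subseteq> {y \<in> space M. \<exists>n. c / 2 * real n < bsum h n y}"
    proof (safe)
      fix y n assume "y \<in> space M" "c * real n < bsum f n y"
      then have "c / 2 * real n < bsum h n y" using le[of n y] by (simp add: algebra_simps)
      then show "\<exists>n. c / 2 * real n < bsum h n y" ..
    qed
  qed (use c in auto)
  also have "\<dots> \<le> (\<integral>y. h y \<partial>M)"
    by (rule weak_maximal_inequality) (use hint h0 c in auto)
  also have "\<dots> \<le> (\<integral>y. f y powr p * (2 / c) powr (p - 1) \<partial>M)"
  proof (rule integral_mono[OF hint])
    show "integrable M (\<lambda>y. f y powr p * (2 / c) powr (p - 1))" using fp by simp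
    fix y
    show "h y \<le> f y powr p * (2 / c) powr (p - 1)"
    proof (cases "c / 2 < f y")
      case True
      then have fy: "0 < f y" using c by simp
      have "1 \<le> (f y * (2 / c)) powr (p - 1)"
      proof (rule ge_one_powr_ge_zero)
        show "1 \<le> f y * (2 / c)" using True c by (simp add: field_simps)
      qed (use p in simp)
      then have "f y \<le> f y * (f y * (2 / c)) powr (p - 1)"
        using fy by simp
      also have "(f y * (2 / c)) powr (p - 1) = f y powr (p - 1) * (2 / c) powr (p - 1)"
        by (rule powr_mult)
      also have "f y * (f y powr (p - 1) * (2 / c) powr (p - 1)) = f y powr p * (2 / c) powr (p - 1)"
        using fy by (simp add: powr_diff)
      finally show ?thesis using True by (simp add: h_def)
    qed (simp add: h_def)
  qed
  finally have "c / 2 * prob {y \<in> space M. \<exists>n. c * real n < bsum f n y}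
      \<le> (2 / c) powr (p - 1) * (\<integral>y. f y powr p \<partial>M)" by (simp add: mult.commute)
  then have "prob {y \<in> space M. \<exists>n. c * real n < bsum f n y}
      \<le> (2 / c) * ((2 / c) powr (p - 1) * (\<integral>y. f y powr p \<partial>M))"
    using c by (simp add: field_simps)
  also have "(2 / c) * ((2 / c) powr (p - 1) * (\<integral>y. f y powr p \<partial>M))
      = (2 / c) powr p * (\<integral>y. f y powr p \<partial>M)"
    using c by (simp add: powr_diff)
  finally show ?thesis .
qed

text \<open>Layer-cake summation of the tail estimate over integer levels. \<open>W\<close> is a
  single integrable majorant for all ergodic averages of f, as dominated convergence will
  require.\<close>

lemma maximal_function_integrable:
  assumes f: "integrable M f" "\<And>y. 0 \<le> f y" and p: "1 < p"
    and fp: "integrable M (\<lambda>y. f y powr p)"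
  obtains W where "integrable M W" "\<And>y. 0 \<le> W y" "AE y in M. \<forall>n. bsum f n y \<le> real n * W y"
proof -
  have [measurable]: "f \<in> borel_measurable M" using f by simp
  define a where "a n y = bsum f n y / real n" for n y
  have [measurable]: "a n \<in> borel_measurable M" for n unfolding a_def[abs_def] by measurable
  define U where "U y = (SUP n. ennreal (a n y))" for y
  have [measurable]: "U \<in> borel_measurable M" unfolding U_def[abs_def] by measurable
  define E where "E j = {y \<in> space M. \<exists>n. real j < a n y}" for j :: nat
  have [measurable]: "E j \<in> sets M" for j unfolding E_def by measurable
  \<comment> \<open>If m is an average rounded up, the point lies in \<open>E 0\<close>, ...,
    \<open>E (m - 1)\<close>, so the number of sets \<open>E j\<close> containing it bounds that
    average.\<close>
  have UE: "U y \<le> (\<Sum>j. indicator (E j) y)" if y: "y \<in> space M" for y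
    unfolding U_def
  proof (rule SUP_least)
    fix n
    define m where "m = nat \<lceil>a n y\<rceil>"
    have "j < m \<Longrightarrow> y \<in> E j" for j
    proof -
      assume "j < m"
      then have "real j < a n y" unfolding m_def by linarith
      then show "y \<in> E j" using y by (auto simp: E_def)
    qed
    then have "(\<Sum>j<m. indicator (E j) y) = (\<Sum>j<m. 1 :: ennreal)"
      by (intro sum.cong) auto
    then have "(\<Sum>j<m. indicator (E j) y :: ennreal) = of_nat m" by simp
    moreover have "ennreal (a n y) \<le> (of_nat m :: ennreal)"
      unfolding m_def by (metis ennreal_leI ennreal_of_nat_eq_real_of_nat real_nat_ceiling_ge)
    moreover have "(\<Sum>j<m. indicator (E j) y) \<le> (\<Sum>j. indicator (E j) y :: ennreal)"
      by (intro sum_le_suminf) auto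
    ultimately show "ennreal (a n y) \<le> (\<Sum>j. indicator (E j) y)" by (metis order_trans)
  qed
  define C where "C = (\<integral>y. f y powr p \<partial>M)"
  have C0: "0 \<le> C" unfolding C_def by simp
  \<comment> \<open>Level 0 gets the trivial bound 1; the tail estimate is available for positive
    levels only.\<close>
  define b where "b j = (if j = 0 then 1 else (2 / real j) powr p * C)" for j :: nat
  have EP: "prob (E j) \<le> b j" for j
  proof (cases "j = 0")
    case False
    have "E j \<subseteq> {y \<in> space M. \<exists>n. real j * real n < bsum f n y}"
    proof safe
      fix y assume "y \<in> E j"
      then obtain n where n: "real j < a n y" "y \<in> space M" by (auto simp: E_def)
      then have "n \<noteq> 0" by (cases "n = 0") (auto simp: a_def)
      then have "real j * real n < bsum f n y" using n by (simp add: a_def field_simps)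
      then show "y \<in> space M" "\<exists>n. real j * real n < bsum f n y" using n by auto
    qed
    then have "prob (E j) \<le> prob {y \<in> space M. \<exists>n. real j * real n < bsum f n y}"
      by (intro finite_measure_mono) auto
    also have "\<dots> \<le> (2 / real j) powr p * C"
      unfolding C_def using False by (intro maximal_function_tail f p fp) auto
    finally show ?thesis using False by (simp add: b_def)
  qed (simp add: b_def)
  have "summable (\<lambda>j. 2 powr p * C * (1 / real j powr p))"
    by (intro summable_mult summable_real_powr_iff[of "-p", THEN iffD2, unfolded powr_minus_divide])
      (use p in auto)
  then have "summable b"
    by (rule summable_cong[THEN iffD1, rotated])
      (auto simp: b_def powr_divide eventually_sequentially intro!: exI[of _ 1])
  have b0: "0 \<le> b j" for j using C0 by (auto simp: b_def)
  have "(\<integral>\<^sup>+y. U y \<partial>M) \<le> (\<integral>\<^sup>+y. (\<Sum>j. indicator (E j) y) \<partial>M)"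
    by (intro nn_integral_mono UE)
  also have "\<dots> = (\<Sum>j. emeasure M (E j))"
    by (subst nn_integral_suminf) auto
  also have "\<dots> \<le> (\<Sum>j. ennreal (b j))"
    by (intro suminf_le) (auto simp: emeasure_eq_measure EP ennreal_leI)
  also have "\<dots> = ennreal (\<Sum>j. b j)"
    by (rule suminf_ennreal2) (use b0 \<open>summable b\<close> in auto)
  finally have fin: "(\<integral>\<^sup>+y. U y \<partial>M) < \<infinity>"
    using ennreal_less_top order_le_less_trans by (metis infinity_ennreal_def)
  then have "AE y in M. U y \<noteq> \<infinity>"
    by (intro nn_integral_PInf_AE) auto
  define W where "W y = enn2real (U y)" for y
  have Wm[measurable]: "W \<in> borel_measurable M" unfolding W_def[abs_def] by measurable
  have "AE y in M. \<forall>n. bsum f n y \<le> real n * W y"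
    using \<open>AE y in M. U y \<noteq> \<infinity>\<close>
  proof eventually_elim
    case (elim y)
    show ?case
    proof
      fix n
      show "bsum f n y \<le> real n * W y"
      proof (cases "n = 0")
        case False
        have "ennreal (a n y) \<le> U y" unfolding U_def by (rule SUP_upper) simp
        also have "U y = ennreal (W y)" using elim by (simp add: W_def less_top)
        finally have "a n y \<le> W y" by (simp add: W_def ennreal_le_iff)
        then show ?thesis using False by (simp add: a_def field_simps)
      qed simp
    qed
  qed
  moreover have "integrable M W"
  proof (rule integrableI_bounded)
    have "(\<integral>\<^sup>+y. ennreal (norm (W y)) \<partial>M) = (\<integral>\<^sup>+y. U y \<partial>M)"
      using \<open>AE y in M. U y \<noteq> \<infinity>\<close>
      by (intro nn_integral_cong_AE) (auto simp: W_def less_top)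
    then show "(\<integral>\<^sup>+y. ennreal (norm (W y)) \<partial>M) < \<infinity>" using fin by simp
  qed simp
  moreover have "0 \<le> W y" for y by (simp add: W_def)
  ultimately show thesis using that by blast
qed

end

section \<open>Pointwise theorems for an ergodic transformation\<close>

locale ergodic_map = pmp_map +
  assumes ergodic: "\<And>E. E \<in> sets M \<Longrightarrow> T -` E \<inter> space M = E \<Longrightarrow> prob E = 0 \<or> prob E = 1"
begin

text \<open>Unboundedness of the sums is unaffected by the first term \<open>f y\<close>, so the set
  where it occurs is strictly invariant. If it had measure 1, the maximal set would be almost the
  whole space and \<open>maximal_ergodic\<close> would contradict the negative integral.\<close>

lemma bsum_bounded_above:
  assumes f: "integrable M f" and neg: "(\<integral>y. f y \<partial>M) < 0"
  shows "AE y in M. \<exists>B::nat. \<forall>n. bsum f n y \<le> real B"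
proof -
  have [measurable]: "f \<in> borel_measurable M" using f by simp
  define A where "A = {y \<in> space M. \<forall>B::nat. \<exists>n. real B < bsum f n y}"
  have [measurable]: "A \<in> sets M" unfolding A_def by measurable
  have inv: "T y \<in> A \<longleftrightarrow> y \<in> A" if y: "y \<in> space M" for y
  proof
    assume a: "y \<in> A"
    show "T y \<in> A" unfolding A_def
    proof (safe intro!: T_space y)
      fix B :: nat
      obtain n where n: "real (B + nat \<lceil>\<bar>f y\<bar>\<rceil>) < bsum f n y" using a unfolding A_def by blast
      then have "0 < bsum f n y" using of_nat_0_le_iff order_le_less_trans by blast
      then obtain m where m: "n = Suc m" by (cases n) auto
      have "real B < bsum f m (T y)"
        using n real_nat_ceiling_ge[of "\<bar>f y\<bar>"] unfolding m bsum_Suc of_nat_add by linarith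
      then show "\<exists>n. real B < bsum f n (T y)" ..
    qed
  next
    assume a: "T y \<in> A"
    show "y \<in> A" unfolding A_def
    proof (safe intro!: y)
      fix B :: nat
      obtain n where n: "real (B + nat \<lceil>\<bar>f y\<bar>\<rceil>) < bsum f n (T y)" using a unfolding A_def by blast
      have "real B < bsum f (Suc n) y"
        using n real_nat_ceiling_ge[of "\<bar>f y\<bar>"] unfolding bsum_Suc of_nat_add by linarith
      then show "\<exists>n. real B < bsum f n y" ..
    qed
  qed
  have "T -` A \<inter> space M = A" using inv by (auto simp: A_def)
  then consider "prob A = 0" | "prob A = 1" using ergodic[of A] by auto
  then show ?thesis
  proof cases
    case 1
    then have "AE y in M. y \<notin> A"
      by (intro AE_not_in) (auto simp: emeasure_eq_measure null_sets_def)
    then show ?thesis by (rule AE_mp) (auto simp: A_def not_less intro!: AE_I2)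
  next
    case 2
    then have "AE y in M. y \<in> A" by (subst (asm) prob_eq_1) auto
    then have "AE y in M. f y * indicator {y. \<exists>n. 0 < bsum f n y} y = f y"
    proof eventually_elim
      case (elim y)
      then have "\<exists>n. 0 < bsum f n y" by (auto simp: A_def dest!: spec[of _ 0])
      then show ?case by simp
    qed
    then have "(\<integral>y. f y * indicator {y. \<exists>n. 0 < bsum f n y} y \<partial>M) = (\<integral>y. f y \<partial>M)"
      by (intro integral_cong_AE) (auto simp: indicator_def)
    then show ?thesis using maximal_ergodic[OF f] neg by simp
  qed
qed

text \<open>Subtracting the mean plus e / 2 leaves a function of integral - e / 2, whose sums are
  bounded above. Divided by n, the bound drops below the other e / 2.\<close>

lemma birkhoff_upper:
  assumes f: "integrable M f" and e: "0 < e"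
  shows "AE y in M. eventually (\<lambda>n. bsum f n y / real n < (\<integral>y. f y \<partial>M) + e) sequentially"
proof -
  define c where "c = (\<integral>y. f y \<partial>M) + e / 2"
  have "AE y in M. \<exists>B::nat. \<forall>n. bsum (\<lambda>y. f y - c) n y \<le> real B"
    by (rule bsum_bounded_above) (use f e in \<open>auto simp: c_def prob_space\<close>)
  then show ?thesis
  proof eventually_elim
    case (elim y)
    then obtain B :: nat where B: "\<And>n. bsum f n y - real n * c \<le> real B"
      by (auto simp: bsum_diff bsum_const)
    have "eventually (\<lambda>n. real B / real n < e / 2) sequentially"
      by (rule order_tendstoD(2)[OF lim_const_over_n]) (use e in simp)
    then show ?case using eventually_gt_at_top[of 0]
    proof eventually_elim
      case (elim n)
      have "bsum f n y / real n \<le> (real n * c + real B) / real n"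
        using B[of n] elim by (intro divide_right_mono) auto
      also have "\<dots> = c + real B / real n" using elim by (simp add: field_simps)
      finally show ?case using elim(1) unfolding c_def by linarith
    qed
  qed
qed

theorem birkhoff:
  assumes f: "integrable M f"
  shows "AE y in M. (\<lambda>n. bsum f n y / real n) \<longlonglongrightarrow> (\<integral>y. f y \<partial>M)"
proof -
  have "AE y in M. \<forall>k::nat. eventually (\<lambda>n. bsum f n y / real n < (\<integral>y. f y \<partial>M) + 1 / Suc k) sequentially"
    by (subst AE_all_countable) (intro allI birkhoff_upper f, simp)
  moreover have "AE y in M. \<forall>k::nat. eventually (\<lambda>n. bsum (\<lambda>y. - f y) n y / real n
      < (\<integral>y. - f y \<partial>M) + 1 / Suc k) sequentially"
    by (subst AE_all_countable) (intro allI birkhoff_upper integrable_minus f, simp)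
  ultimately show ?thesis
  proof eventually_elim
    case (elim y)
    have neg: "bsum (\<lambda>y. - f y) n y = - bsum f n y" for n by (simp add: bsum_def sum_negf)
    show ?case
    proof (rule order_tendstoI)
      fix a assume "a < (\<integral>y. f y \<partial>M)"
      then obtain k where "inverse (of_nat (Suc k)) < (\<integral>y. f y \<partial>M) - a"
        using reals_Archimedean[of "(\<integral>y. f y \<partial>M) - a"] by auto
      then have k: "1 / Suc k < (\<integral>y. f y \<partial>M) - a" by (simp add: inverse_eq_divide)
      show "eventually (\<lambda>n. a < bsum f n y / real n) sequentially"
        using elim(2)[rule_format, of k] by eventually_elim (use k in \<open>simp add: neg\<close>)
    next
      fix a assume "(\<integral>y. f y \<partial>M) < a"
      then obtain k where "inverse (of_nat (Suc k)) < a - (\<integral>y. f y \<partial>M)"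
        using reals_Archimedean[of "a - (\<integral>y. f y \<partial>M)"] by auto
      then have k: "1 / Suc k < a - (\<integral>y. f y \<partial>M)" by (simp add: inverse_eq_divide)
      show "eventually (\<lambda>n. bsum f n y / real n < a) sequentially"
        using elim(1)[rule_format, of k] by eventually_elim (use k in simp)
    qed
  qed
qed


text \<open>The last N terms are negligible in the average, since the averages over
  \<open>Suc n\<close> and \<open>Suc n - N\<close> terms have the same limit. In Maker's theorem
  these are the terms whose function index n - k is below N.\<close>

lemma bsum_tail_tendsto:
  assumes "(\<lambda>n. bsum f n y / real n) \<longlonglongrightarrow> l"
  shows "(\<lambda>n. (bsum f (Suc n) y - bsum f (Suc n - N) y) / real (Suc n)) \<longlonglongrightarrow> 0"
proof -
  have 1: "(\<lambda>n. bsum f (Suc n) y / real (Suc n)) \<longlonglongrightarrow> l"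
    using assms by (rule LIMSEQ_Suc)
  have "filterlim (\<lambda>n. Suc n - N) sequentially sequentially"
    unfolding filterlim_at_top eventually_sequentially
  proof
    fix Z
    show "\<exists>n0. \<forall>n\<ge>n0. Z \<le> Suc n - N" by (rule exI[of _ "Z + N"]) auto
  qed
  have 2: "(\<lambda>n. bsum f (Suc n - N) y / real (Suc n - N)) \<longlonglongrightarrow> l"
    by (rule filterlim_compose[OF assms]) fact
  have 3: "(\<lambda>n. real (Suc n - N) / real (Suc n)) \<longlonglongrightarrow> 1"
  proof (rule Lim_transform_eventually)
    have "(\<lambda>n. real N / real (Suc n)) \<longlonglongrightarrow> 0"
      by (rule LIMSEQ_Suc[OF lim_const_over_n])
    then show "(\<lambda>n. 1 - real N / real (Suc n)) \<longlonglongrightarrow> 1"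
      using tendsto_diff[OF tendsto_const[of 1], of "\<lambda>n. real N / real (Suc n)" 0] by simp
    show "eventually (\<lambda>n. 1 - real N / real (Suc n) = real (Suc n - N) / real (Suc n)) sequentially"
      using eventually_ge_at_top[of N] by eventually_elim (simp add: of_nat_diff field_simps)
  qed
  have "(\<lambda>n. bsum f (Suc n) y / real (Suc n)
      - bsum f (Suc n - N) y / real (Suc n - N) * (real (Suc n - N) / real (Suc n))) \<longlonglongrightarrow> l - l * 1"
    by (intro tendsto_intros 1 2 3)
  moreover have "bsum f (Suc n) y / real (Suc n)
      - bsum f (Suc n - N) y / real (Suc n - N) * (real (Suc n - N) / real (Suc n))
      = (bsum f (Suc n) y - bsum f (Suc n - N) y) / real (Suc n)" for n
    by (cases "Suc n - N = 0") (simp_all add: diff_divide_distrib del: of_nat_Suc of_nat_diff)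
  ultimately show ?thesis by simp
qed

text \<open>The sums are compared with those of the limit \<open>G\<close>, to which
  \<open>birkhoff\<close> applies. Terms with n - k \<ge> N differ from G by at most
  \<open>D N\<close>, whose integral tends to 0 by dominated convergence; the remaining terms, at
  most N in number, are bounded by F. The limit is the integral of G.\<close>

theorem maker_ergodic_theorem:
  fixes g :: "nat \<Rightarrow> 'a \<Rightarrow> real"
  assumes [measurable]: "\<And>n. g n \<in> borel_measurable M"
    and g0: "\<And>n y. 0 \<le> g n y"
    and conv: "AE y in M. convergent (\<lambda>n. g n y)"
    and F: "integrable M F" "\<And>y. 0 \<le> F y" and gF: "AE y in M. \<forall>n. g n y \<le> F y"
  shows "\<exists>h\<ge>0. AE y in M. (\<lambda>n. (\<Sum>k\<le>n. g (n - k) ((T ^^ k) y)) / real (Suc n)) \<longlonglongrightarrow> h"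
proof -
  have [measurable]: "F \<in> borel_measurable M" using F by simp
  define G where "G y = lim (\<lambda>n. g n y)" for y
  have [measurable]: "G \<in> borel_measurable M" unfolding G_def[abs_def] by measurable
  have gG: "AE y in M. (\<lambda>n. g n y) \<longlonglongrightarrow> G y"
    using conv by eventually_elim (simp add: G_def convergent_LIMSEQ_iff)
  have GF: "AE y in M. 0 \<le> G y \<and> G y \<le> F y"
    using gG gF
  proof eventually_elim
    case (elim y)
    then show ?case
      using g0 by (auto intro!: LIMSEQ_le_const[OF elim(1)] LIMSEQ_le_const2[OF elim(1)])
  qed
  have Gint: "integrable M G"
  proof (rule Bochner_Integration.integrable_bound[OF F(1)])
    show "AE y in M. norm (G y) \<le> norm (F y)" using GF by eventually_elim auto
  qed simp
  \<comment> \<open>The supremum of all deviations from index N on, taken in \<open>ennreal\<close>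
    because it may be infinite on a null set. Elsewhere it is at most F, as g and G both lie between
    0 and F.\<close>
  define D where "D N y = enn2real (SUP m\<in>{N..}. ennreal \<bar>g m y - G y\<bar>)" for N y
  have [measurable]: "D N \<in> borel_measurable M" for N unfolding D_def[abs_def] by measurable
  have D0: "0 \<le> D N y" for N y by (simp add: D_def)
  have DF: "AE y in M. \<forall>N. D N y \<le> F y \<and> (\<forall>m. \<bar>g m y - G y\<bar> \<le> F y) \<and> (\<forall>m\<ge>N. \<bar>g m y - G y\<bar> \<le> D N y)"
    using GF gF
  proof eventually_elim
    case (elim y)
    have le: "\<bar>g m y - G y\<bar> \<le> F y" for m
      using elim(1) elim(2)[rule_format, of m] g0[of m y] by linarith
    have sup: "(SUP m\<in>{N..}. ennreal \<bar>g m y - G y\<bar>) \<le> ennreal (F y)" for N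
      by (intro SUP_least ennreal_leI le)
    have fin: "(SUP m\<in>{N..}. ennreal \<bar>g m y - G y\<bar>) < Orderings.top" for N
      using sup[of N] ennreal_less_top order_le_less_trans by blast
    have "D N y \<le> F y" for N
      unfolding D_def using enn2real_mono[OF sup[of N]] F(2) by simp
    moreover have "\<bar>g m y - G y\<bar> \<le> D N y" if "N \<le> m" for N m
    proof -
      have "ennreal \<bar>g m y - G y\<bar> \<le> (SUP m\<in>{N..}. ennreal \<bar>g m y - G y\<bar>)"
        using that by (intro SUP_upper) auto
      then show ?thesis
        unfolding D_def using enn2real_mono[OF _ fin[of N]] by fastforce
    qed
    ultimately show ?case using le by blast
  qed
  have Dint: "integrable M (D N)" for N
    by (rule Bochner_Integration.integrable_bound[OF F(1)]) (use DF D0 F in \<open>auto elim!: eventually_mono\<close>)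
  have "(\<lambda>N. \<integral>y. D N y \<partial>M) \<longlonglongrightarrow> (\<integral>y. 0 \<partial>M)"
  proof (rule integral_dominated_convergence[where w = F])
    show "AE y in M. (\<lambda>N. D N y) \<longlonglongrightarrow> 0"
      using gG
    proof eventually_elim
      case (elim y)
      show ?case
      proof (rule LIMSEQ_I)
        fix e :: real assume "0 < e"
        then obtain N where N: "\<And>m. m \<ge> N \<Longrightarrow> norm (g m y - G y) < e / 2"
          using LIMSEQ_D[OF elim, of "e / 2"] by auto
        have "norm (D n y - 0) < e" if "n \<ge> N" for n
        proof -
          have "(SUP m\<in>{n..}. ennreal \<bar>g m y - G y\<bar>) \<le> ennreal (e / 2)"
          proof (rule SUP_least)
            fix m assume "m \<in> {n..}"
            then have "norm (g m y - G y) < e / 2" using that by (intro N) auto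
            then show "ennreal \<bar>g m y - G y\<bar> \<le> ennreal (e / 2)" by (intro ennreal_leI) auto
          qed
          then have "D n y \<le> e / 2"
            unfolding D_def using enn2real_mono[of _ "ennreal (e / 2)"] \<open>0 < e\<close> by fastforce
          then show ?thesis using D0[of n y] \<open>0 < e\<close> by simp
        qed
        then show "\<exists>N. \<forall>n\<ge>N. norm (D n y - 0) < e" by blast
      qed
    qed
    show "AE y in M. norm (D N y) \<le> F y" for N
      using DF by eventually_elim (use D0 in auto)
  qed (use F in auto)
  then have Dlim: "(\<lambda>N. \<integral>y. D N y \<partial>M) \<longlonglongrightarrow> 0" by simp
  have b1: "AE y in M. \<forall>N. (\<lambda>n. bsum (D N) n y / real n) \<longlonglongrightarrow> (\<integral>y. D N y \<partial>M)"
    by (subst AE_all_countable) (intro allI birkhoff Dint)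
  have b2: "AE y in M. (\<lambda>n. bsum F n y / real n) \<longlonglongrightarrow> (\<integral>y. F y \<partial>M)"
    by (intro birkhoff F)
  have b3: "AE y in M. (\<lambda>n. bsum G n y / real n) \<longlonglongrightarrow> (\<integral>y. G y \<partial>M)"
    by (intro birkhoff Gint)
  have DFT: "AE y in M. \<forall>k N. (\<forall>m. \<bar>g m ((T ^^ k) y) - G ((T ^^ k) y)\<bar> \<le> F ((T ^^ k) y))
      \<and> (\<forall>m\<ge>N. \<bar>g m ((T ^^ k) y) - G ((T ^^ k) y)\<bar> \<le> D N ((T ^^ k) y))"
    unfolding AE_all_countable
  proof (intro allI)
    fix k N
    from AE_T_pow[OF DF, of k]
    show "AE y in M. (\<forall>m. \<bar>g m ((T ^^ k) y) - G ((T ^^ k) y)\<bar> \<le> F ((T ^^ k) y))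
      \<and> (\<forall>m\<ge>N. \<bar>g m ((T ^^ k) y) - G ((T ^^ k) y)\<bar> \<le> D N ((T ^^ k) y))"
      by eventually_elim blast
  qed
  have "AE y in M. (\<lambda>n. (\<Sum>k\<le>n. g (n - k) ((T ^^ k) y)) / real (Suc n)) \<longlonglongrightarrow> (\<integral>y. G y \<partial>M)"
    using b1 b2 b3 DFT
  proof eventually_elim
    case (elim y)
    let ?A = "\<lambda>n. (\<Sum>k\<le>n. g (n - k) ((T ^^ k) y)) / real (Suc n)"
    have bound: "\<bar>?A n - bsum G (Suc n) y / real (Suc n)\<bar>
        \<le> bsum (D N) (Suc n) y / real (Suc n) + (bsum F (Suc n) y - bsum F (Suc n - N) y) / real (Suc n)" for n N
    proof -
      have "\<bar>(\<Sum>k\<le>n. g (n - k) ((T ^^ k) y)) - bsum G (Suc n) y\<bar>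
          \<le> (\<Sum>k\<le>n. \<bar>g (n - k) ((T ^^ k) y) - G ((T ^^ k) y)\<bar>)"
        unfolding bsum_def lessThan_Suc_atMost sum_subtractf[symmetric] by (rule sum_abs)
      \<comment> \<open>For k \<le> n, the condition k < \<open>Suc n - N\<close> says that n - k
        \<ge> N; beyond it only the crude bound F is available.\<close>
      also have "\<dots> \<le> (\<Sum>k\<le>n. D N ((T ^^ k) y) + F ((T ^^ k) y) * (if k < Suc n - N then 0 else 1))"
      proof (rule sum_mono)
        fix k assume k: "k \<in> {..n}"
        show "\<bar>g (n - k) ((T ^^ k) y) - G ((T ^^ k) y)\<bar>
            \<le> D N ((T ^^ k) y) + F ((T ^^ k) y) * (if k < Suc n - N then 0 else 1)"
        proof (cases "k < Suc n - N")
          case True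
          then have "N \<le> n - k" using k by auto
          then show ?thesis using elim(4) True by auto
        next
          case False
          have "\<bar>g (n - k) ((T ^^ k) y) - G ((T ^^ k) y)\<bar> \<le> F ((T ^^ k) y)" using elim(4) by blast
          then show ?thesis using False D0[of N "(T ^^ k) y"] by simp
        qed
      qed
      also have "\<dots> = bsum (D N) (Suc n) y + (bsum F (Suc n) y - bsum F (Suc n - N) y)"
      proof -
        have "(\<Sum>k\<le>n. F ((T ^^ k) y) * (if k < Suc n - N then 0 else 1))
            = (\<Sum>k\<in>{..<Suc n} - {..<Suc n - N}. F ((T ^^ k) y))"
          by (intro sum.mono_neutral_cong_right) auto
        also have "\<dots> = bsum F (Suc n) y - bsum F (Suc n - N) y"
          unfolding bsum_def by (intro sum_diff) auto
        finally show ?thesis by (simp add: sum.distrib bsum_def lessThan_Suc_atMost)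
      qed
      finally have "\<bar>(\<Sum>k\<le>n. g (n - k) ((T ^^ k) y)) - bsum G (Suc n) y\<bar> / real (Suc n)
          \<le> (bsum (D N) (Suc n) y + (bsum F (Suc n) y - bsum F (Suc n - N) y)) / real (Suc n)"
        by (rule divide_right_mono) simp
      then show ?thesis by (simp only: diff_divide_distrib[symmetric] add_divide_distrib[symmetric] abs_divide abs_of_nat)
    qed
    have lim: "(\<lambda>n. bsum (D N) (Suc n) y / real (Suc n)
        + (bsum F (Suc n) y - bsum F (Suc n - N) y) / real (Suc n)) \<longlonglongrightarrow> (\<integral>y. D N y \<partial>M) + 0" for N
      by (intro tendsto_add LIMSEQ_Suc[OF elim(1)[rule_format]] bsum_tail_tendsto[OF elim(2)])
    have "(\<lambda>n. ?A n - bsum G (Suc n) y / real (Suc n)) \<longlonglongrightarrow> 0"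
    proof (rule LIMSEQ_I)
      fix e :: real assume e: "0 < e"
      from order_tendstoD(2)[OF Dlim e] obtain N where N: "(\<integral>y. D N y \<partial>M) < e"
        by (auto simp: eventually_sequentially)
      from N have "(\<integral>y. D N y \<partial>M) + 0 < e" by simp
      from order_tendstoD(2)[OF lim this]
      have "eventually (\<lambda>n. \<bar>?A n - bsum G (Suc n) y / real (Suc n)\<bar> < e) sequentially"
        by (rule eventually_mono) (blast intro: order_le_less_trans[OF bound])
      then show "\<exists>n0. \<forall>n\<ge>n0. norm (?A n - bsum G (Suc n) y / real (Suc n) - 0) < e"
        by (simp add: eventually_sequentially)
    qed
    from tendsto_add[OF this LIMSEQ_Suc[OF elim(3)]] show ?case by simp
  qed
  moreover have "0 \<le> (\<integral>y. G y \<partial>M)"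
    by (rule integral_nonneg_AE) (use GF in \<open>auto elim!: eventually_mono\<close>)
  ultimately show ?thesis by blast
qed

end

section \<open>Convergence of bounded martingales\<close>

text \<open>Kolmogorov's inequality for the martingale and the boundedness in \<open>L^2\<close> give almost sure
  Cauchyness without upcrossings.\<close>

theorem (in prob_space) bounded_martingale_convergent:
  fixes X :: "nat \<Rightarrow> 'a \<Rightarrow> real" and F :: "nat \<Rightarrow> 'a measure"
  assumes sub: "\<And>n. subalgebra M (F n)" and mono: "\<And>m n. m \<le> n \<Longrightarrow> sets (F m) \<subseteq> sets (F n)"
    and X: "\<And>n. X n \<in> borel_measurable (F n)"
    and bound: "\<And>n x. \<bar>X n x\<bar> \<le> 1"
    and mart: "\<And>m n h. m \<le> n \<Longrightarrow> h \<in> borel_measurable (F m) \<Longrightarrow> (\<And>x. \<bar>h x\<bar> \<le> 2) \<Longrightarrow>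
       (\<integral>x. h x * X n x \<partial>M) = (\<integral>x. h x * X m x \<partial>M)"
  shows "AE x in M. convergent (\<lambda>n. X n x)"
proof -
  have meas: "h \<in> borel_measurable (F n)" if "h \<in> borel_measurable (F m)" "m \<le> n" for h :: "'a \<Rightarrow> real" and m n
    using that mono[OF that(2)] sub by (auto simp: measurable_def subalgebra_def)
  have measM: "h \<in> borel_measurable M" if "h \<in> borel_measurable (F m)" for h :: "'a \<Rightarrow> real" and m
    using sub that by (rule measurable_from_subalg)
  note [measurable] = measM[OF X]
  have int: "integrable M h" if "h \<in> borel_measurable M" "\<And>x. \<bar>h x\<bar> \<le> B" for h :: "'a \<Rightarrow> real" and B
    using that by (intro integrable_const_bound[of _ B]) auto
  have b2: "\<bar>X m x - X n x\<bar> \<le> 2" for m n x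
    using bound[of m x] bound[of n x] by linarith
  have sq: "(X m x - X n x)\<^sup>2 \<le> 4" for m n x
    using power_mono[OF b2[of m x n], of 2] by simp
  have sqi: "integrable M (\<lambda>x. indicator R x * (X m x - X n x)\<^sup>2)" if "R \<in> sets M" for R m n
    using that sq by (intro int[of _ 4]) (auto simp: indicator_def)
  have sqi': "integrable M (\<lambda>x. (X m x - X n x)\<^sup>2)" for m n
    using sq by (intro int[of _ 4]) auto
  \<comment> \<open>The bound 2 on test functions, here and in \<open>mart\<close>, is tailored to
    an indicator times a difference of two members of X, the shape needed for
    \<open>pyth\<close>.\<close>
  have orth: "(\<integral>x. h x * (X n x - X m x) \<partial>M) = 0"
    if "m \<le> n" "h \<in> borel_measurable (F m)" "\<And>x. \<bar>h x\<bar> \<le> 2" for m n h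
  proof -
    have [measurable]: "h \<in> borel_measurable M" using measM that by blast
    have "\<bar>h x * X k x\<bar> \<le> 2" for k x
      using mult_mono[OF that(3)[of x] bound[of k x]] by (simp add: abs_mult)
    then have "integrable M (\<lambda>x. h x * X k x)" for k by (intro int[of _ 2]) auto
    then show ?thesis using mart[OF that] by (simp add: right_diff_distrib)
  qed
  have pyth: "(\<integral>x. indicator R x * (X n x - X l x)\<^sup>2 \<partial>M)
      = (\<integral>x. indicator R x * (X n x - X m x)\<^sup>2 \<partial>M) + (\<integral>x. indicator R x * (X m x - X l x)\<^sup>2 \<partial>M)"
    if "l \<le> m" "m \<le> n" "R \<in> sets (F m)" for l m n R
  proof -
    have [measurable]: "R \<in> sets M" using that sub by (auto simp: subalgebra_def)
    let ?h = "\<lambda>x. indicator R x * (X m x - X l x)"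
    have hm: "?h \<in> borel_measurable (F m)"
      using that X[of m] meas[OF X[of l] that(1)] by measurable
    have hb: "\<bar>?h x\<bar> \<le> 2" for x using b2[of m x l] by (auto simp: indicator_def)
    have "\<bar>2 * (?h x * (X n x - X m x))\<bar> \<le> 8" for x
      using mult_mono[OF hb[of x] b2[of n x m]] by (simp add: abs_mult)
    then have i3: "integrable M (\<lambda>x. 2 * (?h x * (X n x - X m x)))"
      by (intro int[of _ 8]) (auto simp: abs_mult)
    have "(\<integral>x. indicator R x * (X n x - X l x)\<^sup>2 \<partial>M)
        = (\<integral>x. indicator R x * (X n x - X m x)\<^sup>2 + indicator R x * (X m x - X l x)\<^sup>2
            + 2 * (?h x * (X n x - X m x)) \<partial>M)"
      by (intro Bochner_Integration.integral_cong) (auto simp: power2_eq_square algebra_simps)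
    also have "\<dots> = (\<integral>x. indicator R x * (X n x - X m x)\<^sup>2 \<partial>M) + (\<integral>x. indicator R x * (X m x - X l x)\<^sup>2 \<partial>M)
        + (\<integral>x. 2 * (?h x * (X n x - X m x)) \<partial>M)"
      using sqi i3 \<open>R \<in> sets M\<close> by (simp only: Bochner_Integration.integral_add Bochner_Integration.integrable_add)
    also have "(\<integral>x. 2 * (?h x * (X n x - X m x)) \<partial>M) = 0"
      using orth[OF that(2) hm hb] by simp
    finally show ?thesis by simp
  qed
  have maxineq: "c\<^sup>2 * prob {x \<in> space M. \<exists>m\<in>{l..n}. c < \<bar>X m x - X l x\<bar>} \<le> (\<integral>x. (X n x - X l x)\<^sup>2 \<partial>M)"
    if c: "0 < c" and "l \<le> n" for l n c
  proof -
    \<comment> \<open>Points whose deviation from \<open>X l\<close> first exceeds c at time m. This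
      is decided by time m, so \<open>pyth\<close> applies on \<open>R m\<close>: later increments
      can only increase the integral of the square.\<close>
    define R where "R m = {x \<in> space M. c < \<bar>X m x - X l x\<bar> \<and> (\<forall>k\<in>{l..<m}. \<not> c < \<bar>X k x - X l x\<bar>)}" for m
    have RF: "R m \<in> sets (F m)" if "l \<le> m" for m
    proof -
      have sp: "space M = space (F m)" using sub by (simp add: subalgebra_def)
      have [measurable]: "X k \<in> borel_measurable (F m)" if "k \<le> m" for k using meas[OF X that] .
      have [measurable]: "X l \<in> borel_measurable (F m)" using meas[OF X that] .
      have "Measurable.pred (F m) (\<lambda>x. \<not> c < \<bar>X k x - X l x\<bar>)" if "k \<in> {l..<m}" for k
      proof -
        have [measurable]: "X k \<in> borel_measurable (F m)" using meas[OF X, of k m] that by auto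
        show ?thesis by measurable
      qed
      then have "Measurable.pred (F m) (\<lambda>x. \<forall>k\<in>{l..<m}. \<not> c < \<bar>X k x - X l x\<bar>)"
        by (intro pred_intros_finite) auto
      then show ?thesis using X[of m] unfolding R_def sp by measurable
    qed
    have RM: "R m \<in> sets M" if "l \<le> m" for m
      using RF[OF that] sub by (auto simp: subalgebra_def)
    have disj: "disjoint_family_on R {l..n}"
    proof (unfold disjoint_family_on_def, intro ballI impI)
      fix i j assume "i \<in> {l..n}" "j \<in> {l..n}" "i \<noteq> j"
      then show "R i \<inter> R j = {}" by (cases i j rule: linorder_cases) (auto simp: R_def)
    qed
    have un: "{x \<in> space M. \<exists>m\<in>{l..n}. c < \<bar>X m x - X l x\<bar>} = (\<Union>m\<in>{l..n}. R m)"
    proof (intro Set.set_eqI iffI)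
      fix x assume "x \<in> {x \<in> space M. \<exists>m\<in>{l..n}. c < \<bar>X m x - X l x\<bar>}"
      then obtain m where m: "x \<in> space M" "m \<in> {l..n}" "c < \<bar>X m x - X l x\<bar>" by blast
      define k where "k = (LEAST k. l \<le> k \<and> c < \<bar>X k x - X l x\<bar>)"
      have k: "l \<le> k \<and> c < \<bar>X k x - X l x\<bar>" unfolding k_def by (rule LeastI[of _ m]) (use m in auto)
      have "k \<le> m" unfolding k_def by (rule Least_le) (use m in auto)
      moreover have "\<not> c < \<bar>X j x - X l x\<bar>" if "j \<in> {l..<k}" for j
        using not_less_Least[of j "\<lambda>k. l \<le> k \<and> c < \<bar>X k x - X l x\<bar>"] that by (auto simp: k_def[symmetric])
      ultimately show "x \<in> (\<Union>m\<in>{l..n}. R m)" using k m by (auto simp: R_def)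
    qed (auto simp: R_def)
    have "c\<^sup>2 * prob (R m) \<le> (\<integral>x. indicator (R m) x * (X n x - X l x)\<^sup>2 \<partial>M)" if m: "m \<in> {l..n}" for m
    proof -
      have Rm: "R m \<in> sets M" using RM m by auto
      have "c\<^sup>2 * prob (R m) = (\<integral>x. indicator (R m) x * c\<^sup>2 \<partial>M)"
        using sets.sets_into_space[OF Rm] by (simp add: Int_absorb2)
      also have "\<dots> \<le> (\<integral>x. indicator (R m) x * (X m x - X l x)\<^sup>2 \<partial>M)"
      proof (rule integral_mono)
        fix x
        show "indicator (R m) x * c\<^sup>2 \<le> indicator (R m) x * (X m x - X l x)\<^sup>2"
        proof (cases "x \<in> R m")
          case True
          then have "c \<le> \<bar>X m x - X l x\<bar>" by (simp add: R_def)
          from power_mono[OF this, of 2] True c show ?thesis by simp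
        qed simp
      qed (use sqi Rm in \<open>auto simp: emeasure_eq_measure\<close>)
      also have "\<dots> \<le> (\<integral>x. indicator (R m) x * (X n x - X l x)\<^sup>2 \<partial>M)"
        using pyth[of l m n "R m"] RF[of m] m by simp
      finally show ?thesis .
    qed
    then have "(\<Sum>m\<in>{l..n}. c\<^sup>2 * prob (R m)) \<le> (\<Sum>m\<in>{l..n}. \<integral>x. indicator (R m) x * (X n x - X l x)\<^sup>2 \<partial>M)"
      by (rule sum_mono)
    also have "\<dots> = (\<integral>x. (\<Sum>m\<in>{l..n}. indicator (R m) x * (X n x - X l x)\<^sup>2) \<partial>M)"
      by (rule Bochner_Integration.integral_sum[symmetric]) (use sqi RM in auto)
    also have "\<dots> \<le> (\<integral>x. (X n x - X l x)\<^sup>2 \<partial>M)"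
    proof (rule integral_mono)
      fix x
      have "(\<Sum>m\<in>{l..n}. indicator (R m) x) = (indicator (\<Union>m\<in>{l..n}. R m) x :: real)"
        using disj by (simp add: indicator_UN_disjoint)
      then show "(\<Sum>m\<in>{l..n}. indicator (R m) x * (X n x - X l x)\<^sup>2) \<le> (X n x - X l x)\<^sup>2"
        by (simp add: sum_distrib_right[symmetric] mult_left_le_one_le indicator_def)
    next
      show "integrable M (\<lambda>x. \<Sum>m\<in>{l..n}. indicator (R m) x * (X n x - X l x)\<^sup>2)"
        by (rule Bochner_Integration.integrable_sum) (use sqi RM in auto)
    qed (rule sqi')
    finally have "c\<^sup>2 * (\<Sum>m\<in>{l..n}. prob (R m)) \<le> (\<integral>x. (X n x - X l x)\<^sup>2 \<partial>M)"
      by (simp add: sum_distrib_left)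
    also have "(\<Sum>m\<in>{l..n}. prob (R m)) = prob (\<Union>m\<in>{l..n}. R m)"
      by (rule finite_measure_finite_Union[symmetric]) (use RM disj in auto)
    finally show ?thesis unfolding un .
  qed
  \<comment> \<open>By \<open>pyth\<close>, increments of \<open>a\<close> are the squared L^2
    distances between members of X. So \<open>a\<close> is increasing and bounded by 4, and the
    maximal inequality from time l on is controlled by the remainder a' -
    \<open>a l\<close>.\<close>
  define a where "a n = (\<integral>x. (X n x - X 0 x)\<^sup>2 \<partial>M)" for n
  have diff: "(\<integral>x. (X n x - X l x)\<^sup>2 \<partial>M) = a n - a l" if "l \<le> n" for l n
  proof -
    have i: "(\<integral>x. indicator (space M) x * (X n x - X m x)\<^sup>2 \<partial>M) = (\<integral>x. (X n x - X m x)\<^sup>2 \<partial>M)" for m n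
      by (intro Bochner_Integration.integral_cong) auto
    have "space M \<in> sets (F l)" using sub[of l] by (metis subalgebra_def sets.top)
    from pyth[of 0 l n "space M", unfolded i, OF _ that this] show ?thesis by (simp add: a_def)
  qed
  have "convergent a"
  proof (rule Bseq_mono_convergent)
    show "Bseq a"
    proof (rule BseqI'[of _ 4])
      fix n
      have "a n \<le> (\<integral>x. 4 \<partial>M)" unfolding a_def using sq sqi' by (intro integral_mono) auto
      moreover have "0 \<le> a n" unfolding a_def by simp
      ultimately show "norm (a n) \<le> 4" by (simp add: prob_space)
    qed
    show "\<forall>m n. m \<le> n \<longrightarrow> a m \<le> a n"
    proof (intro allI impI)
      fix m n :: nat assume "m \<le> n"
      have "0 \<le> (\<integral>x. (X n x - X m x)\<^sup>2 \<partial>M)" by simp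
      then show "a m \<le> a n" using diff[OF \<open>m \<le> n\<close>] by simp
    qed
  qed
  then obtain a' where a': "a \<longlonglongrightarrow> a'" by (auto simp: convergent_def)
  have amono: "a n \<le> a'" for n
  proof (rule LIMSEQ_le_const[OF a'])
    have "a n \<le> a m" if "n \<le> m" for m
    proof -
      have "0 \<le> (\<integral>x. (X m x - X n x)\<^sup>2 \<partial>M)" by simp
      then show ?thesis using diff[OF that] by simp
    qed
    then show "\<exists>N. \<forall>m\<ge>N. a n \<le> a m" by blast
  qed
  define E where "E c l = {x \<in> space M. \<exists>m\<in>{l..}. c < \<bar>X m x - X l x\<bar>}" for c l
  have [measurable]: "E c l \<in> sets M" for c l unfolding E_def by measurable
  have Eb: "c\<^sup>2 * prob (E c l) \<le> a' - a l" if c: "0 < c" for c l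
  proof -
    let ?S = "\<lambda>n. {x \<in> space M. \<exists>m\<in>{l..n}. c < \<bar>X m x - X l x\<bar>}"
    have "(\<lambda>n. prob (?S n)) \<longlonglongrightarrow> prob (\<Union>n. ?S n)"
    proof (rule finite_Lim_measure_incseq)
      show "range ?S \<subseteq> sets M" by auto measurable
      show "incseq ?S" by (rule incseq_SucI) auto
    qed
    also have "(\<Union>n. ?S n) = E c l" unfolding E_def by (auto intro!: exI[of _ ] bexI)
    finally have lim: "(\<lambda>n. c\<^sup>2 * prob (?S n)) \<longlonglongrightarrow> c\<^sup>2 * prob (E c l)" by (intro tendsto_intros)
    show ?thesis
    proof (rule LIMSEQ_le_const2[OF lim])
      have "c\<^sup>2 * prob (?S n) \<le> a' - a l" if "l \<le> n" for n
        using maxineq[OF c that] diff[OF that] amono[of n] by simp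
      then show "\<exists>N. \<forall>n\<ge>N. c\<^sup>2 * prob (?S n) \<le> a' - a l" by blast
    qed
  qed
  have null: "AE x in M. \<exists>l. x \<notin> E c l" if c: "0 < c" for c
  proof -
    have [measurable]: "(\<Inter>l. E c l) \<in> sets M" by measurable
    have "(\<lambda>l. (a' - a l) / c\<^sup>2) \<longlonglongrightarrow> (a' - a') / c\<^sup>2"
      by (intro tendsto_intros a') (use c in auto)
    then have "prob (\<Inter>l. E c l) \<le> (a' - a') / c\<^sup>2"
    proof (rule LIMSEQ_le_const)
      have "prob (\<Inter>l. E c l) \<le> (a' - a l) / c\<^sup>2" for l
      proof -
        have "prob (\<Inter>l. E c l) \<le> prob (E c l)" by (rule finite_measure_mono) auto
        also have "\<dots> \<le> (a' - a l) / c\<^sup>2" using Eb[OF c, of l] c by (simp add: field_simps)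
        finally show ?thesis .
      qed
      then show "\<exists>N. \<forall>n\<ge>N. prob (\<Inter>l. E c l) \<le> (a' - a n) / c\<^sup>2" by blast
    qed
    then have "prob (\<Inter>l. E c l) = 0" by (simp add: measure_le_0_iff)
    then have "AE x in M. x \<notin> (\<Inter>l. E c l)"
      by (intro AE_not_in) (auto simp: emeasure_eq_measure null_sets_def)
    then show ?thesis by eventually_elim auto
  qed
  have "AE x in M. \<forall>k::nat. \<exists>l. x \<notin> E (1 / real (Suc k)) l"
    by (subst AE_all_countable) (intro allI null, simp)
  then show ?thesis using AE_space
  proof eventually_elim
    case (elim x)
    have "Cauchy (\<lambda>n. X n x)"
    proof (rule metric_CauchyI)
      fix e :: real assume e: "0 < e"
      obtain k where k: "inverse (of_nat (Suc k)) < e / 2" using reals_Archimedean[of "e / 2"] e by auto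
      obtain l where "x \<notin> E (1 / real (Suc k)) l" using elim(1) by blast
      then have l: "\<bar>X m x - X l x\<bar> \<le> 1 / real (Suc k)" if "l \<le> m" for m
        using elim(2) that by (auto simp: E_def not_less)
      have "dist (X m x) (X n x) < e" if "l \<le> m" "l \<le> n" for m n
        using l[OF that(1)] l[OF that(2)] k by (simp add: dist_real_def inverse_eq_divide)
      then show "\<exists>M. \<forall>m\<ge>M. \<forall>n\<ge>M. dist (X m x) (X n x) < e" by blast
    qed
    then show ?case by (simp add: Cauchy_convergent_iff)
  qed
qed

section \<open>Information along a filtration of countable partitions\<close>

text \<open>A countable partition given as the map from a point to its cell. In this form joins are
  pointwise intersections, pullbacks are preimages, and quantities such as the mass of a cell are
  functions of the point.\<close>

locale countable_cells = prob_space M for M :: "'a measure" +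
  fixes C :: "'a \<Rightarrow> 'a set"
  assumes cell_sets: "x \<in> space M \<Longrightarrow> C x \<in> sets M"
    and cell_self: "x \<in> space M \<Longrightarrow> x \<in> C x"
    and cell_eq: "x \<in> space M \<Longrightarrow> y \<in> C x \<Longrightarrow> C y = C x"
    and cell_count: "countable (C ` space M)"
begin

lemma vimage_cells: "C -` S \<inter> space M = (\<Union>D\<in>C ` space M \<inter> S. D)"
proof (intro Set.set_eqI iffI)
  fix x assume "x \<in> (\<Union>D\<in>C ` space M \<inter> S. D)"
  then obtain y where y: "y \<in> space M" "C y \<in> S" "x \<in> C y" by auto
  then have "x \<in> space M" using cell_sets[of y] sets.sets_into_space by blast
  then show "x \<in> C -` S \<inter> space M" using cell_eq[OF y(1,3)] y by auto
qed (use cell_self in auto)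

lemma cells_disjoint: "disjoint_family_on (\<lambda>D. D) (C ` space M \<inter> S)"
  unfolding disjoint_family_on_def
  by safe (metis IntI cell_eq empty_iff)+

lemma cell_measurable [measurable]: "C \<in> measurable M (count_space UNIV)"
  unfolding measurable_def
proof safe
  fix S
  have "(\<Union>D\<in>C ` space M \<inter> S. D) \<in> sets M"
    by (rule sets.countable_UN'') (use cell_count cell_sets in auto)
  then show "C -` S \<inter> space M \<in> sets M" by (simp add: vimage_cells)
qed simp

lemma emeasure_vimage_cells:
  assumes N: "sets N = sets M"
  shows "emeasure N (C -` S \<inter> space M) = (\<integral>\<^sup>+D. emeasure N D \<partial>count_space (C ` space M \<inter> S))"
  unfolding vimage_cells
  by (rule emeasure_UN_countable)
    (use cell_count cell_sets cells_disjoint in \<open>auto simp: N\<close>)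

text \<open>Its sets are arbitrary unions of cells, so its measurable functions include every
  function of the cell; there being countably many cells, all of them are measurable in M.\<close>

definition cell_algebra :: "'a measure" where
  "cell_algebra = vimage_algebra (space M) C (count_space UNIV)"

lemma sets_cell_algebra: "sets cell_algebra = {C -` S \<inter> space M | S. True}"
  by (simp add: cell_algebra_def sets_vimage_algebra2)

lemma subalgebra_cell_algebra: "subalgebra M cell_algebra"
  unfolding subalgebra_def
proof
  show "space cell_algebra = space M" by (simp add: cell_algebra_def)
  show "sets cell_algebra \<subseteq> sets M"
    using measurable_sets[OF cell_measurable] by (auto simp: sets_cell_algebra)
qed

lemma measurable_cell_algebra: "(\<lambda>x. f (C x)) \<in> measurable cell_algebra N \<longleftrightarrow> f \<in> C ` space M \<rightarrow> space N"
proof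
  assume *: "f \<in> C ` space M \<rightarrow> space N"
  show "(\<lambda>x. f (C x)) \<in> measurable cell_algebra N"
  proof (rule measurableI)
    fix A assume "A \<in> sets N"
    have "(\<lambda>x. f (C x)) -` A \<inter> space cell_algebra = C -` (f -` A) \<inter> space M"
      by (auto simp: cell_algebra_def)
    then show "(\<lambda>x. f (C x)) -` A \<inter> space cell_algebra \<in> sets cell_algebra"
      by (auto simp: sets_cell_algebra)
  qed (use * in \<open>auto simp: cell_algebra_def\<close>)
next
  assume "(\<lambda>x. f (C x)) \<in> measurable cell_algebra N"
  from measurable_space[OF this] show "f \<in> C ` space M \<rightarrow> space N"
    by (auto simp: cell_algebra_def)
qed

text \<open>An everywhere defined version of the conditional probability of A given
  \<open>cell_algebra\<close>. On null cells division by zero gives 0, which is harmless because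
  these cells form a null set.\<close>

definition cond_prob_cell :: "'a set \<Rightarrow> 'a \<Rightarrow> real" where
  "cond_prob_cell A x = prob (A \<inter> C x) / prob (C x)"

lemma cond_prob_cell_bounds:
  assumes "A \<in> sets M" "x \<in> space M"
  shows "0 \<le> cond_prob_cell A x" "cond_prob_cell A x \<le> 1"
proof -
  have "prob (A \<inter> C x) \<le> prob (C x)"
    by (intro finite_measure_mono) (use cell_sets assms in auto)
  then show "0 \<le> cond_prob_cell A x" "cond_prob_cell A x \<le> 1"
    by (auto simp: cond_prob_cell_def divide_le_eq_1 measure_le_0_iff zero_less_measure_iff)
qed

lemma cond_prob_cell_measurable_cell_algebra:
  "cond_prob_cell A \<in> borel_measurable cell_algebra"
  unfolding cond_prob_cell_def[abs_def]
  using measurable_cell_algebra[of "\<lambda>D. prob (A \<inter> D) / prob D" borel] by simp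

lemma cond_prob_cell_measurable [measurable]: "cond_prob_cell A \<in> borel_measurable M"
  by (rule measurable_from_subalg[OF subalgebra_cell_algebra cond_prob_cell_measurable_cell_algebra])

text \<open>Both sides are measures in R. They agree on each cell, null cells having no mass on
  either side, and hence on countable unions of cells.\<close>

lemma nn_integral_cond_prob_cell:
  assumes A: "A \<in> sets M" and R: "R \<in> sets cell_algebra"
  shows "(\<integral>\<^sup>+x. ennreal (cond_prob_cell A x) * indicator R x \<partial>M) = emeasure M (A \<inter> R)"
proof -
  obtain S where S: "R = C -` S \<inter> space M" using R by (auto simp: sets_cell_algebra)
  have RM: "R \<in> sets M" using R subalgebra_cell_algebra by (auto simp: subalgebra_def)
  let ?N = "density M (\<lambda>x. ennreal (cond_prob_cell A x))" and ?L = "density M (indicator A)"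
  have cell: "emeasure ?N D = emeasure ?L D" if DC: "D \<in> C ` space M" for D
  proof -
    obtain y where y: "y \<in> space M" "D = C y" using DC by blast
    have D[measurable]: "D \<in> sets M" using cell_sets y by auto
    have "emeasure ?N D = (\<integral>\<^sup>+x. ennreal (cond_prob_cell A x) * indicator D x \<partial>M)"
      by (simp add: emeasure_density)
    also have "\<dots> = (\<integral>\<^sup>+x. ennreal (prob (A \<inter> D) / prob D) * indicator D x \<partial>M)"
      using cell_eq[OF y(1)] y(2)
      by (intro nn_integral_cong) (auto simp: cond_prob_cell_def indicator_def)
    also have "\<dots> = ennreal (prob (A \<inter> D) / prob D) * ennreal (prob D)"
      by (simp add: nn_integral_cmult emeasure_eq_measure)
    also have "\<dots> = ennreal (prob (A \<inter> D) / prob D * prob D)"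
      by (rule ennreal_mult[symmetric]) auto
    also have "prob (A \<inter> D) / prob D * prob D = prob (A \<inter> D)"
    proof (cases "prob D = 0")
      case True
      have "prob (A \<inter> D) \<le> prob D" by (rule finite_measure_mono) auto
      then have "prob (A \<inter> D) = 0" using True by (simp add: measure_le_0_iff)
      then show ?thesis by simp
    qed simp
    also have "ennreal (prob (A \<inter> D)) = emeasure ?L D"
      using A by (simp add: emeasure_density emeasure_eq_measure flip: indicator_inter_arith)
    finally show ?thesis .
  qed
  have "emeasure ?N R = emeasure ?L R"
    unfolding S using cell
    by (simp add: emeasure_vimage_cells cong: nn_integral_cong_simp)
  then show ?thesis
    using RM A by (simp add: emeasure_density emeasure_eq_measure flip: indicator_inter_arith)
qed

lemma integral_cond_prob_cell_set:
  assumes A: "A \<in> sets M" and R: "R \<in> sets cell_algebra"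
  shows "(\<integral>x. cond_prob_cell A x * indicator R x \<partial>M) = prob (A \<inter> R)"
proof -
  have RM[measurable]: "R \<in> sets M" using R subalgebra_cell_algebra by (auto simp: subalgebra_def)
  have "(\<integral>x. cond_prob_cell A x * indicator R x \<partial>M)
      = enn2real (\<integral>\<^sup>+x. ennreal (cond_prob_cell A x * indicator R x) \<partial>M)"
    by (rule integral_eq_nn_integral) (use cond_prob_cell_bounds[OF A] in auto)
  also have "(\<integral>\<^sup>+x. ennreal (cond_prob_cell A x * indicator R x) \<partial>M)
      = (\<integral>\<^sup>+x. ennreal (cond_prob_cell A x) * indicator R x \<partial>M)"
    by (intro nn_integral_cong) (auto simp: indicator_def)
  finally show ?thesis by (simp add: nn_integral_cond_prob_cell[OF A R] measure_def)
qed

text \<open>Uniqueness of conditional expectations passes from sets of the algebra to bounded test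
  functions. Applied at two levels with the same h, it yields the martingale property.\<close>

lemma integral_cond_prob_cell:
  assumes A: "A \<in> sets M" and h: "h \<in> borel_measurable cell_algebra" and b: "\<And>x. \<bar>h x\<bar> \<le> (B::real)"
  shows "(\<integral>x. h x * cond_prob_cell A x \<partial>M) = (\<integral>x. h x * indicator A x \<partial>M)"
proof -
  note sub = subalgebra_cell_algebra
  interpret S: finite_measure_subalgebra M cell_algebra
    by unfold_locales (rule sub)
  have [measurable]: "h \<in> borel_measurable M" by (rule measurable_from_subalg[OF sub h])
  have iA: "integrable M (indicator A :: 'a \<Rightarrow> real)"
    using A by (intro integrable_real_indicator) (auto simp: emeasure_eq_measure)
  have iC: "integrable M (cond_prob_cell A)"
    by (rule integrable_const_bound[of _ 1]) (use cond_prob_cell_bounds[OF A] in auto)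
  have "AE x in M. real_cond_exp M cell_algebra (indicator A) x = cond_prob_cell A x"
  proof (rule S.real_cond_exp_charact)
    fix R assume R: "R \<in> sets cell_algebra"
    then have "R \<in> sets M" using sub by (auto simp: subalgebra_def)
    then show "(\<integral>x\<in>R. indicator A x \<partial>M) = (\<integral>x\<in>R. cond_prob_cell A x \<partial>M)"
      using integral_cond_prob_cell_set[OF A R] A
      by (simp add: set_lebesgue_integral_def mult.commute flip: indicator_inter_arith)
  qed (use iA iC cond_prob_cell_measurable_cell_algebra in auto)
  then have "(\<integral>x. h x * cond_prob_cell A x \<partial>M)
      = (\<integral>x. h x * real_cond_exp M cell_algebra (indicator A) x \<partial>M)"
    by (intro integral_cong_AE) auto
  also have "\<dots> = (\<integral>x. h x * indicator A x \<partial>M)"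
  proof (rule S.real_cond_exp_intg(2))
    show "integrable M (\<lambda>x. h x * indicator A x)"
      by (rule Bochner_Integration.integrable_bound[OF integrable_const[of "\<bar>B\<bar>"]])
        (use A in \<open>auto simp: indicator_def intro: order_trans[OF b] order_trans[OF _ abs_ge_self]\<close>)
  qed (use h A in auto)
  finally show ?thesis .
qed

end

section \<open>Conditional probabilities along a nested sequence of partitions\<close>

locale cell_filtration = prob_space M for M :: "'a measure" +
  fixes B :: "nat \<Rightarrow> 'a \<Rightarrow> 'a set"
  assumes cells: "countable_cells M (B n)"
    and nested: "x \<in> space M \<Longrightarrow> B (Suc n) x \<subseteq> B n x"
begin

sublocale cells: countable_cells M "B n" for n
  by (rule cells)

lemma nested_le: "m \<le> n \<Longrightarrow> x \<in> space M \<Longrightarrow> B n x \<subseteq> B m x"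
  by (rule lift_Suc_antimono_le[of "\<lambda>n. B n x"]) (use nested in auto)

lemma cell_algebra_mono:
  assumes "m \<le> n"
  shows "sets (cells.cell_algebra m) \<subseteq> sets (cells.cell_algebra n)"
proof
  fix R assume "R \<in> sets (cells.cell_algebra m)"
  then obtain S where S: "R = B m -` S \<inter> space M" by (auto simp: cells.sets_cell_algebra)
  have "R = B n -` (B n ` R) \<inter> space M"
  proof (intro Set.set_eqI iffI)
    fix x assume x: "x \<in> B n -` (B n ` R) \<inter> space M"
    then obtain y where y: "y \<in> R" "B n x = B n y" by auto
    then have "y \<in> B m x"
      using x S cells.cell_self[of y n] nested_le[OF assms, of x] by auto
    then have "B m y = B m x" using cells.cell_eq x by blast
    then show "x \<in> R" using y x S by auto
  qed (use S in auto)
  then show "R \<in> sets (cells.cell_algebra n)" unfolding cells.sets_cell_algebra by blast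
qed

abbreviation "q A n \<equiv> cells.cond_prob_cell n A"

lemma cond_prob_convergent:
  assumes A: "A \<in> sets M"
  shows "AE x in M. convergent (\<lambda>n. q A n x)"
proof -
  \<comment> \<open>The martingale theorem asks for the bound at every point of the type, so the
    values off the space are set to 0.\<close>
  define X where "X n x = (if x \<in> space M then q A n x else 0)" for n x
  have "AE x in M. convergent (\<lambda>n. X n x)"
  proof (rule bounded_martingale_convergent[where F = cells.cell_algebra])
    show "subalgebra M (cells.cell_algebra n)" for n by (rule cells.subalgebra_cell_algebra)
    show "m \<le> n \<Longrightarrow> sets (cells.cell_algebra m) \<subseteq> sets (cells.cell_algebra n)" for m n
      by (rule cell_algebra_mono)
    show "X n \<in> borel_measurable (cells.cell_algebra n)" for n
      using cells.cond_prob_cell_measurable_cell_algebra[of n A] cells.subalgebra_cell_algebra[of n]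
      by (subst measurable_cong[of _ _ "q A n"]) (auto simp: X_def subalgebra_def)
    show "\<bar>X n x\<bar> \<le> 1" for n x
      using cells.cond_prob_cell_bounds[OF A, of x n] by (simp add: X_def)
    fix m n and h :: "'a \<Rightarrow> real"
    assume mn: "m \<le> n" and h: "h \<in> borel_measurable (cells.cell_algebra m)" "\<And>x. \<bar>h x\<bar> \<le> 2"
    have h': "h \<in> borel_measurable (cells.cell_algebra n)"
      using h(1) cell_algebra_mono[OF mn] cells.subalgebra_cell_algebra[of m] cells.subalgebra_cell_algebra[of n]
      by (auto simp: measurable_def subalgebra_def)
    have "(\<integral>x. h x * X k x \<partial>M) = (\<integral>x. h x * q A k x \<partial>M)" for k
      by (intro Bochner_Integration.integral_cong) (auto simp: X_def)
    then show "(\<integral>x. h x * X n x \<partial>M) = (\<integral>x. h x * X m x \<partial>M)"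
      using cells.integral_cond_prob_cell[OF A h(1) h(2)] cells.integral_cond_prob_cell[OF A h' h(2)] by simp
  qed
  then show ?thesis using AE_space by eventually_elim (simp add: X_def)
qed

text \<open>Stop at the first n at which the conditional probability of A drops below s. The
  stopping event \<open>R n\<close> belongs to the n-th algebra, so the mass of A on it is the
  integral of that conditional probability, hence at most s times the mass of \<open>R n\<close>.
  Summing over disjoint events gives s.\<close>

lemma cond_prob_small:
  assumes A: "A \<in> sets M" and s: "0 \<le> s"
  shows "prob {x \<in> A. \<exists>n. q A n x < s} \<le> s"
proof -
  have Asp: "A \<subseteq> space M" using A sets.sets_into_space by blast
  define R where "R n = {x \<in> space M. q A n x < s \<and> (\<forall>k<n. \<not> q A k x < s)}" for n
  have R: "R n \<in> sets (cells.cell_algebra n)" for n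
  proof -
    have sp: "space M = space (cells.cell_algebra n)"
      using cells.subalgebra_cell_algebra[of n] by (simp add: subalgebra_def)
    have [measurable]: "q A k \<in> borel_measurable (cells.cell_algebra n)" if "k \<le> n" for k
      using cells.cond_prob_cell_measurable_cell_algebra[of k A] cell_algebra_mono[OF that]
        cells.subalgebra_cell_algebra[of k] cells.subalgebra_cell_algebra[of n]
      by (auto simp: measurable_def subalgebra_def)
    have "Measurable.pred (cells.cell_algebra n) (\<lambda>x. \<forall>k\<in>{..<n}. \<not> q A k x < s)"
    proof (intro pred_intros_finite)
      fix k assume "k \<in> {..<n}"
      then have [measurable]: "q A k \<in> borel_measurable (cells.cell_algebra n)"
        using \<open>k \<le> n \<Longrightarrow> q A k \<in> borel_measurable (cells.cell_algebra n)\<close> by simp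
      show "Measurable.pred (cells.cell_algebra n) (\<lambda>x. \<not> q A k x < s)" by measurable
    qed simp
    then have "{x \<in> space (cells.cell_algebra n). q A n x < s \<and> (\<forall>k\<in>{..<n}. \<not> q A k x < s)}
        \<in> sets (cells.cell_algebra n)" by measurable
    then show ?thesis unfolding R_def sp by simp
  qed
  then have RM[measurable]: "R n \<in> sets M" for n
    using cells.subalgebra_cell_algebra[of n] by (auto simp: subalgebra_def)
  have disj: "disjoint_family R"
  proof (unfold disjoint_family_on_def, intro ballI impI)
    fix i j :: nat assume "i \<noteq> j"
    then show "R i \<inter> R j = {}" by (cases i j rule: linorder_cases) (auto simp: R_def)
  qed
  have "{x \<in> A. \<exists>n. q A n x < s} = (\<Union>n. A \<inter> R n)"
  proof (intro Set.set_eqI iffI)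
    fix x assume x: "x \<in> {x \<in> A. \<exists>n. q A n x < s}"
    define n where "n = (LEAST n. q A n x < s)"
    have "q A n x < s" unfolding n_def by (rule LeastI_ex) (use x in auto)
    moreover have "\<not> q A k x < s" if "k < n" for k
      using not_less_Least that unfolding n_def by blast
    ultimately show "x \<in> (\<Union>n. A \<inter> R n)" using x Asp by (auto simp: R_def)
  qed (auto simp: R_def)
  moreover have "(\<lambda>n. prob (A \<inter> R n)) sums prob (\<Union>n. A \<inter> R n)"
    by (rule finite_measure_UNION) (use A disj in \<open>auto simp: disjoint_family_on_def\<close>)
  ultimately have sum1: "(\<lambda>n. prob (A \<inter> R n)) sums prob {x \<in> A. \<exists>n. q A n x < s}" by simp
  have sum2: "(\<lambda>n. s * prob (R n)) sums (s * prob (\<Union>n. R n))"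
    by (intro sums_mult finite_measure_UNION) (use RM disj in auto)
  have "prob (A \<inter> R n) \<le> s * prob (R n)" for n
  proof -
    have "prob (A \<inter> R n) = (\<integral>x. q A n x * indicator (R n) x \<partial>M)"
      by (rule cells.integral_cond_prob_cell_set[symmetric, OF A R])
    also have "\<dots> \<le> (\<integral>x. s * indicator (R n) x \<partial>M)"
    proof (rule integral_mono)
      have iR: "integrable M (indicator (R n) :: 'a \<Rightarrow> real)"
        by (rule integrable_real_indicator) (auto simp: emeasure_eq_measure)
      then show "integrable M (\<lambda>x. s * indicator (R n) x)" by simp
      show "integrable M (\<lambda>x. q A n x * indicator (R n) x)"
        by (rule Bochner_Integration.integrable_bound[OF iR])
          (use cells.cond_prob_cell_bounds[OF A] in \<open>auto simp: indicator_def\<close>)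
    qed (auto simp: R_def indicator_def)
    finally show ?thesis by simp
  qed
  then have "prob {x \<in> A. \<exists>n. q A n x < s} \<le> s * prob (\<Union>n. R n)"
    by (rule sums_le[OF _ sum1 sum2])
  also have "\<dots> \<le> s" using s by (simp add: mult_left_le)
  finally show ?thesis .
qed

text \<open>Convergence of the conditional probabilities passes through the logarithm only if their
  limit is not 0. By \<open>cond_prob_small\<close>, at almost every point of A they stay above some
  1 / (k + 1).\<close>

lemma information_convergent_on:
  assumes A: "A \<in> sets M"
  shows "AE x in M. x \<in> A \<longrightarrow> convergent (\<lambda>n. - ln (q A n x))"
proof -
  let ?E = "\<lambda>k. {x \<in> A. \<exists>n. q A n x < 1 / real (Suc k)}"
  have [measurable]: "A \<in> sets M" by fact
  have E: "?E k \<in> sets M" for k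
  proof -
    have "?E k = A \<inter> {x \<in> space M. \<exists>n. q A n x < 1 / real (Suc k)}"
      using sets.sets_into_space[OF A] by auto
    also have "\<dots> \<in> sets M" by measurable
    finally show ?thesis .
  qed
  have I: "(\<Inter>k. ?E k) \<in> sets M" by (intro sets.countable_INT) (use E in auto)
  have "prob (\<Inter>k. ?E k) \<le> 1 / real (Suc k)" for k
  proof -
    have "prob (\<Inter>k. ?E k) \<le> prob (?E k)" by (rule finite_measure_mono) (use E in auto)
    also have "\<dots> \<le> 1 / real (Suc k)" by (rule cond_prob_small[OF A]) simp
    finally show ?thesis .
  qed
  then have "prob (\<Inter>k. ?E k) \<le> 0"
    by (intro LIMSEQ_le_const[OF LIMSEQ_Suc[OF lim_const_over_n[of 1]]]) auto
  then have "prob (\<Inter>k. ?E k) = 0" by (simp only: measure_le_0_iff)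
  then have "AE x in M. x \<notin> (\<Inter>k. ?E k)"
    by (intro AE_not_in) (use I in \<open>auto simp: emeasure_eq_measure null_sets_def\<close>)
  then show ?thesis using cond_prob_convergent[OF A]
  proof eventually_elim
    case (elim x)
    show ?case
    proof
      assume "x \<in> A"
      then obtain k where k: "\<And>n. 1 / real (Suc k) \<le> q A n x" using elim(1) by (auto simp: not_less)
      obtain L where L: "(\<lambda>n. q A n x) \<longlonglongrightarrow> L" using elim(2) by (auto simp: convergent_def)
      have "1 / real (Suc k) \<le> L" by (rule LIMSEQ_le_const[OF L]) (use k in auto)
      then have "L \<noteq> 0" by (auto simp: field_simps)
      then have "(\<lambda>n. - ln (q A n x)) \<longlonglongrightarrow> - ln L" by (intro tendsto_intros L)
      then show "convergent (\<lambda>n. - ln (q A n x))" by (auto simp: convergent_def)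
    qed
  qed
qed

end

section \<open>The Chung-Neveu tail estimate and its moments\<close>

locale partition_cell_filtration = cell_filtration M B + P: countable_cells M P
  for M :: "'a measure" and B and P :: "'a \<Rightarrow> 'a set"
begin

definition info :: "nat \<Rightarrow> 'a \<Rightarrow> real" where
  "info n x = - ln (q (P x) n x)"

lemma info_measurable [measurable]: "info n \<in> borel_measurable M"
proof -
  have "(\<lambda>(A, x). - ln (q A n x)) \<in> borel_measurable (count_space (P ` space M) \<Otimes>\<^sub>M M)"
    by (rule measurable_pair_measure_countable1) (use P.cell_count in auto)
  moreover have "(\<lambda>x. (P x, x)) \<in> measurable M (count_space (P ` space M) \<Otimes>\<^sub>M M)"
  proof (rule measurable_Pair)
    show "(\<lambda>x. P x) \<in> measurable M (count_space (P ` space M))"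
      using P.cell_measurable by (auto simp: measurable_def)
  qed simp
  ultimately have "(\<lambda>(A, x). - ln (q A n x)) \<circ> (\<lambda>x. (P x, x)) \<in> borel_measurable M"
    by (rule measurable_comp[rotated])
  then show ?thesis by (simp add: comp_def info_def[abs_def])
qed

lemma info_nonneg: "x \<in> space M \<Longrightarrow> 0 \<le> info n x"
  using cells.cond_prob_cell_bounds[OF P.cell_sets, of x x n]
  by (cases "q (P x) n x = 0") (auto simp: info_def ln_le_zero_iff less_le)

lemma info_convergent: "AE x in M. convergent (\<lambda>n. info n x)"
proof -
  have "AE x in M. \<forall>A\<in>P ` space M. x \<in> A \<longrightarrow> convergent (\<lambda>n. - ln (q A n x))"
    by (subst AE_ball_countable[OF P.cell_count])
      (use P.cell_sets in \<open>auto intro!: information_convergent_on\<close>)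
  then show ?thesis using AE_space
    by eventually_elim (use P.cell_self in \<open>auto simp: info_def\<close>)
qed

abbreviation "pinfo x \<equiv> - ln (prob (P x))"

text \<open>In each atom D of the partition apply \<open>cond_prob_small\<close> with s = exp (- j)
  times the mass of D. Measuring the excess over \<open>pinfo\<close> is what produces the factor
  mass of D, so the bounds sum over infinitely many atoms without loss.\<close>

lemma info_tail:
  "prob {x \<in> space M. \<exists>n. pinfo x + real j < info n x} \<le> exp (- real j)"
proof -
  let ?E = "{x \<in> space M. \<exists>n. pinfo x + real j < info n x}"
  have m: "(\<lambda>x. pinfo x) \<in> borel_measurable M"
    using measurable_compose[OF P.cell_measurable, of "\<lambda>D. - ln (prob D)" borel] by simp
  note [measurable] = m
  have E: "?E \<in> sets M" by measurable
  \<comment> \<open>Restricting M to the event gives a measure, so its total mass can be computed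
    atom by atom with \<open>emeasure_vimage_cells\<close>.\<close>
  let ?N = "density M (indicator ?E)"
  have cell: "emeasure ?N D \<le> ennreal (exp (- real j)) * emeasure M D" if DP: "D \<in> P ` space M" for D
  proof -
    obtain y where y: "y \<in> space M" "D = P y" using DP by blast
    have D: "D \<in> sets M" using P.cell_sets y by auto
    have "emeasure ?N D = ennreal (prob (?E \<inter> D))"
      using D E by (simp add: emeasure_density emeasure_eq_measure flip: indicator_inter_arith)
    also have "prob (?E \<inter> D) \<le> exp (- real j) * prob D"
    proof (cases "prob D = 0")
      case True
      have "prob (?E \<inter> D) \<le> prob D" by (rule finite_measure_mono) (use D in auto)
      then show ?thesis using True by simp
    next
      case False
      then have pos: "0 < prob D" by (simp add: zero_less_measure_iff)
      have "?E \<inter> D \<subseteq> {x \<in> D. \<exists>n. q D n x < exp (- real j) * prob D}"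
      proof safe
        fix x n assume x: "x \<in> space M" "x \<in> D" and n: "pinfo x + real j < info n x"
        have "P x = D" using P.cell_eq[OF y(1)] x y by auto
        then have "ln (q D n x) < ln (prob D) - real j" using n by (simp add: info_def)
        also have "\<dots> = ln (exp (- real j) * prob D)" using pos by (simp add: ln_mult)
        finally have l: "ln (q D n x) < ln (exp (- real j) * prob D)" .
        have "q D n x < exp (- real j) * prob D"
        proof (cases "q D n x = 0")
          case False
          then have "0 < q D n x" using cells.cond_prob_cell_bounds[OF D x(1), of n] by simp
          then show ?thesis using l pos by simp
        qed (use pos in simp)
        then show "\<exists>n. q D n x < exp (- real j) * prob D" ..
      qed
      moreover have "{x \<in> D. \<exists>n. q D n x < exp (- real j) * prob D} \<in> sets M"
      proof -
        have "{x \<in> D. \<exists>n. q D n x < exp (- real j) * prob D}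
            = D \<inter> {x \<in> space M. \<exists>n. q D n x < exp (- real j) * prob D}"
          using sets.sets_into_space[OF D] by auto
        also have "\<dots> \<in> sets M" using D by measurable
        finally show ?thesis .
      qed
      ultimately have "prob (?E \<inter> D) \<le> prob {x \<in> D. \<exists>n. q D n x < exp (- real j) * prob D}"
        by (rule finite_measure_mono)
      also have "\<dots> \<le> exp (- real j) * prob D" by (rule cond_prob_small[OF D]) simp
      finally show ?thesis .
    qed
    finally show ?thesis by (simp add: emeasure_eq_measure ennreal_mult[symmetric] ennreal_leI)
  qed
  have sp: "P -` UNIV \<inter> space M = space M" by auto
  have "ennreal (prob ?E) = emeasure ?N (space M)"
    using E by (simp add: emeasure_density emeasure_eq_measure Int_absorb2 flip: indicator_inter_arith)
  also have "\<dots> = (\<integral>\<^sup>+D. emeasure ?N D \<partial>count_space (P ` space M \<inter> UNIV))"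
    using P.emeasure_vimage_cells[of ?N UNIV] sp by simp
  also have "\<dots> \<le> (\<integral>\<^sup>+D. ennreal (exp (- real j)) * emeasure M D \<partial>count_space (P ` space M \<inter> UNIV))"
    by (rule nn_integral_mono) (use cell in auto)
  also have "\<dots> = ennreal (exp (- real j)) * (\<integral>\<^sup>+D. emeasure M D \<partial>count_space (P ` space M \<inter> UNIV))"
    by (rule nn_integral_cmult) simp
  also have "(\<integral>\<^sup>+D. emeasure M D \<partial>count_space (P ` space M \<inter> UNIV)) = 1"
    using P.emeasure_vimage_cells[of M UNIV] sp by (simp add: emeasure_space_1)
  finally show ?thesis by simp
qed

text \<open>Only half of the exponential rate is used, so that multiplication by the tail exp (- z)
  still leaves a convergent series. The constant arises by raising z / (2 p) \<le> exp (z / (2 p))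
  to the power p.\<close>

lemma powr_le_exp_half:
  assumes "1 < p" "0 \<le> (z::real)"
  shows "z powr p \<le> (2 * p) powr p * exp (z / 2)"
proof -
  have "z / (2 * p) \<le> exp (z / (2 * p))" using exp_ge_add_one_self[of "z / (2 * p)"] by linarith
  then have "(z / (2 * p)) powr p \<le> exp (z / (2 * p)) powr p"
    using assms by (intro powr_mono2) auto
  also have "\<dots> = exp (z / 2)" using assms by (simp add: exp_powr_real)
  finally show ?thesis using assms by (simp add: powr_divide field_simps)
qed

text \<open>The information is at most twice the larger of \<open>pinfo\<close> and its excess
  \<open>z\<close> over \<open>pinfo\<close>; the excess has an exponential tail uniformly in n. The
  right-hand side depends on p and the partition but not on the filtration, which makes it
  integrable over \<xi> later.\<close>

theorem nn_integral_sup_info: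
  assumes p: "1 < p"
  shows "(\<integral>\<^sup>+x. (SUP n. ennreal (info n x powr p)) \<partial>M)
    \<le> ennreal (2 powr p) * ((\<integral>\<^sup>+x. ennreal (pinfo x powr p) \<partial>M)
        + ennreal ((2 * p) powr p) * (\<Sum>j. ennreal (exp (1 - real j / 2))))"
proof -
  have m: "(\<lambda>x. pinfo x) \<in> borel_measurable M"
    using measurable_compose[OF P.cell_measurable, of "\<lambda>D. - ln (prob D)" borel] by simp
  note [measurable] = m
  define E' where "E' j = {x \<in> space M. \<exists>n. pinfo x + real j < info n x}" for j
  have E'[measurable]: "E' j \<in> sets M" for j unfolding E'_def by measurable
  \<comment> \<open>Shifting the index by one lets j be the excess rounded up: \<open>E 0\<close> is
    everything, and x lies in \<open>E (Suc i)\<close> as soon as its excess is above i. The shift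
    accounts for the 1 in the exponent 1 - j.\<close>
  define E where "E j = (case j of 0 \<Rightarrow> space M | Suc i \<Rightarrow> E' i)" for j
  have E[measurable]: "E j \<in> sets M" for j
    by (cases j) (simp_all add: E_def E')
  have EP: "prob (E j) \<le> exp (1 - real j)" for j
  proof (cases j)
    case (Suc i)
    then show ?thesis using info_tail[of i] by (simp add: E_def E'_def)
  qed (simp add: E_def prob_space)
  let ?S = "\<lambda>x. \<Sum>j. ennreal (exp (real j / 2)) * indicator (E j) x"
  have term_le: "f j \<le> (\<Sum>i. f i)" for f :: "nat \<Rightarrow> ennreal" and j
    using sum_le_suminf[of f "{j}"] by simp
  have pw: "ennreal (info n x powr p) \<le> ennreal (2 powr p) * (ennreal (pinfo x powr p) + ennreal ((2 * p) powr p) * ?S x)"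
    if x: "x \<in> space M" for n x
  proof -
    have a0: "0 \<le> pinfo x"
      by (cases "prob (P x) = 0") (auto simp: less_le)
    define z where "z = max 0 (info n x - pinfo x)"
    have z0: "0 \<le> z" by (simp add: z_def)
    have "info n x \<le> 2 * max (pinfo x) z" using a0 by (auto simp: z_def max_def)
    then have "info n x powr p \<le> (2 * max (pinfo x) z) powr p"
      using info_nonneg[OF x] p by (intro powr_mono2) auto
    also have "\<dots> = 2 powr p * max (pinfo x) z powr p" using z0 a0 by (simp add: powr_mult)
    also have "\<dots> \<le> 2 powr p * (pinfo x powr p + z powr p)"
      by (intro mult_left_mono) (auto simp: max_def)
    also have "\<dots> \<le> 2 powr p * (pinfo x powr p + (2 * p) powr p * exp (z / 2))"
      using powr_le_exp_half[OF p z0] by simp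
    finally have "ennreal (info n x powr p) \<le> ennreal (2 powr p * (pinfo x powr p + (2 * p) powr p * exp (z / 2)))"
      by (rule ennreal_leI)
    also have "\<dots> = ennreal (2 powr p) * (ennreal (pinfo x powr p) + ennreal ((2 * p) powr p) * ennreal (exp (z / 2)))"
      by (simp add: ennreal_mult ennreal_plus)
    also have "\<dots> \<le> ennreal (2 powr p) * (ennreal (pinfo x powr p) + ennreal ((2 * p) powr p) * ?S x)"
    proof (intro mult_left_mono add_left_mono)
      define j where "j = nat \<lceil>z\<rceil>"
      have "x \<in> E j"
      proof (cases j)
        case (Suc i)
        then have "real i < z" unfolding j_def by linarith
        then have "pinfo x + real i < info n x" unfolding z_def by linarith
        then show ?thesis using Suc x by (auto simp: E_def E'_def)
      qed (use x in \<open>simp add: E_def\<close>)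
      moreover have "z \<le> real j" unfolding j_def by linarith
      ultimately have "ennreal (exp (z / 2)) \<le> ennreal (exp (real j / 2)) * indicator (E j) x"
        by (simp add: ennreal_leI)
      also have "\<dots> \<le> ?S x" by (rule term_le)
      finally show "ennreal (exp (z / 2)) \<le> ?S x" .
    qed auto
    finally show ?thesis .
  qed
  have "(\<integral>\<^sup>+x. (SUP n. ennreal (info n x powr p)) \<partial>M)
      \<le> (\<integral>\<^sup>+x. ennreal (2 powr p) * (ennreal (pinfo x powr p) + ennreal ((2 * p) powr p) * ?S x) \<partial>M)"
    by (intro nn_integral_mono SUP_least pw)
  also have "\<dots> = ennreal (2 powr p) * (\<integral>\<^sup>+x. ennreal (pinfo x powr p) + ennreal ((2 * p) powr p) * ?S x \<partial>M)"
    by (rule nn_integral_cmult) measurable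
  also have "(\<integral>\<^sup>+x. ennreal (pinfo x powr p) + ennreal ((2 * p) powr p) * ?S x \<partial>M)
      = (\<integral>\<^sup>+x. ennreal (pinfo x powr p) \<partial>M) + (\<integral>\<^sup>+x. ennreal ((2 * p) powr p) * ?S x \<partial>M)"
    by (rule nn_integral_add) measurable
  also have "(\<integral>\<^sup>+x. ennreal ((2 * p) powr p) * ?S x \<partial>M) = ennreal ((2 * p) powr p) * (\<integral>\<^sup>+x. ?S x \<partial>M)"
    by (rule nn_integral_cmult) measurable
  also have "(\<integral>\<^sup>+x. ?S x \<partial>M) = (\<Sum>j. \<integral>\<^sup>+x. ennreal (exp (real j / 2)) * indicator (E j) x \<partial>M)"
    by (rule nn_integral_suminf) measurable
  also have "ennreal (2 powr p) * ((\<integral>\<^sup>+x. ennreal (pinfo x powr p) \<partial>M)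
        + ennreal ((2 * p) powr p) * (\<Sum>j. \<integral>\<^sup>+x. ennreal (exp (real j / 2)) * indicator (E j) x \<partial>M))
      \<le> ennreal (2 powr p) * ((\<integral>\<^sup>+x. ennreal (pinfo x powr p) \<partial>M)
        + ennreal ((2 * p) powr p) * (\<Sum>j. ennreal (exp (1 - real j / 2))))"
  proof (intro mult_left_mono add_left_mono suminf_le)
    fix j
    have "(\<integral>\<^sup>+x. ennreal (exp (real j / 2)) * indicator (E j) x \<partial>M) = ennreal (exp (real j / 2)) * emeasure M (E j)"
      by (rule nn_integral_cmult_indicator) (rule E)
    also have "\<dots> \<le> ennreal (exp (real j / 2)) * ennreal (exp (1 - real j))"
      using EP by (intro mult_left_mono) (auto simp: emeasure_eq_measure ennreal_leI)
    also have "\<dots> = ennreal (exp (real j / 2) * exp (1 - real j))"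
      by (rule ennreal_mult[symmetric]) auto
    also have "exp (real j / 2) * exp (1 - real j) = exp (1 - real j / 2)"
      by (simp add: exp_add[symmetric])
    finally show "(\<integral>\<^sup>+x. ennreal (exp (real j / 2)) * indicator (E j) x \<partial>M) \<le> ennreal (exp (1 - real j / 2))" .
  qed auto
  finally show ?thesis .
qed

end

lemma suminf_exp_half_finite: "(\<Sum>j. ennreal (exp (1 - real j / 2))) < \<infinity>"
proof -
  have "exp (1 - real j / 2) = exp 1 * exp (- (1 / 2)) ^ j" for j
    using exp_add[of 1 "real j * - (1 / 2)"] exp_of_nat_mult[of j "- (1 / 2) :: real"] by simp
  then have "summable (\<lambda>j. exp (1 - real j / 2))"
    by (simp add: summable_mult summable_geometric)
  then have "(\<Sum>j. ennreal (exp (1 - real j / 2))) = ennreal (\<Sum>j. exp (1 - real j / 2))"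
    by (intro suminf_ennreal2) auto
  then show ?thesis by simp
qed

section \<open>The shift on the boundary\<close>

definition shift :: "(nat \<Rightarrow> letter) \<Rightarrow> nat \<Rightarrow> letter" where
  "shift \<xi> = (\<lambda>i. \<xi> (Suc i))"

lemma cylinder_Nil [simp]: "cylinder r [] = boundary r"
  by (auto simp: cylinder_def)

lemma boundary_letter: "\<xi> \<in> boundary r \<Longrightarrow> \<xi> i \<in> letters r"
  by (simp add: boundary_def)

lemma cylinder_boundary: "\<xi> \<in> cylinder r w \<Longrightarrow> \<xi> \<in> boundary r"
  by (simp add: cylinder_def)

lemma shift_boundary: "\<xi> \<in> boundary r \<Longrightarrow> shift \<xi> \<in> boundary r"
  by (simp add: boundary_def shift_def)

lemma prefix_reduced: "\<xi> \<in> boundary r \<Longrightarrow> map \<xi> [0..<n] \<in> reduced_words r"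
  by (auto simp: reduced_words_def boundary_def successively_conv_nth)

lemma mem_cylinder_iff:
  "\<xi> \<in> cylinder r w \<longleftrightarrow> \<xi> \<in> boundary r \<and> map \<xi> [0..<length w] = w"
  using list_eq_iff_nth_eq[of "map \<xi> [0..<length w]" w] by (simp add: cylinder_def)

lemma cylinder_not_reduced: "w \<notin> reduced_words r \<Longrightarrow> cylinder r w = {}"
proof -
  assume w: "w \<notin> reduced_words r"
  have "\<xi> \<notin> cylinder r w" for \<xi>
    using w prefix_reduced[of \<xi> r "length w"] by (auto simp: mem_cylinder_iff)
  then show ?thesis by blast
qed

lemma prefix_Suc: "map \<xi> [0..<Suc n] = \<xi> 0 # map (shift \<xi>) [0..<n]"
  unfolding shift_def by (rule map_upt_Suc)

lemma mem_cylinder_Cons: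
  "\<xi> \<in> cylinder r (a # w) \<longleftrightarrow> \<xi> \<in> boundary r \<and> \<xi> 0 = a \<and> shift \<xi> \<in> cylinder r w"
  by (auto simp: mem_cylinder_iff prefix_Suc shift_boundary simp del: upt_Suc)

lemma cylinder_Int:
  assumes "length v \<le> length u"
  shows "cylinder r u \<inter> cylinder r v = (if take (length v) u = v then cylinder r u else {})"
proof -
  have "take (length v) (map \<xi> [0..<length u]) = map \<xi> [0..<length v]" for \<xi> :: "nat \<Rightarrow> letter"
    using assms by (simp add: take_map)
  then show ?thesis by (auto simp: mem_cylinder_iff) metis+
qed

lemma Int_stable_cylinders: "Int_stable (range (cylinder r))"
proof (rule Int_stableI)
  fix A B assume "A \<in> range (cylinder r)" "B \<in> range (cylinder r)"
  then obtain u v where uv: "A = cylinder r u" "B = cylinder r v" by auto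
  \<comment> \<open>Generators are numbered from 1, so the letter 0 gives a word that is not
    reduced, whose cylinder is empty. This puts the empty set among the cylinders.\<close>
  have "[(0, True)] \<notin> reduced_words r" by (simp add: reduced_words_def letters_def)
  then have "{} \<in> range (cylinder r)" using cylinder_not_reduced by blast
  then show "A \<inter> B \<in> range (cylinder r)"
    using cylinder_Int[of v u r] cylinder_Int[of u v r] unfolding uv
    by (metis Int_commute nle_le rangeI)
qed

lemma reduced_words_Cons:
  "a # w \<in> reduced_words r \<longleftrightarrow> a \<in> letters r \<and> w \<in> reduced_words r \<and> (w = [] \<or> hd w \<noteq> inv_letter a)"
  by (cases w) (auto simp: reduced_words_def)

lemma finite_letters [simp]: "finite (letters r)"
  by (simp add: letters_def)

lemma card_letters: "card (letters r) = 2 * r"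
  by (simp add: letters_def card_cartesian_product)

lemma word_sphere_eq: "word_sphere r n = {w \<in> reduced_words r. length w = n}"
  using word_length_eq[of _ r] by (auto simp: word_sphere_def free_group_def)

lemma finite_word_sphere: "finite (word_sphere r n)"
proof (rule finite_subset)
  show "word_sphere r n \<subseteq> {w. set w \<subseteq> letters r \<and> length w = n}"
    by (auto simp: word_sphere_eq reduced_words_def)
qed (simp add: finite_lists_length_eq)

locale free_boundary =
  fixes r :: nat
  assumes rank: "2 \<le> r"
begin

abbreviation "\<nu> \<equiv> boundary_measure r"

lemma boundary_measure_r: "is_boundary_measure r \<nu>"
  by (rule boundary_measure) (use rank in simp)

sublocale \<nu>: prob_space \<nu>
  using boundary_measure_r by (simp add: is_boundary_measure_def)

lemma space_\<nu> [simp]: "space \<nu> = boundary r"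
  using boundary_measure_r by (simp add: is_boundary_measure_def)

lemma measure_cylinder:
  assumes "w \<in> reduced_words r" "w \<noteq> []"
  shows "\<nu>.prob (cylinder r w) = 1 / (2 * real r * (2 * real r - 1) ^ (length w - 1))"
  using boundary_measure_r assms by (simp add: is_boundary_measure_def)

lemma cylinder_sets [measurable]: "cylinder r w \<in> sets \<nu>"
proof -
  have s: "sets \<nu> = sigma_sets (boundary r) (cylinder r ` (reduced_words r - {[]}))"
    using boundary_measure_r by (simp add: is_boundary_measure_def)
  consider "w = []" | "w \<notin> reduced_words r" | "w \<in> reduced_words r - {[]}" by blast
  then show ?thesis
  proof cases
    case 1
    then show ?thesis using sets.top[of \<nu>] by simp
  next
    case 2
    then show ?thesis by (simp add: cylinder_not_reduced)
  next
    case 3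
    then show ?thesis unfolding s by (auto intro: sigma_sets.Basic)
  qed
qed

lemma sets_\<nu>: "sets \<nu> = sigma_sets (boundary r) (range (cylinder r))"
proof
  have "sets \<nu> = sigma_sets (boundary r) (cylinder r ` (reduced_words r - {[]}))"
    using boundary_measure_r by (simp add: is_boundary_measure_def)
  also have "\<dots> \<subseteq> sigma_sets (boundary r) (range (cylinder r))"
    by (rule sigma_sets_mono') auto
  finally show "sets \<nu> \<subseteq> sigma_sets (boundary r) (range (cylinder r))" .
  show "sigma_sets (boundary r) (range (cylinder r)) \<subseteq> sets \<nu>"
    using sets.sigma_sets_subset[of "range (cylinder r)" \<nu>] cylinder_sets
    by (metis image_subset_iff space_\<nu>)
qed

lemma cylinder_subset: "cylinder r w \<subseteq> boundary r"
  by (auto simp: cylinder_def)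

lemma measure_eqI_cylinders:
  assumes "sets N1 = sets \<nu>" "sets N2 = sets \<nu>"
    and "\<And>w. emeasure N1 (cylinder r w) = emeasure N2 (cylinder r w)"
    and "emeasure N1 (boundary r) \<noteq> \<infinity>"
  shows "N1 = N2"
proof (rule measure_eqI_generator_eq[OF Int_stable_cylinders, where \<Omega> = "boundary r" and A = "\<lambda>_. boundary r"])
  show "range (\<lambda>_::nat. boundary r) \<subseteq> range (cylinder r)"
    using cylinder_Nil by (metis image_subset_iff rangeI)
  show "range (cylinder r) \<subseteq> Pow (boundary r)" by (auto dest: cylinder_boundary)
  show "sets N1 = sigma_sets (boundary r) (range (cylinder r))"
    "sets N2 = sigma_sets (boundary r) (range (cylinder r))"
    unfolding assms by (rule sets_\<nu>)+
  show "emeasure N1 X = emeasure N2 X" if "X \<in> range (cylinder r)" for X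
    using that assms(3) by blast
  show "(\<Union>i::nat. boundary r) = boundary r" by blast
  show "emeasure N1 (boundary r) \<noteq> \<infinity>" by (rule assms(4))
qed

lemma prefix_measurable [measurable]:
  "(\<lambda>\<xi>. map \<xi> [0..<n]) \<in> measurable \<nu> (count_space UNIV)"
proof (subst measurable_count_space_eq2_countable)
  have "(\<lambda>\<xi>. map \<xi> [0..<n]) -` {w} \<inter> space \<nu> = (if length w = n then cylinder r w else {})" for w
    by (auto simp: mem_cylinder_iff)
  then show "(\<lambda>\<xi>. map \<xi> [0..<n]) \<in> space \<nu> \<rightarrow> UNIV \<and>
      (\<forall>w\<in>UNIV. (\<lambda>\<xi>. map \<xi> [0..<n]) -` {w} \<inter> space \<nu> \<in> sets \<nu>)" by simp
qed

lemma letter_measurable [measurable]: "(\<lambda>\<xi>. \<xi> i) \<in> measurable \<nu> (count_space (letters r))"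
proof -
  have "(\<lambda>w. last w) \<circ> (\<lambda>\<xi>. map \<xi> [0..<Suc i]) \<in> measurable \<nu> (count_space UNIV)"
    by (rule measurable_comp[OF prefix_measurable]) simp
  then have "(\<lambda>\<xi>. \<xi> i) \<in> measurable \<nu> (count_space UNIV)" by (simp add: comp_def)
  then show ?thesis using boundary_letter by (auto simp: measurable_def)
qed

lemma shift_measurable [measurable]: "shift \<in> measurable \<nu> \<nu>"
proof -
  have "shift -` cylinder r w \<inter> boundary r \<in> sets \<nu>" for w
  proof -
    have "shift -` cylinder r w \<inter> boundary r = (\<Union>a\<in>letters r. cylinder r (a # w))"
      by (auto simp: mem_cylinder_Cons boundary_letter dest: cylinder_boundary)
    then show ?thesis by auto
  qed
  then show ?thesis
    by (intro measurable_sigma_sets[OF sets_\<nu>]) (auto intro: shift_boundary dest: cylinder_boundary)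
qed

lemma measure_cylinder_Cons:
  assumes "a # b # w \<in> reduced_words r"
  shows "\<nu>.prob (cylinder r (b # w)) = (2 * real r - 1) * \<nu>.prob (cylinder r (a # b # w))"
proof -
  have "b # w \<in> reduced_words r" using assms by (auto simp: reduced_words_Cons)
  then show ?thesis using assms rank by (simp add: measure_cylinder)
qed

text \<open>The Markov property: given the first two letters a, b, the shifted ray is distributed
  like a ray conditioned to start with b. Both sides are finite measures in D, so comparison on
  cylinders suffices.\<close>

lemma measure_shift_vimage:
  assumes ab: "[a, b] \<in> reduced_words r" and D: "D \<in> sets \<nu>"
  shows "\<nu>.prob (cylinder r [b] \<inter> D) = (2 * real r - 1) * \<nu>.prob (cylinder r [a, b] \<inter> (shift -` D \<inter> boundary r))"
proof -
  have c0: "0 < 2 * real r - 1" using rank by simp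
  let ?N1 = "density \<nu> (indicator (cylinder r [b]))"
  let ?N2 = "distr (density \<nu> (\<lambda>\<xi>. ennreal (2 * real r - 1) * indicator (cylinder r [a, b]) \<xi>)) \<nu> shift"
  have N1: "emeasure ?N1 D = ennreal (\<nu>.prob (cylinder r [b] \<inter> D))" if "D \<in> sets \<nu>" for D
    using that by (simp add: emeasure_density \<nu>.emeasure_eq_measure flip: indicator_inter_arith)
  have N2: "emeasure ?N2 D = ennreal ((2 * real r - 1) * \<nu>.prob (cylinder r [a, b] \<inter> (shift -` D \<inter> boundary r)))"
    if D: "D \<in> sets \<nu>" for D
  proof -
    have [measurable]: "shift -` D \<inter> boundary r \<in> sets \<nu>"
      using measurable_sets[OF shift_measurable D] by simp
    have "emeasure ?N2 D = emeasure (density \<nu> (\<lambda>\<xi>. ennreal (2 * real r - 1) * indicator (cylinder r [a, b]) \<xi>)) (shift -` D \<inter> boundary r)"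
      using D by (simp add: emeasure_distr)
    also have "\<dots> = (\<integral>\<^sup>+\<xi>. ennreal (2 * real r - 1) * indicator (cylinder r [a, b] \<inter> (shift -` D \<inter> boundary r)) \<xi> \<partial>\<nu>)"
      by (simp add: emeasure_density indicator_inter_arith mult.assoc)
    also have "\<dots> = ennreal (2 * real r - 1) * ennreal (\<nu>.prob (cylinder r [a, b] \<inter> (shift -` D \<inter> boundary r)))"
      by (subst nn_integral_cmult_indicator) (auto simp: \<nu>.emeasure_eq_measure)
    finally show ?thesis using c0 by (simp add: ennreal_mult)
  qed
  have "?N1 = ?N2"
  proof (rule measure_eqI_cylinders)
    fix w
    have "\<nu>.prob (cylinder r [b] \<inter> cylinder r w)
        = (2 * real r - 1) * \<nu>.prob (cylinder r [a, b] \<inter> (shift -` cylinder r w \<inter> boundary r))"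
    proof (cases w)
      case Nil
      have "cylinder r [a, b] \<inter> (shift -` cylinder r w \<inter> boundary r) = cylinder r [a, b]"
        using Nil by (auto simp: shift_boundary dest: cylinder_boundary)
      then show ?thesis using Nil measure_cylinder_Cons[OF ab] cylinder_subset[of "[b]"] by (simp add: Int_absorb2)
    next
      case (Cons b' v)
      show ?thesis
      proof (cases "b' = b")
        case True
        have 1: "cylinder r [b] \<inter> cylinder r w = cylinder r w"
          using True Cons by (auto simp: mem_cylinder_Cons shift_boundary)
        have 2: "cylinder r [a, b] \<inter> (shift -` cylinder r w \<inter> boundary r) = cylinder r (a # w)"
          using True Cons by (auto simp: mem_cylinder_Cons shift_boundary)
        show ?thesis
        proof (cases "a # w \<in> reduced_words r")
          case red: True
          show ?thesis unfolding 1 2 using measure_cylinder_Cons[of a b v] red Cons True by simp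
        next
          case False
          then have "w \<notin> reduced_words r" using ab Cons True by (auto simp: reduced_words_Cons)
          then show ?thesis unfolding 1 2 using False by (simp add: cylinder_not_reduced)
        qed
      next
        case False
        have 1: "cylinder r [b] \<inter> cylinder r w = {}"
          using False Cons by (auto simp: mem_cylinder_Cons)
        have 2: "cylinder r [a, b] \<inter> (shift -` cylinder r w \<inter> boundary r) = {}"
          using False Cons by (auto simp: mem_cylinder_Cons shift_boundary)
        show ?thesis unfolding 1 2 by simp
      qed
    qed
    then show "emeasure ?N1 (cylinder r w) = emeasure ?N2 (cylinder r w)" by (simp add: N1 N2)
  next
    show "emeasure ?N1 (boundary r) \<noteq> \<infinity>"
      using N1[of "boundary r"] sets.top[of \<nu>] by simp
  qed auto
  then have "ennreal (\<nu>.prob (cylinder r [b] \<inter> D))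
      = ennreal ((2 * real r - 1) * \<nu>.prob (cylinder r [a, b] \<inter> (shift -` D \<inter> boundary r)))"
    using N1[OF D] N2[OF D] by simp
  then show ?thesis using c0 by (simp add: measure_nonneg)
qed

lemma card_followers:
  assumes "a \<in> letters r"
  shows "card (letters r - {inv_letter a}) = 2 * r - 1"
  using assms by (simp add: card_Diff_singleton card_letters)

lemma real_card_followers: "real (2 * r - 1) = 2 * real r - 1"
  using rank by (simp add: of_nat_diff)

text \<open>A nonempty reduced word can be preceded by 2r - 1 letters, and each extended cylinder
  has the fraction 1 / (2r - 1) of its mass.\<close>

lemma distr_shift: "distr \<nu> \<nu> shift = \<nu>"
proof (rule measure_eqI_cylinders)
  fix w
  have e: "emeasure (distr \<nu> \<nu> shift) (cylinder r w) = emeasure \<nu> (shift -` cylinder r w \<inter> boundary r)"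
    by (simp add: emeasure_distr)
  show "emeasure (distr \<nu> \<nu> shift) (cylinder r w) = emeasure \<nu> (cylinder r w)"
  proof (cases "w \<in> reduced_words r")
    case False
    then show ?thesis unfolding e by (simp add: cylinder_not_reduced)
  next
    case red: True
    show ?thesis
    proof (cases w)
      case Nil
      have "shift -` boundary r \<inter> boundary r = boundary r" using shift_boundary by auto
      then show ?thesis unfolding e using Nil by simp
    next
      case (Cons b v)
      have b: "b \<in> letters r" using red Cons by (simp add: reduced_words_Cons)
      let ?L = "letters r - {inv_letter b}"
      have redC: "a # w \<in> reduced_words r" if "a \<in> ?L" for a
        using that red Cons by (auto simp: reduced_words_Cons)
      have "shift -` cylinder r w \<inter> boundary r = (\<Union>a\<in>?L. cylinder r (a # w))"
      proof (rule Set.set_eqI, rule iffI)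
        fix \<xi> assume \<xi>: "\<xi> \<in> shift -` cylinder r w \<inter> boundary r"
        then have c: "\<xi> \<in> cylinder r (\<xi> 0 # w)" by (simp add: mem_cylinder_Cons)
        then have "\<xi> 0 # w \<in> reduced_words r" using cylinder_not_reduced by blast
        then have "\<xi> 0 \<in> ?L" using Cons by (auto simp: reduced_words_Cons)
        then show "\<xi> \<in> (\<Union>a\<in>?L. cylinder r (a # w))" using c by blast
      next
        fix \<xi> assume "\<xi> \<in> (\<Union>a\<in>?L. cylinder r (a # w))"
        then show "\<xi> \<in> shift -` cylinder r w \<inter> boundary r"
          by (auto simp: mem_cylinder_Cons)
      qed
      then have "\<nu>.prob (shift -` cylinder r w \<inter> boundary r) = (\<Sum>a\<in>?L. \<nu>.prob (cylinder r (a # w)))"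
      proof (simp only:, intro \<nu>.finite_measure_finite_Union)
        show "disjoint_family_on (\<lambda>a. cylinder r (a # w)) ?L"
          by (auto simp: disjoint_family_on_def mem_cylinder_Cons dest: cylinder_boundary)
      qed auto
      also have "\<dots> = (\<Sum>a\<in>?L. \<nu>.prob (cylinder r w) / (2 * real r - 1))"
      proof (rule sum.cong[OF refl])
        fix a assume "a \<in> ?L"
        then have "a # b # v \<in> reduced_words r" using redC Cons by simp
        from measure_cylinder_Cons[OF this]
        show "\<nu>.prob (cylinder r (a # w)) = \<nu>.prob (cylinder r w) / (2 * real r - 1)"
          using Cons rank by simp
      qed
      also have "\<dots> = \<nu>.prob (cylinder r w)"
        using rank b by (simp add: card_followers real_card_followers del: card_Diff_insert)
      finally show ?thesis unfolding e by (simp add: \<nu>.emeasure_eq_measure)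
    qed
  qed
next
  show "emeasure (distr \<nu> \<nu> shift) (boundary r) \<noteq> \<infinity>"
    using prob_space.emeasure_space_1[OF \<nu>.prob_space_distr[OF shift_measurable]] by simp
qed simp_all

text \<open>The cylinders of the sphere partition the boundary and have equal masses, so no formula
  for the size of the sphere is required.\<close>

lemma cylinder_sphere_measure:
  assumes "w \<in> word_sphere r n"
  shows "\<nu>.prob (cylinder r w) = 1 / real (card (word_sphere r n))"
proof -
  have un: "boundary r = (\<Union>w\<in>word_sphere r n. cylinder r w)"
    by (auto simp: word_sphere_eq mem_cylinder_iff prefix_reduced)
  have const: "\<nu>.prob (cylinder r u) = \<nu>.prob (cylinder r w)" if "u \<in> word_sphere r n" for u
  proof (cases "n = 0")
    case False
    then have "u \<noteq> []" "w \<noteq> []" using assms that by (auto simp: word_sphere_eq)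
    then show ?thesis using that assms by (simp add: word_sphere_eq measure_cylinder)
  qed (use that assms in \<open>auto simp: word_sphere_eq\<close>)
  have "1 = \<nu>.prob (\<Union>w\<in>word_sphere r n. cylinder r w)"
    using \<nu>.prob_space un by simp
  also have "\<dots> = (\<Sum>u\<in>word_sphere r n. \<nu>.prob (cylinder r u))"
  proof (intro \<nu>.finite_measure_finite_Union finite_word_sphere)
    show "disjoint_family_on (cylinder r) (word_sphere r n)"
      by (auto simp: disjoint_family_on_def word_sphere_eq mem_cylinder_iff)
  qed auto
  also have "\<dots> = real (card (word_sphere r n)) * \<nu>.prob (cylinder r w)"
    using const by simp
  finally have "real (card (word_sphere r n)) * \<nu>.prob (cylinder r w) = 1" by simp
  then show ?thesis by (cases "card (word_sphere r n) = 0") (simp_all add: field_simps)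
qed

text \<open>The bridge from rays to spheres: under \<nu> the prefix of length n is uniformly
  distributed on the sphere of radius n.\<close>

lemma integral_prefix:
  fixes \<phi> :: "letter list \<Rightarrow> real"
  shows "(\<integral>\<xi>. \<phi> (map \<xi> [0..<n]) \<partial>\<nu>) = (\<Sum>w\<in>word_sphere r n. \<phi> w) / real (card (word_sphere r n))"
proof -
  have "(\<integral>\<xi>. \<phi> (map \<xi> [0..<n]) \<partial>\<nu>) = (\<integral>\<xi>. (\<Sum>w\<in>word_sphere r n. \<phi> w * indicator (cylinder r w) \<xi>) \<partial>\<nu>)"
  proof (rule Bochner_Integration.integral_cong[OF refl])
    fix \<xi> assume "\<xi> \<in> space \<nu>"
    then have \<xi>: "\<xi> \<in> boundary r" by simp
    then have m: "map \<xi> [0..<n] \<in> word_sphere r n" by (simp add: word_sphere_eq prefix_reduced)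
    have "(\<Sum>w\<in>word_sphere r n. \<phi> w * indicator (cylinder r w) \<xi>)
        = (\<Sum>w\<in>word_sphere r n. if w = map \<xi> [0..<n] then \<phi> w else 0)"
      using \<xi> by (intro sum.cong) (auto simp: mem_cylinder_iff word_sphere_eq indicator_def)
    also have "\<dots> = \<phi> (map \<xi> [0..<n])"
      using m by (simp add: sum.delta finite_word_sphere)
    finally show "\<phi> (map \<xi> [0..<n]) = (\<Sum>w\<in>word_sphere r n. \<phi> w * indicator (cylinder r w) \<xi>)" ..
  qed
  also have "\<dots> = (\<Sum>w\<in>word_sphere r n. \<integral>\<xi>. \<phi> w * indicator (cylinder r w) \<xi> \<partial>\<nu>)"
    by (rule Bochner_Integration.integral_sum)
      (auto intro!: integrable_mult_right integrable_real_indicator simp: \<nu>.emeasure_eq_measure)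
  also have "\<dots> = (\<Sum>w\<in>word_sphere r n. \<phi> w * (1 / real (card (word_sphere r n))))"
    using cylinder_sphere_measure cylinder_subset by (intro sum.cong) (auto simp: Int_absorb2)
  finally show ?thesis by (simp add: sum_divide_distrib)
qed

end

section \<open>Ergodicity of the skew product\<close>

lemma carrier_free_group [simp]: "carrier (free_group r) = reduced_words r"
  by (simp add: free_group_def)

lemma Nil_reduced [simp]: "[] \<in> reduced_words r"
  by (simp add: reduced_words_def)

locale free_group_action = free_boundary r + M: prob_space M
  for r :: nat and M :: "'x measure" +
  fixes \<alpha> :: "letter list \<Rightarrow> 'x \<Rightarrow> 'x"
  assumes pmp: "pmp_action (free_group r) M \<alpha>"
begin

sublocale \<alpha>: group_action "free_group r" "space M" \<alpha>
  using pmp by (simp add: pmp_action_def)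

abbreviation act :: "letter \<Rightarrow> 'x \<Rightarrow> 'x" where
  "act a \<equiv> \<alpha> [a]"

lemma letter_reduced: "a \<in> letters r \<Longrightarrow> [a] \<in> reduced_words r"
  by (simp add: reduced_words_def)

lemma \<alpha>_measurable: "w \<in> reduced_words r \<Longrightarrow> \<alpha> w \<in> measurable M M"
  and \<alpha>_distr: "w \<in> reduced_words r \<Longrightarrow> distr M M (\<alpha> w) = M"
  using pmp by (auto simp: pmp_action_def)

lemma act_measurable: "a \<in> letters r \<Longrightarrow> act a \<in> measurable M M"
  by (intro \<alpha>_measurable letter_reduced)

lemma \<alpha>_space: "w \<in> reduced_words r \<Longrightarrow> x \<in> space M \<Longrightarrow> \<alpha> w x \<in> space M"
  using \<alpha>_measurable by (rule measurable_space)

lemma act_space: "a \<in> letters r \<Longrightarrow> x \<in> space M \<Longrightarrow> act a x \<in> space M"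
  by (intro \<alpha>_space letter_reduced)

lemma \<alpha>_Nil: "x \<in> space M \<Longrightarrow> \<alpha> [] x = x"
  using \<alpha>.id_eq_one by (metis free_group_def monoid.select_convs(2) restrict_apply')

lemma \<alpha>_Cons:
  assumes "a # w \<in> reduced_words r" "x \<in> space M"
  shows "\<alpha> (a # w) x = act a (\<alpha> w x)"
proof -
  have aw: "[a] \<in> reduced_words r" "w \<in> reduced_words r" using assms by (auto simp: reduced_words_Cons)
  have "[a] \<otimes>\<^bsub>free_group r\<^esub> w = a # w"
    using assms(1) by (cases w) (auto simp: free_group_def reduced_words_Cons)
  then show ?thesis using \<alpha>.composition_rule[of x "[a]" w] aw assms(2) by simp
qed

lemma act_inv:
  assumes "a \<in> letters r" "x \<in> space M"
  shows "act (inv_letter a) (act a x) = x" "act a (act (inv_letter a) x) = x"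
proof -
  have *: "act (inv_letter a) (act a x) = x" if "a \<in> letters r" for a
    using \<alpha>.orbit_sym_aux[of "[a]" x "act a x"] that assms(2) generators_inverse(2)[OF that]
    by (simp add: letter_reduced)
  show "act (inv_letter a) (act a x) = x" by (rule *[OF assms(1)])
  show "act a (act (inv_letter a) x) = x" using *[of "inv_letter a"] assms(1) by simp
qed

lemma prob_\<alpha>_vimage:
  assumes "w \<in> reduced_words r" "A \<in> sets M"
  shows "M.prob (\<alpha> w -` A \<inter> space M) = M.prob A"
  using measure_distr[OF \<alpha>_measurable[OF assms(1)] assms(2)] \<alpha>_distr[OF assms(1)] by simp

lemma AE_\<alpha>:
  assumes "w \<in> reduced_words r" "AE x in M. Q x"
  shows "AE x in M. Q (\<alpha> w x)"
proof -
  have "AE y in distr M M (\<alpha> w). Q y" unfolding \<alpha>_distr[OF assms(1)] by (rule assms(2))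
  then show ?thesis by (rule AE_distrD[OF \<alpha>_measurable[OF assms(1)]])
qed

lemma integral_act:
  fixes f :: "'x \<Rightarrow> real"
  assumes "a \<in> letters r" "f \<in> borel_measurable M"
  shows "(\<integral>x. f (act a x) \<partial>M) = (\<integral>x. f x \<partial>M)"
  using integral_distr[OF act_measurable[OF assms(1)] assms(2)] \<alpha>_distr[OF letter_reduced[OF assms(1)]]
  by simp

text \<open>The inverse letter is used because x lies in \<xi>_0 u A exactly when the second
  component of the image lies in u A: translates along \<xi> at x become translates along the
  shifted ray at the image point.\<close>

definition T :: "(nat \<Rightarrow> letter) \<times> 'x \<Rightarrow> (nat \<Rightarrow> letter) \<times> 'x" where
  "T = (\<lambda>(\<xi>, x). (shift \<xi>, act (inv_letter (\<xi> 0)) x))"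

abbreviation Y :: "((nat \<Rightarrow> letter) \<times> 'x) measure" where
  "Y \<equiv> \<nu> \<Otimes>\<^sub>M M"

sublocale Y: pair_prob_space \<nu> M ..

lemma act_pair_measurable [measurable]: "(\<lambda>p. act (inv_letter (fst p 0)) (snd p)) \<in> measurable Y M"
proof (rule measurable_compose_countable'[where I = "letters r" and f = "\<lambda>a p. act (inv_letter a) (snd p)"])
  show "(\<lambda>p. act (inv_letter a) (snd p)) \<in> measurable Y M" if "a \<in> letters r" for a
    using act_measurable[of "inv_letter a"] that by (intro measurable_compose[OF measurable_snd]) simp
  show "(\<lambda>p. fst p 0) \<in> measurable Y (count_space (letters r))"
    by (rule measurable_compose[OF measurable_fst letter_measurable])
qed (simp add: countable_finite)

lemma T_measurable [measurable]: "T \<in> measurable Y Y"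
proof -
  have "(\<lambda>p. (shift (fst p), act (inv_letter (fst p 0)) (snd p))) \<in> measurable Y Y" by measurable
  then show ?thesis by (simp add: T_def case_prod_beta')
qed

text \<open>On each fibre the letter \<xi>_0 acts by a measure preserving map, after which only the
  invariance of \<nu> under the shift is left.\<close>

lemma distr_T: "distr Y Y T = Y"
proof (rule measure_eqI)
  fix C assume "C \<in> sets (distr Y Y T)"
  then have C[measurable]: "C \<in> sets Y" by simp
  have sec: "Pair \<xi> -` C \<in> sets M" for \<xi> by (rule sets_Pair1[OF C])
  have m: "(\<lambda>\<xi>. emeasure M (Pair \<xi> -` C)) \<in> borel_measurable \<nu>"
    by (rule M.measurable_emeasure_Pair[OF C])
  have "emeasure (distr Y Y T) C = emeasure Y (T -` C \<inter> space Y)"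
    by (simp add: emeasure_distr)
  also have "\<dots> = (\<integral>\<^sup>+\<xi>. emeasure M (Pair \<xi> -` (T -` C \<inter> space Y)) \<partial>\<nu>)"
    by (rule M.emeasure_pair_measure_alt) measurable
  also have "\<dots> = (\<integral>\<^sup>+\<xi>. emeasure M (Pair (shift \<xi>) -` C) \<partial>\<nu>)"
  proof (rule nn_integral_cong)
    fix \<xi> assume "\<xi> \<in> space \<nu>"
    then have \<xi>: "\<xi> \<in> boundary r" by simp
    let ?a = "inv_letter (\<xi> 0)"
    have a: "?a \<in> letters r" using boundary_letter[OF \<xi>] by simp
    have "Pair \<xi> -` (T -` C \<inter> space Y) = act ?a -` (Pair (shift \<xi>) -` C) \<inter> space M"
      using \<xi> by (auto simp: T_def space_pair_measure)
    then show "emeasure M (Pair \<xi> -` (T -` C \<inter> space Y)) = emeasure M (Pair (shift \<xi>) -` C)"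
      using prob_\<alpha>_vimage[OF letter_reduced[OF a] sec] by (simp add: M.emeasure_eq_measure)
  qed
  also have "\<dots> = (\<integral>\<^sup>+\<xi>. emeasure M (Pair \<xi> -` C) \<partial>distr \<nu> \<nu> shift)"
    by (rule nn_integral_distr[symmetric]) (use m in auto)
  also have "\<dots> = emeasure Y C"
    unfolding distr_shift by (rule M.emeasure_pair_measure_alt[symmetric, OF C])
  finally show "emeasure (distr Y Y T) C = emeasure Y C" .
qed simp

end

section \<open>From invariant sets of the skew product to the group action\<close>

locale ergodic_free_group_action = free_group_action r M \<alpha>
  for r :: nat and M :: "'x measure" and \<alpha> +
  assumes ergodic: "ergodic_action (free_group r) M \<alpha>"
begin

text \<open>\<open>ergodic_action\<close> speaks of strictly invariant sets. The points whose whole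
  orbit lies in A form such a set, and it agrees with A up to a null set.\<close>

lemma invariant_set_trivial:
  assumes A[measurable]: "A \<in> sets M"
    and inv: "AE x in M. \<forall>w\<in>reduced_words r. \<alpha> w x \<in> A \<longleftrightarrow> x \<in> A"
  shows "M.prob A = 0 \<or> M.prob A = 1"
proof -
  define A' where "A' = {x \<in> space M. \<forall>w\<in>reduced_words r. \<alpha> w x \<in> A}"
  have "{x \<in> space M. w \<in> reduced_words r \<longrightarrow> \<alpha> w x \<in> A} \<in> sets M" for w
  proof (cases "w \<in> reduced_words r")
    case True
    note \<alpha>_measurable[OF True, measurable]
    show ?thesis using True by simp
  qed simp
  then have A'm[measurable]: "A' \<in> sets M"
    unfolding A'_def Ball_def by (rule sets.sets_Collect_countable_All)
  have act_A': "\<alpha> g x \<in> A'" if x: "x \<in> A'" and g: "g \<in> reduced_words r" for g x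
    unfolding A'_def
  proof (safe)
    show "\<alpha> g x \<in> space M" using x g by (auto simp: A'_def intro: \<alpha>_space)
    fix w assume w: "w \<in> reduced_words r"
    have "w \<otimes>\<^bsub>free_group r\<^esub> g \<in> reduced_words r"
      using group.is_monoid[OF group_free_group, of r] monoid.m_closed[of "free_group r" w g] w g by simp
    then have "\<alpha> (w \<otimes>\<^bsub>free_group r\<^esub> g) x \<in> A" using x by (simp add: A'_def)
    then show "\<alpha> w (\<alpha> g x) \<in> A" using \<alpha>.composition_rule[of x w g] x w g by (simp add: A'_def)
  qed
  have "\<alpha> g ` A' = A'" if g: "g \<in> reduced_words r" for g
  proof
    show "\<alpha> g ` A' \<subseteq> A'" using act_A' g by blast
    show "A' \<subseteq> \<alpha> g ` A'"
    proof
      fix x assume x: "x \<in> A'"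
      let ?h = "inv\<^bsub>free_group r\<^esub> g"
      have h: "?h \<in> reduced_words r"
        using group.inv_closed[OF group_free_group, of g r] g by simp
      have "\<alpha> g (\<alpha> ?h x) = x"
        using \<alpha>.composition_rule[of x g ?h] group.r_inv[OF group_free_group, of g r] g h x \<alpha>_Nil[of x]
        by (simp add: A'_def free_group_def)
      then show "x \<in> \<alpha> g ` A'" using act_A'[OF x h] by (metis imageI)
    qed
  qed
  then have "M.prob A' = 0 \<or> M.prob A' = 1"
    using ergodic A'm by (simp add: ergodic_action_def)
  moreover have "M.prob A' = M.prob A"
  proof (rule M.finite_measure_eq_AE)
    show "AE x in M. x \<in> A' \<longleftrightarrow> x \<in> A"
      using inv AE_space
    proof eventually_elim
      case (elim x)
      have "reduced_words r \<noteq> {}" using Nil_reduced by blast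
      then show ?case using elim \<alpha>_Nil[of x] by (auto simp: A'_def)
    qed
  qed auto
  ultimately show ?thesis by simp
qed

text \<open>The set where f exceeds its mean is null or of full measure. In both cases f minus its
  mean has a constant sign and integral 0, so it vanishes almost everywhere.\<close>

lemma invariant_function_const:
  fixes f :: "'x \<Rightarrow> real"
  assumes f: "integrable M f"
    and inv: "\<And>a. a \<in> letters r \<Longrightarrow> AE x in M. f (act a x) = f x"
  shows "AE x in M. f x = (\<integral>x. f x \<partial>M)"
proof -
  have [measurable]: "f \<in> borel_measurable M" using f by simp
  have "AE x in M. f (\<alpha> w x) = f x" if "w \<in> reduced_words r" for w
    using that
  proof (induction w)
    case Nil
    show ?case using AE_space by eventually_elim (simp add: \<alpha>_Nil)
  next
    case (Cons a w)
    then have aw: "a \<in> letters r" "w \<in> reduced_words r" by (auto simp: reduced_words_Cons)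
    show ?case using AE_\<alpha>[OF aw(2) inv[OF aw(1)]] Cons.IH[OF aw(2)] AE_space
      by eventually_elim (simp add: \<alpha>_Cons[OF Cons.prems])
  qed
  then have "AE x in M. \<forall>w\<in>reduced_words r. f (\<alpha> w x) = f x"
    by (subst AE_ball_countable) auto
  then have "AE x in M. \<forall>w\<in>reduced_words r. \<alpha> w x \<in> {x \<in> space M. (\<integral>x. f x \<partial>M) < f x}
      \<longleftrightarrow> x \<in> {x \<in> space M. (\<integral>x. f x \<partial>M) < f x}"
    using AE_space by eventually_elim (auto simp: \<alpha>_space)
  then have "M.prob {x \<in> space M. (\<integral>x. f x \<partial>M) < f x} = 0 \<or> M.prob {x \<in> space M. (\<integral>x. f x \<partial>M) < f x} = 1"
    by (intro invariant_set_trivial) measurable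
  then show ?thesis
  proof
    assume "M.prob {x \<in> space M. (\<integral>x. f x \<partial>M) < f x} = 0"
    then have "AE x in M. x \<notin> {x \<in> space M. (\<integral>x. f x \<partial>M) < f x}"
      by (intro AE_not_in) (auto simp: M.emeasure_eq_measure null_sets_def)
    then have le: "AE x in M. 0 \<le> (\<integral>x. f x \<partial>M) - f x"
      using AE_space by eventually_elim auto
    have "(\<integral>x. (\<integral>x. f x \<partial>M) - f x \<partial>M) = 0"
      using f by (simp add: M.prob_space)
    then have "AE x in M. (\<integral>x. f x \<partial>M) - f x = 0"
      using integral_nonneg_eq_0_iff_AE[OF _ le] f by simp
    then show ?thesis by eventually_elim simp
  next
    assume "M.prob {x \<in> space M. (\<integral>x. f x \<partial>M) < f x} = 1"
    then have ae: "AE x in M. (\<integral>x. f x \<partial>M) < f x"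
      by (subst (asm) M.prob_Collect_eq_1) auto
    have le: "AE x in M. 0 \<le> f x - (\<integral>x. f x \<partial>M)" using ae by eventually_elim simp
    have "(\<integral>x. f x - (\<integral>x. f x \<partial>M) \<partial>M) = 0"
      using f by (simp add: M.prob_space)
    then have "AE x in M. f x - (\<integral>x. f x \<partial>M) = 0"
      using integral_nonneg_eq_0_iff_AE[OF _ le] f by simp
    then show ?thesis by eventually_elim simp
  qed
qed

text \<open>A family that equals its own average over followers has equality in Jensen's inequality for
  the square, so all the averaged functions agree.\<close>

lemma harmonic_family_const:
  fixes F :: "letter \<Rightarrow> 'x \<Rightarrow> real"
  assumes F[measurable]: "\<And>a. a \<in> letters r \<Longrightarrow> F a \<in> borel_measurable M"
    and bound: "\<And>a x. \<bar>F a x\<bar> \<le> 1"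
    and harm: "\<And>a x. a \<in> letters r \<Longrightarrow> x \<in> space M \<Longrightarrow>
       (2 * real r - 1) * F a x = (\<Sum>b\<in>letters r - {inv_letter a}. F b (act (inv_letter a) x))"
  shows "\<exists>c. \<forall>a\<in>letters r. AE x in M. F a x = c"
proof -
  define N where "N = 2 * real r - 1"
  have N: "0 < N" "real (2 * r - 1) = N" using rank by (auto simp: N_def of_nat_diff)
  define I where "I a = (\<integral>x. (F a x)\<^sup>2 \<partial>M)" for a
  let ?f = "\<lambda>a. letters r - {inv_letter a}"
  define V where "V a x = (\<Sum>b\<in>?f a. (F b (act (inv_letter a) x) - F a x)\<^sup>2)" for a x
  have V: "V a x = (\<Sum>b\<in>?f a. (F b (act (inv_letter a) x))\<^sup>2) - N * (F a x)\<^sup>2"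
    if "a \<in> letters r" "x \<in> space M" for a x
  proof -
    have "V a x = (\<Sum>b\<in>?f a. (F b (act (inv_letter a) x))\<^sup>2 - 2 * F a x * F b (act (inv_letter a) x) + (F a x)\<^sup>2)"
      unfolding V_def by (intro sum.cong) (auto simp: power2_eq_square algebra_simps)
    also have "\<dots> = (\<Sum>b\<in>?f a. (F b (act (inv_letter a) x))\<^sup>2)
        - 2 * F a x * (\<Sum>b\<in>?f a. F b (act (inv_letter a) x)) + real (card (?f a)) * (F a x)\<^sup>2"
      unfolding sum.distrib sum_subtractf sum_distrib_left[symmetric] by simp
    also have "(\<Sum>b\<in>?f a. F b (act (inv_letter a) x)) = N * F a x"
      using harm[OF that] by (simp add: N_def)
    also have "real (card (?f a)) = N" unfolding card_followers[OF that(1)] by (rule N)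
    finally show ?thesis by (simp add: power2_eq_square)
  qed
  have b2: "(F a x)\<^sup>2 \<le> 1" for a x
    using power_mono[OF bound[of a x], of 2] by simp
  have i1: "integrable M (\<lambda>x. (F b x)\<^sup>2)" if "b \<in> letters r" for b
    by (rule M.integrable_const_bound[of _ 1]) (use that b2 in auto)
  have Fm: "(\<lambda>x. (F b (act (inv_letter a) x))\<^sup>2) \<in> borel_measurable M" if "a \<in> letters r" "b \<in> letters r" for a b
    using measurable_compose[OF act_measurable[of "inv_letter a"] F[OF that(2)]] that by simp
  have i2: "integrable M (\<lambda>x. (F b (act (inv_letter a) x))\<^sup>2)" if "a \<in> letters r" "b \<in> letters r" for a b
    by (rule M.integrable_const_bound[of _ 1]) (use Fm that b2 in auto)
  have e2: "(\<integral>x. (F b (act (inv_letter a) x))\<^sup>2 \<partial>M) = I b" if "a \<in> letters r" "b \<in> letters r" for a b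
    unfolding I_def by (rule integral_act[of "inv_letter a" "\<lambda>x. (F b x)\<^sup>2"]) (use that in auto)
  have iV: "integrable M (V a)" if "a \<in> letters r" for a
  proof -
    have "integrable M (\<lambda>x. (\<Sum>b\<in>?f a. (F b (act (inv_letter a) x))\<^sup>2) - N * (F a x)\<^sup>2)"
      using that by (intro Bochner_Integration.integrable_diff Bochner_Integration.integrable_sum i2 integrable_mult_right i1) auto
    then show ?thesis using V[OF that] by (subst Bochner_Integration.integrable_cong[OF refl]) auto
  qed
  have eV: "(\<integral>x. V a x \<partial>M) = (\<Sum>b\<in>?f a. I b) - N * I a" if a: "a \<in> letters r" for a
  proof -
    have "(\<integral>x. V a x \<partial>M) = (\<integral>x. (\<Sum>b\<in>?f a. (F b (act (inv_letter a) x))\<^sup>2) - N * (F a x)\<^sup>2 \<partial>M)"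
      by (rule Bochner_Integration.integral_cong) (use V a in auto)
    also have "\<dots> = (\<integral>x. (\<Sum>b\<in>?f a. (F b (act (inv_letter a) x))\<^sup>2) \<partial>M) - (\<integral>x. N * (F a x)\<^sup>2 \<partial>M)"
      using a by (intro Bochner_Integration.integral_diff Bochner_Integration.integrable_sum i2 integrable_mult_right i1) auto
    also have "(\<integral>x. (\<Sum>b\<in>?f a. (F b (act (inv_letter a) x))\<^sup>2) \<partial>M) = (\<Sum>b\<in>?f a. I b)"
      using a by (subst Bochner_Integration.integral_sum) (auto intro!: sum.cong i2 e2)
    finally show ?thesis by (simp add: I_def)
  qed
  \<comment> \<open>Each letter b may follow all but one of the 2r letters, so \<open>I b\<close>
    occurs 2r - 1 times in the double sum. Hence the integrals of the nonnegative defects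
    \<open>V a\<close> add up to 0.\<close>
  have "(\<Sum>a\<in>letters r. \<Sum>b\<in>?f a. I b) = (\<Sum>a\<in>letters r. (\<Sum>b\<in>letters r. I b) - I (inv_letter a))"
    by (intro sum.cong) (auto simp: sum_diff1)
  also have "\<dots> = 2 * real r * (\<Sum>b\<in>letters r. I b) - (\<Sum>a\<in>letters r. I (inv_letter a))"
    by (simp add: sum_subtractf card_letters)
  also have "(\<Sum>a\<in>letters r. I (inv_letter a)) = (\<Sum>a\<in>letters r. I a)"
    by (rule sum.reindex_bij_witness[of _ inv_letter inv_letter]) auto
  finally have "(\<Sum>a\<in>letters r. (\<Sum>b\<in>?f a. I b) - N * I a) = 0"
    unfolding sum_subtractf sum_distrib_left[symmetric] by (simp add: N_def algebra_simps)
  then have "(\<Sum>a\<in>letters r. \<integral>x. V a x \<partial>M) = 0"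
    using eV by (simp cong: sum.cong)
  moreover have V0: "0 \<le> V a x" for a x unfolding V_def by (intro sum_nonneg) auto
  ultimately have "(\<integral>x. V a x \<partial>M) = 0" if "a \<in> letters r" for a
    using that by (subst (asm) sum_nonneg_eq_0_iff) auto
  then have "AE x in M. V a x = 0" if "a \<in> letters r" for a
    using integral_nonneg_eq_0_iff_AE[OF iV[OF that]] V0 that by simp
  then have AEV: "AE x in M. F b (act (inv_letter a) x) = F a x"
    if "a \<in> letters r" "b \<in> letters r" "b \<noteq> inv_letter a" for a b
  proof -
    from \<open>\<And>a. a \<in> letters r \<Longrightarrow> AE x in M. V a x = 0\<close>[OF that(1)]
    show ?thesis
    proof eventually_elim
      case (elim x)
      then have "\<forall>b\<in>?f a. (F b (act (inv_letter a) x) - F a x)\<^sup>2 = 0"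
        unfolding V_def by (subst (asm) sum_nonneg_eq_0_iff) auto
      then show ?case using that by simp
    qed
  qed
  have AEF: "AE x in M. F a (act a x) = F b x"
    if "a \<in> letters r" "b \<in> letters r" "b \<noteq> inv_letter a" for a b
    using AE_\<alpha>[OF letter_reduced[OF that(1)] AEV[OF that]] AE_space
    by eventually_elim (use act_inv[OF that(1)] in auto)
  have AEeq: "AE x in M. F b x = F b' x" if b: "b \<in> letters r" "b' \<in> letters r" for b b'
  proof -
    \<comment> \<open>To compare b and b' there must be a letter a that both may follow; at most two
      letters are excluded and at least four exist.\<close>
    have "\<not> letters r \<subseteq> {inv_letter b, inv_letter b'}"
    proof
      assume "letters r \<subseteq> {inv_letter b, inv_letter b'}"
      then have "card (letters r) \<le> card {inv_letter b, inv_letter b'}" by (intro card_mono) auto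
      also have "\<dots> \<le> 2" by (simp add: card_insert_if)
      finally show False using rank by (simp add: card_letters)
    qed
    then obtain a where a: "a \<in> letters r" "a \<noteq> inv_letter b" "a \<noteq> inv_letter b'" by blast
    then have "b \<noteq> inv_letter a" "b' \<noteq> inv_letter a" by auto
    then show ?thesis using AEF[OF a(1) b(1)] AEF[OF a(1) b(2)] by (auto elim: AE_mp)
  qed
  let ?b = "(1, True) :: letter"
  have b0: "?b \<in> letters r" using rank by (auto simp: letters_def)
  have "AE x in M. F ?b x = (\<integral>x. F ?b x \<partial>M)"
  proof (rule invariant_function_const)
    show "integrable M (F ?b)"
      by (rule M.integrable_const_bound[of _ 1]) (use b0 bound in auto)
    fix a assume a: "a \<in> letters r"
    have "letters r - {inv_letter a} \<noteq> {}"
    proof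
      assume "letters r - {inv_letter a} = {}"
      then have "card ({} :: letter set) = 2 * r - 1" using card_followers[OF a] by (simp only:)
      then show False using rank by simp
    qed
    then obtain b where b: "b \<in> letters r" "b \<noteq> inv_letter a" by blast
    \<comment> \<open>Replace the fixed letter by a at the point a x, use harmonicity to get from F
      a at a x to F b at x, and return from b to the fixed letter.\<close>
    show "AE x in M. F ?b (act a x) = F ?b x"
      using AE_\<alpha>[OF letter_reduced[OF a] AEeq[OF b0 a]] AEF[OF a b] AEeq[OF b(1) b0]
      by eventually_elim simp
  qed
  then have "AE x in M. F b x = (\<integral>x. F ?b x \<partial>M)" if "b \<in> letters r" for b
    using AEeq[OF that b0] by eventually_elim simp
  then show ?thesis by blast
qed

text \<open>\<open>F w x\<close> is the mass of the section of E at x inside a cylinder. Once the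
  one-letter masses are constant, invariance fixes those of all cylinders, so for almost every x the
  restriction of \<nu> to the section equals C \<nu>. Evaluated on the section itself this says C =
  C * C.\<close>

theorem ergodic_T:
  assumes E[measurable]: "E \<in> sets Y" and inv: "T -` E \<inter> space Y = E"
  shows "Y.prob E = 0 \<or> Y.prob E = 1"
proof -
  define S where "S x = {\<xi>. (\<xi>, x) \<in> E}" for x
  have S_sets: "S x \<in> sets \<nu>" for x
    using sets_Pair2[OF E, of x] by (simp add: S_def vimage_def)
  have Ssub: "S x \<subseteq> boundary r" for x using sets.sets_into_space[OF S_sets] by simp
  define F where "F w x = \<nu>.prob (cylinder r w \<inter> S x)" for w x
  have Fm: "F w \<in> borel_measurable M" for w
  proof -
    have C: "E \<inter> (cylinder r w \<times> space M) \<in> sets Y" by measurable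
    have "(\<lambda>x. emeasure \<nu> ((\<lambda>\<xi>. (\<xi>, x)) -` (E \<inter> (cylinder r w \<times> space M)))) \<in> borel_measurable M"
      by (rule Y.measurable_emeasure_Pair2[OF C])
    moreover have "(\<lambda>\<xi>. (\<xi>, x)) -` (E \<inter> (cylinder r w \<times> space M)) = cylinder r w \<inter> S x" if "x \<in> space M" for x
      using that by (auto simp: S_def)
    ultimately have "(\<lambda>x. emeasure \<nu> (cylinder r w \<inter> S x)) \<in> borel_measurable M"
      by (simp cong: measurable_cong)
    then show ?thesis unfolding F_def[abs_def] measure_def by measurable
  qed
  \<comment> \<open>For rays beginning with a, invariance of E says that \<xi> is in the section at
    x exactly when its shift is in the section at the moved point; the factor 2r - 1 is the Markov
    property.\<close>
  have step: "F (b # w) (act (inv_letter a) x) = (2 * real r - 1) * F (a # b # w) x"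
    if ab: "a # b # w \<in> reduced_words r" and x: "x \<in> space M" for a b w x
  proof -
    have ab2: "[a, b] \<in> reduced_words r" using ab by (auto simp: reduced_words_Cons)
    let ?D = "cylinder r (b # w) \<inter> S (act (inv_letter a) x)"
    have D: "?D \<in> sets \<nu>" using S_sets by measurable
    have 1: "cylinder r [b] \<inter> ?D = ?D" by (auto simp: mem_cylinder_Cons shift_boundary dest: cylinder_boundary)
    have SE: "\<xi> \<in> S x \<longleftrightarrow> shift \<xi> \<in> S (act (inv_letter a) x)" if "\<xi> \<in> boundary r" "\<xi> 0 = a" for \<xi>
    proof -
      have "(\<xi>, x) \<in> E \<longleftrightarrow> T (\<xi>, x) \<in> E"
        using inv that x by (auto simp: space_pair_measure)
      then show ?thesis using that by (simp add: S_def T_def)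
    qed
    have 2: "cylinder r [a, b] \<inter> (shift -` ?D \<inter> boundary r) = cylinder r (a # b # w) \<inter> S x"
      using SE by (auto simp: mem_cylinder_Cons shift_boundary)
    show ?thesis using measure_shift_vimage[OF ab2 D] unfolding 1 2 F_def .
  qed
  have "\<exists>c. \<forall>a\<in>letters r. AE x in M. F [a] x = c"
  proof (rule harmonic_family_const)
    fix a x assume a: "a \<in> letters r" and x: "x \<in> space M"
    let ?L = "letters r - {inv_letter a}"
    have red: "[a, b] \<in> reduced_words r" if "b \<in> ?L" for b
      using that a by (auto simp: reduced_words_Cons reduced_words_def)
    have "cylinder r [a] \<inter> S x = (\<Union>b\<in>?L. cylinder r [a, b] \<inter> S x)"
    proof (rule Set.set_eqI, rule iffI)
      fix \<xi> assume \<xi>: "\<xi> \<in> cylinder r [a] \<inter> S x"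
      then have "\<xi> \<in> cylinder r [a, \<xi> 1]"
        by (auto simp: mem_cylinder_Cons shift_boundary shift_def[of \<xi>])
      moreover from this have "[a, \<xi> 1] \<in> reduced_words r" using cylinder_not_reduced by blast
      then have "\<xi> 1 \<in> ?L" by (auto simp: reduced_words_def)
      ultimately show "\<xi> \<in> (\<Union>b\<in>?L. cylinder r [a, b] \<inter> S x)" using \<xi> by blast
    next
      fix \<xi> assume "\<xi> \<in> (\<Union>b\<in>?L. cylinder r [a, b] \<inter> S x)"
      then show "\<xi> \<in> cylinder r [a] \<inter> S x" by (auto simp: mem_cylinder_Cons)
    qed
    then have "F [a] x = (\<Sum>b\<in>?L. F [a, b] x)"
      unfolding F_def
    proof (simp only:, intro \<nu>.finite_measure_finite_Union)
      show "disjoint_family_on (\<lambda>b. cylinder r [a, b] \<inter> S x) ?L"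
        by (auto simp: disjoint_family_on_def mem_cylinder_Cons)
    qed (use S_sets in auto)
    then show "(2 * real r - 1) * F [a] x = (\<Sum>b\<in>?L. F [b] (act (inv_letter a) x))"
      using step[OF red x] by (simp add: sum_distrib_left)
  next
    show "F [a] \<in> borel_measurable M" for a by (rule Fm)
    show "\<bar>F [a] x\<bar> \<le> 1" for a x by (simp add: F_def)
  qed
  then obtain c where c: "\<And>a. a \<in> letters r \<Longrightarrow> AE x in M. F [a] x = c" by blast
  \<comment> \<open>The factor 2r normalises c, since a one-letter cylinder has mass 1 /
    (2r).\<close>
  have Fw: "AE x in M. F w x = c * (2 * real r) * \<nu>.prob (cylinder r w)"
    if "w \<in> reduced_words r" "w \<noteq> []" for w
    using that
  proof (induction w rule: induct_list012)
    case (2 a)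
    then have "a \<in> letters r" by (simp add: reduced_words_Cons)
    from c[OF this] show ?case
      by eventually_elim (use 2 rank in \<open>simp add: measure_cylinder\<close>)
  next
    case (3 a b w)
    then have a: "inv_letter a \<in> letters r" "b # w \<in> reduced_words r" by (auto simp: reduced_words_Cons)
    have "AE x in M. F (b # w) x = c * (2 * real r) * \<nu>.prob (cylinder r (b # w))"
      using 3 a by simp
    from AE_\<alpha>[OF letter_reduced[OF a(1)] this] AE_space
    show ?case
    proof eventually_elim
      case (elim x)
      have "(2 * real r - 1) * F (a # b # w) x = F (b # w) (act (inv_letter a) x)"
        by (rule step[OF 3(3) elim(2), symmetric])
      also have "\<dots> = c * (2 * real r) * ((2 * real r - 1) * \<nu>.prob (cylinder r (a # b # w)))"
        using elim(1) unfolding measure_cylinder_Cons[OF 3(3)] .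
      also have "\<dots> = (2 * real r - 1) * (c * (2 * real r) * \<nu>.prob (cylinder r (a # b # w)))"
        by (simp only: ac_simps)
      finally show ?case using rank by simp
    qed
  qed simp
  define C where "C = c * (2 * real r)"
  have all: "AE x in M. \<forall>w\<in>reduced_words r - {[]}. F w x = C * \<nu>.prob (cylinder r w)"
    by (subst AE_ball_countable) (use Fw in \<open>auto simp: C_def\<close>)
  have dich: "AE x in M. \<nu>.prob (S x) = C \<and> (C = 0 \<or> C = 1)"
    using all
  proof eventually_elim
    case (elim x)
    have b0: "(1, True) \<in> letters r" using rank by (auto simp: letters_def)
    then have red0: "[(1, True)] \<in> reduced_words r" by (simp add: reduced_words_def)
    have "0 \<le> F [(1, True)] x" by (simp add: F_def)
    then have "0 \<le> C * \<nu>.prob (cylinder r [(1, True)])" using elim red0 by simp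
    then have C0: "0 \<le> C"
      using measure_cylinder[OF red0] rank by (simp add: zero_le_divide_iff)
    have bS: "boundary r = (\<Union>a\<in>letters r. cylinder r [a])"
      by (auto simp: mem_cylinder_Cons shift_boundary boundary_letter dest: cylinder_boundary)
    have letter: "F [a] x = C / (2 * real r)" if "a \<in> letters r" for a
      using elim measure_cylinder[of "[a]"] letter_reduced[OF that] by simp
    have SC: "\<nu>.prob (S x) = C"
    proof -
      have "S x = (\<Union>a\<in>letters r. cylinder r [a] \<inter> S x)" using Ssub[of x] bS by blast
      then have "\<nu>.prob (S x) = \<nu>.prob (\<Union>a\<in>letters r. cylinder r [a] \<inter> S x)" by simp
      also have "\<dots> = (\<Sum>a\<in>letters r. \<nu>.prob (cylinder r [a] \<inter> S x))"
        by (rule \<nu>.finite_measure_finite_Union)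
          (use S_sets in \<open>auto simp: disjoint_family_on_def mem_cylinder_Cons\<close>)
      also have "\<dots> = C" using letter rank by (simp add: F_def card_letters)
      finally show ?thesis .
    qed
    have eq: "density \<nu> (indicator (S x)) = density \<nu> (\<lambda>_. ennreal C)"
    proof (rule measure_eqI_cylinders)
      fix w
      have "\<nu>.prob (cylinder r w \<inter> S x) = C * \<nu>.prob (cylinder r w)"
      proof -
        consider "w = []" | "w \<notin> reduced_words r" | "w \<in> reduced_words r - {[]}" by blast
        then show ?thesis
        proof cases
          case 1
          then show ?thesis using SC Ssub[of x] \<nu>.prob_space by (simp add: Int_absorb1)
        qed (use elim in \<open>auto simp: cylinder_not_reduced F_def\<close>)
      qed
      then show "emeasure (density \<nu> (indicator (S x))) (cylinder r w) = emeasure (density \<nu> (\<lambda>_. ennreal C)) (cylinder r w)"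
        using S_sets C0
        by (simp add: emeasure_density \<nu>.emeasure_eq_measure nn_integral_cmult ennreal_mult Int_commute flip: indicator_inter_arith)
    next
      show "emeasure (density \<nu> (indicator (S x))) (boundary r) \<noteq> \<infinity>"
        using S_sets[of x] sets.top[of \<nu>]
        by (simp add: emeasure_density \<nu>.emeasure_eq_measure flip: indicator_inter_arith)
    qed auto
    have "emeasure (density \<nu> (indicator (S x))) (S x) = emeasure (density \<nu> (\<lambda>_. ennreal C)) (S x)"
      unfolding eq ..
    then have "ennreal C = ennreal (C * C)"
      using S_sets[of x] C0 SC
      by (simp add: emeasure_density \<nu>.emeasure_eq_measure nn_integral_cmult ennreal_mult flip: indicator_inter_arith)
    then have "C = C * C" using C0 by simp
    then show ?case using SC by auto
  qed
  have "\<exists>x. C = 0 \<or> C = 1"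
  proof (rule ccontr)
    assume "\<not> ?thesis"
    then have "AE x in M. False" using dich by (auto elim: AE_mp)
    then show False using M.not_empty M.AE_False by simp
  qed
  then have C: "C = 0 \<or> C = 1" by simp
  have "emeasure Y E = (\<integral>\<^sup>+x. emeasure \<nu> ((\<lambda>\<xi>. (\<xi>, x)) -` E) \<partial>M)"
    by (rule Y.emeasure_pair_measure_alt2[OF E])
  also have "\<dots> = (\<integral>\<^sup>+x. ennreal C \<partial>M)"
    using dich by (intro nn_integral_cong_AE) (auto simp: S_def \<nu>.emeasure_eq_measure vimage_def elim: AE_mp)
  also have "\<dots> = ennreal C" by (simp add: M.emeasure_space_1)
  finally have "Y.prob E = C" using C by (auto simp: measure_def)
  then show ?thesis using C by simp
qed

end

section \<open>Information of joins along a ray\<close>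

text \<open>Connects the unordered sums in which entropy and the moment condition are stated with
  the integration theory used for cells.\<close>

lemma nn_integral_count_space_eq_infsum:
  fixes f :: "'a \<Rightarrow> ennreal"
  assumes "countable A"
  shows "(\<integral>\<^sup>+a. f a \<partial>count_space A) = (\<Sum>\<^sub>\<infinity>a\<in>A. f a)"
proof (cases "finite A")
  case True
  then show ?thesis by (simp add: nn_integral_count_space_finite)
next
  case False
  have sup: "(\<Sum>\<^sub>\<infinity>a\<in>A. f a) = (SUP F\<in>{F. finite F \<and> F \<subseteq> A}. sum f F)"
    by (rule nonneg_infsum_complete) simp
  let ?e = "from_nat_into A"
  have e: "bij_betw ?e UNIV A" by (rule bij_betw_from_nat_into[OF assms False])
  have "(\<integral>\<^sup>+a. f a \<partial>count_space A) = (\<Sum>n. f (?e n))"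
    using nn_integral_bij_count_space[OF e, of f] by (simp add: nn_integral_count_space_nat)
  also have "\<dots> \<le> (\<Sum>\<^sub>\<infinity>a\<in>A. f a)"
  proof (rule suminf_le_const[OF summableI])
    fix n
    have "inj_on ?e {..<n}" using e by (auto simp: bij_betw_def intro: inj_on_subset)
    then have "(\<Sum>i<n. f (?e i)) = sum f (?e ` {..<n})" by (simp add: sum.reindex)
    also have "\<dots> \<le> (\<Sum>\<^sub>\<infinity>a\<in>A. f a)"
      unfolding sup using e by (intro SUP_upper) (auto simp: bij_betw_def)
    finally show "(\<Sum>i<n. f (?e i)) \<le> (\<Sum>\<^sub>\<infinity>a\<in>A. f a)" .
  qed
  finally have le: "(\<integral>\<^sup>+a. f a \<partial>count_space A) \<le> (\<Sum>\<^sub>\<infinity>a\<in>A. f a)" .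
  have "(\<Sum>\<^sub>\<infinity>a\<in>A. f a) \<le> (\<integral>\<^sup>+a. f a \<partial>count_space A)"
    unfolding sup
  proof (rule SUP_least)
    fix F assume "F \<in> {F. finite F \<and> F \<subseteq> A}"
    then have F: "finite F" "F \<subseteq> A" by auto
    have "sum f F = (\<integral>\<^sup>+a. f a * indicator F a \<partial>count_space A)"
      using F by (subst nn_integral_count_space'[of F]) (auto simp: indicator_def intro!: sum.cong)
    also have "\<dots> \<le> (\<integral>\<^sup>+a. f a \<partial>count_space A)"
      by (intro nn_integral_mono) (auto simp: indicator_def)
    finally show "sum f F \<le> (\<integral>\<^sup>+a. f a \<partial>count_space A)" .
  qed
  with le show ?thesis by (rule antisym)
qed

lemma (in countable_cells) nn_integral_cell_function:
  "(\<integral>\<^sup>+x. f (C x) \<partial>M) = (\<Sum>\<^sub>\<infinity>A\<in>C ` space M. f A * emeasure M A)"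
proof -
  have m[measurable]: "(\<lambda>x. f (C x)) \<in> borel_measurable M"
    by (rule measurable_compose[OF cell_measurable]) simp
  let ?N = "density M (\<lambda>x. f (C x))"
  have sp: "C -` UNIV \<inter> space M = space M" by auto
  have "(\<integral>\<^sup>+x. f (C x) \<partial>M) = emeasure ?N (space M)"
    using m by (subst emeasure_density) (auto intro!: nn_integral_cong)
  also have "\<dots> = (\<integral>\<^sup>+D. emeasure ?N D \<partial>count_space (C ` space M))"
    using emeasure_vimage_cells[of ?N UNIV] sp by simp
  also have "\<dots> = (\<integral>\<^sup>+D. f D * emeasure M D \<partial>count_space (C ` space M))"
  proof (rule nn_integral_cong)
    fix D assume "D \<in> space (count_space (C ` space M))"
    then obtain y where y: "y \<in> space M" "D = C y" by auto
    have D[measurable]: "D \<in> sets M" using cell_sets y by auto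
    have "emeasure ?N D = (\<integral>\<^sup>+x. f D * indicator D x \<partial>M)"
      using cell_eq[OF y(1)] y(2) m D
      by (subst emeasure_density) (auto intro!: nn_integral_cong simp: indicator_def)
    then show "emeasure ?N D = f D * emeasure M D" by (simp add: nn_integral_cmult_indicator)
  qed
  also have "\<dots> = (\<Sum>\<^sub>\<infinity>A\<in>C ` space M. f A * emeasure M A)"
    by (rule nn_integral_count_space_eq_infsum[OF cell_count])
  finally show ?thesis .
qed

text \<open>Countably many null cells have null union. This justifies working with ln 0 = 0: the
  convention is felt on a null set only.\<close>

lemma (in countable_cells) AE_cell_pos: "AE x in M. 0 < prob (C x)"
proof -
  have "AE x in M. \<forall>D\<in>C ` space M. \<not> (prob D = 0 \<and> x \<in> D)"
  proof (subst AE_ball_countable[OF cell_count], intro ballI)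
    fix D assume D: "D \<in> C ` space M"
    then have Ds: "D \<in> sets M" using cell_sets by auto
    show "AE x in M. \<not> (prob D = 0 \<and> x \<in> D)"
    proof (cases "prob D = 0")
      case True
      then have "D \<in> null_sets M" using Ds by (auto simp: emeasure_eq_measure null_sets_def)
      then show ?thesis by (rule AE_mp[OF AE_not_in]) auto
    qed simp
  qed
  then show ?thesis using AE_space
    by eventually_elim (use cell_self in \<open>auto simp: zero_less_measure_iff\<close>)
qed

text \<open>A partition is handled through its equivalence relation. Joins, even nested ones, then
  become conjunctions, and no atom has to be named.\<close>

definition same_atom :: "'a set set \<Rightarrow> 'a \<Rightarrow> 'a \<Rightarrow> bool" where
  "same_atom Q x y \<longleftrightarrow> (\<exists>A\<in>Q. x \<in> A \<and> y \<in> A)"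

lemma partition_on_unique:
  "partition_on X Q \<Longrightarrow> A \<in> Q \<Longrightarrow> B \<in> Q \<Longrightarrow> x \<in> A \<Longrightarrow> x \<in> B \<Longrightarrow> A = B"
  by (auto simp: partition_on_def disjoint_def)

lemma the_atom:
  assumes "partition_on X Q" "x \<in> X"
  shows "(THE A. A \<in> Q \<and> x \<in> A) = {y. same_atom Q x y}" "{y. same_atom Q x y} \<in> Q"
proof -
  obtain A where A: "A \<in> Q" "x \<in> A" using assms by (auto simp: partition_on_def)
  have un: "B = A" if "B \<in> Q" "x \<in> B" for B
    using partition_on_unique[OF assms(1) that(1) A(1) that(2) A(2)] .
  have eq: "{y. same_atom Q x y} = A"
  proof
    show "{y. same_atom Q x y} \<subseteq> A"
    proof
      fix y assume "y \<in> {y. same_atom Q x y}"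
      then obtain B where "B \<in> Q" "x \<in> B" "y \<in> B" by (auto simp: same_atom_def)
      then show "y \<in> A" using un[of B] by simp
    qed
    show "A \<subseteq> {y. same_atom Q x y}" using A by (auto simp: same_atom_def)
  qed
  show "{y. same_atom Q x y} \<in> Q" unfolding eq by (rule A)
  show "(THE A. A \<in> Q \<and> x \<in> A) = {y. same_atom Q x y}"
    unfolding eq
  proof (rule the_equality)
    show "A \<in> Q \<and> x \<in> A" using A by simp
    show "B = A" if "B \<in> Q \<and> x \<in> B" for B using un that by simp
  qed
qed

lemma partition_on_eq_atoms:
  assumes "partition_on X Q"
  shows "Q = (\<lambda>x. {y. same_atom Q x y}) ` X"
proof
  show "Q \<subseteq> (\<lambda>x. {y. same_atom Q x y}) ` X"
  proof
    fix A assume A: "A \<in> Q"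
    then have "A \<noteq> {}" "A \<subseteq> X" using assms by (auto simp: partition_on_def)
    then obtain x where x: "x \<in> A" "x \<in> X" by blast
    have "x \<in> {y. same_atom Q x y}" using A x by (auto simp: same_atom_def)
    then have "A = {y. same_atom Q x y}"
      by (rule partition_on_unique[OF assms A the_atom(2)[OF assms x(2)] x(1)])
    then show "A \<in> (\<lambda>x. {y. same_atom Q x y}) ` X" using x(2) by (rule image_eqI)
  qed
next
  show "(\<lambda>x. {y. same_atom Q x y}) ` X \<subseteq> Q" by (rule image_subsetI) (rule the_atom(2)[OF assms])
qed

lemma same_atom_common_refinement:
  assumes "\<Q> \<noteq> {}"
  shows "same_atom (common_refinement \<Q>) x y \<longleftrightarrow> (\<forall>Q\<in>\<Q>. same_atom Q x y)"
proof
  assume "same_atom (common_refinement \<Q>) x y"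
  then obtain A where A: "A \<in> common_refinement \<Q>" "x \<in> A" "y \<in> A" by (auto simp: same_atom_def)
  show "\<forall>Q\<in>\<Q>. same_atom Q x y"
  proof
    fix Q assume "Q \<in> \<Q>"
    from common_refinement_exists[OF A(1) this] obtain B where "B \<in> Q" "A \<subseteq> B" by blast
    then show "same_atom Q x y" using A by (auto simp: same_atom_def)
  qed
next
  assume *: "\<forall>Q\<in>\<Q>. same_atom Q x y"
  define f where "f Q = (SOME A. A \<in> Q \<and> x \<in> A \<and> y \<in> A)" for Q
  have f: "f Q \<in> Q \<and> x \<in> f Q \<and> y \<in> f Q" if "Q \<in> \<Q>" for Q
  proof -
    have "\<exists>A. A \<in> Q \<and> x \<in> A \<and> y \<in> A" using * that by (auto simp: same_atom_def)
    then show ?thesis unfolding f_def by (rule someI_ex)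
  qed
  have xy: "x \<in> \<Inter> (f ` \<Q>)" "y \<in> \<Inter> (f ` \<Q>)" using f by auto
  have "f \<in> (\<Pi> Q\<in>\<Q>. Q)" using f by auto
  then have "\<Inter> (f ` \<Q>) \<in> common_refinement \<Q>" using xy(1) unfolding common_refinement by blast
  then show "same_atom (common_refinement \<Q>) x y" unfolding same_atom_def using xy by (intro bexI) simp_all
qed

lemma information_eq:
  "partition_on X Q \<Longrightarrow> x \<in> X \<Longrightarrow> information M Q x = - ln (measure M {y. same_atom Q x y})"
  by (simp add: information_def the_atom(1))

lemma countable_cells_Int:
  assumes "countable_cells M C" "countable_cells M D"
  shows "countable_cells M (\<lambda>x. C x \<inter> D x)"
proof -
  interpret C: countable_cells M C by fact
  interpret D: countable_cells M D by fact
  show ?thesis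
  proof unfold_locales
    have "(\<lambda>x. C x \<inter> D x) ` space M \<subseteq> (\<lambda>(A, B). A \<inter> B) ` (C ` space M \<times> D ` space M)" by auto
    then show "countable ((\<lambda>x. C x \<inter> D x) ` space M)"
      by (rule countable_subset) (simp add: C.cell_count D.cell_count)
  next
    fix x y assume "x \<in> space M" "y \<in> C x \<inter> D x"
    then show "C y \<inter> D y = C x \<inter> D x" using C.cell_eq D.cell_eq by blast
  qed (use C.cell_sets D.cell_sets C.cell_self D.cell_self in auto)
qed

lemma (in free_group_action) countable_cells_vimage:
  assumes "countable_cells M C" "a \<in> letters r"
  shows "countable_cells M (\<lambda>x. act a -` C (act a x) \<inter> space M)"
proof -
  interpret C: countable_cells M C by fact
  note [simp] = act_space[OF assms(2)]
  show ?thesis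
  proof unfold_locales
    have "(\<lambda>x. act a -` C (act a x) \<inter> space M) ` space M \<subseteq> (\<lambda>A. act a -` A \<inter> space M) ` (C ` space M)"
      by auto
    then show "countable ((\<lambda>x. act a -` C (act a x) \<inter> space M) ` space M)"
      by (rule countable_subset) (simp add: C.cell_count)
  next
    fix x assume "x \<in> space M"
    then show "act a -` C (act a x) \<inter> space M \<in> sets M"
      by (intro measurable_sets[OF act_measurable[OF assms(2)]] C.cell_sets) simp
  next
    fix x y assume "x \<in> space M" "y \<in> act a -` C (act a x) \<inter> space M"
    then show "act a -` C (act a y) \<inter> space M = act a -` C (act a x) \<inter> space M"
      using C.cell_eq[of "act a x" "act a y"] by simp
  qed (use C.cell_self in auto)
qed

locale partitioned_action = ergodic_free_group_action r M \<alpha>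
  for r :: nat and M :: "'x measure" and \<alpha> +
  fixes P :: "'x set set"
  assumes partition: "countable_measurable_partition M P"
begin

lemma partition_on_P: "partition_on (space M) P"
  using partition by (simp add: countable_measurable_partition_def)

definition atom :: "'x \<Rightarrow> 'x set" where
  "atom x = {y. same_atom P x y}"

lemma atoms_eq: "atom ` space M = P"
  unfolding atom_def[abs_def] by (rule partition_on_eq_atoms[OF partition_on_P, symmetric])

sublocale atom: countable_cells M atom
proof unfold_locales
  show "countable (atom ` space M)"
    using partition by (simp add: atoms_eq countable_measurable_partition_def)
next
  fix x assume x: "x \<in> space M"
  then show "atom x \<in> sets M"
    using partition atoms_eq by (auto simp: countable_measurable_partition_def)
  have self: "z \<in> atom z" if "z \<in> space M" for z
    using that partition_on_P by (auto simp: atom_def same_atom_def partition_on_def)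
  show "x \<in> atom x" by (rule self[OF x])
  fix y assume y: "y \<in> atom x"
  then have ys: "y \<in> space M"
    using partition_on_P by (auto simp: atom_def same_atom_def partition_on_def)
  have "atom y \<in> P" "atom x \<in> P" using x ys atoms_eq by auto
  then show "atom y = atom x"
    using partition_on_unique[OF partition_on_P] self[OF ys] y by blast
qed

text \<open>\<open>cell w x\<close> is the atom containing \<open>x\<close> of the join of the translates of \<open>P\<close> by all prefixes
  of \<open>w\<close>, and \<open>past w x\<close> the one for the nonempty prefixes only.\<close>

primrec cell :: "letter list \<Rightarrow> 'x \<Rightarrow> 'x set" where
  "cell [] x = atom x"
| "cell (a # w) x = atom x \<inter> (act (inv_letter a) -` cell w (act (inv_letter a) x) \<inter> space M)"

definition past :: "letter list \<Rightarrow> 'x \<Rightarrow> 'x set" where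
  "past w x = (case w of [] \<Rightarrow> space M
     | a # v \<Rightarrow> act (inv_letter a) -` cell v (act (inv_letter a) x) \<inter> space M)"

lemma cell_eq_past: "x \<in> space M \<Longrightarrow> cell w x = atom x \<inter> past w x"
  using sets.sets_into_space[OF atom.cell_sets[of x]] by (cases w) (auto simp: past_def)

lemma countable_cells_cell: "set w \<subseteq> letters r \<Longrightarrow> countable_cells M (cell w)"
proof (induction w)
  case Nil
  then show ?case using atom.countable_cells_axioms by (simp cong: if_cong)
next
  case (Cons a w)
  then show ?case
    using countable_cells_Int[OF atom.countable_cells_axioms
        countable_cells_vimage[of "cell w" "inv_letter a"]] by simp
qed

lemma past_Nil: "past [] = (\<lambda>x. space M)"
  by (rule ext) (simp add: past_def)

lemma past_Cons: "past (a # w) = (\<lambda>x. act (inv_letter a) -` cell w (act (inv_letter a) x) \<inter> space M)"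
  by (rule ext) (simp add: past_def)

lemma countable_cells_past:
  assumes "set w \<subseteq> letters r"
  shows "countable_cells M (past w)"
proof (cases w)
  case Nil
  show ?thesis unfolding Nil past_Nil
  proof unfold_locales
    have "(\<lambda>x. space M) ` space M \<subseteq> {space M}" by blast
    then show "countable ((\<lambda>x. space M) ` space M)" by (rule countable_subset) simp
  qed auto
next
  case (Cons a v)
  have "inv_letter a \<in> letters r" "set v \<subseteq> letters r" using assms Cons by auto
  then show ?thesis unfolding Cons past_Cons
    by (intro countable_cells_vimage countable_cells_cell)
qed

text \<open>Along a ray words grow at their end, whereas \<open>cell\<close> recurses on the first
  letter as the chain rule wants. This reconciles the two and makes the pasts of the prefixes of
  \<xi> nested.\<close>

lemma cell_append: "set w \<subseteq> letters r \<Longrightarrow> x \<in> space M \<Longrightarrow> cell (w @ [b]) x \<subseteq> cell w x"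
proof (induction w arbitrary: x)
  case (Cons a w)
  then show ?case using act_space[of "inv_letter a" x] by auto
qed simp

lemma past_append: "set w \<subseteq> letters r \<Longrightarrow> x \<in> space M \<Longrightarrow> past (w @ [b]) x \<subseteq> past w x"
  using cell_append[of "tl w" "act (inv_letter (hd w)) x" b] act_space[of "inv_letter (hd w)" x]
  by (cases w) (auto simp: past_def)

lemma boundary_prefix_letters: "\<xi> \<in> boundary r \<Longrightarrow> set (map \<xi> [0..<n]) \<subseteq> letters r"
  by (auto simp: boundary_letter)

lemma partition_cell_filtration_past:
  assumes \<xi>: "\<xi> \<in> boundary r"
  shows "partition_cell_filtration M (\<lambda>n. past (map \<xi> [0..<n])) atom"
proof (intro partition_cell_filtration.intro cell_filtration.intro cell_filtration_axioms.intro
    atom.countable_cells_axioms M.prob_space_axioms)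
  show "countable_cells M (past (map \<xi> [0..<n]))" for n
    by (rule countable_cells_past[OF boundary_prefix_letters[OF \<xi>]])
  show "past (map \<xi> [0..<Suc n]) x \<subseteq> past (map \<xi> [0..<n]) x" if "x \<in> space M" for x n
    using past_append[OF boundary_prefix_letters[OF \<xi>] that] by simp
qed

section \<open>The chain rule along orbits of the skew product\<close>

definition joint_info :: "letter list \<Rightarrow> 'x \<Rightarrow> real" where
  "joint_info w x = - ln (M.prob (cell w x))"

text \<open>The information of P given the join of its translates by the nonempty prefixes of w; for
  the empty word the condition is trivial.\<close>

definition cond_info :: "letter list \<Rightarrow> 'x \<Rightarrow> real" where
  "cond_info w x = - ln (M.prob (atom x \<inter> past w x) / M.prob (past w x))"

lemma cond_info_nonneg: "0 \<le> cond_info w x"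
proof -
  have "M.prob (atom x \<inter> past w x) / M.prob (past w x) \<le> 1"
  proof (cases "past w x \<in> sets M")
    case True
    then have "M.prob (atom x \<inter> past w x) \<le> M.prob (past w x)" by (intro M.finite_measure_mono) auto
    then show ?thesis by (simp add: divide_le_eq_1 zero_less_measure_iff)
  qed (simp add: measure_notin_sets)
  then show ?thesis
    by (cases "M.prob (atom x \<inter> past w x) / M.prob (past w x) = 0")
      (auto simp: cond_info_def ln_le_zero_iff zero_less_measure_iff)
qed

lemma joint_info_nonneg: "0 \<le> joint_info w x"
  by (cases "M.prob (cell w x) = 0") (auto simp: joint_info_def zero_less_measure_iff)

lemma joint_info_measurable: "set w \<subseteq> letters r \<Longrightarrow> joint_info w \<in> borel_measurable M"
  using measurable_compose[OF countable_cells.cell_measurable[OF countable_cells_cell], of w "\<lambda>D. - ln (M.prob D)" borel]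
  by (simp add: joint_info_def[abs_def])

lemma cond_info_measurable:
  assumes w: "set w \<subseteq> letters r"
  shows "cond_info w \<in> borel_measurable M"
proof -
  have [measurable]: "(\<lambda>x. M.prob (cell w x)) \<in> borel_measurable M"
    by (rule measurable_compose[OF countable_cells.cell_measurable[OF countable_cells_cell[OF w]]]) simp
  have [measurable]: "(\<lambda>x. M.prob (past w x)) \<in> borel_measurable M"
    by (rule measurable_compose[OF countable_cells.cell_measurable[OF countable_cells_past[OF w]]]) simp
  have "(\<lambda>x. - ln (M.prob (cell w x) / M.prob (past w x))) \<in> borel_measurable M" by measurable
  then show ?thesis
    by (rule measurable_cong[THEN iffD1, rotated]) (simp add: cond_info_def cell_eq_past)
qed

lemma prob_past_Cons:
  assumes "a \<in> letters r" "set w \<subseteq> letters r" "x \<in> space M"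
  shows "M.prob (past (a # w) x) = M.prob (cell w (act (inv_letter a) x))"
proof -
  interpret C: countable_cells M "cell w" by (rule countable_cells_cell) fact
  show ?thesis
    using prob_\<alpha>_vimage[of "[inv_letter a]" "cell w (act (inv_letter a) x)"] assms C.cell_sets
    by (simp add: past_def letter_reduced act_space)
qed

text \<open>Points at which no logarithm in the chain rule meets a null cell. Quantifying over all
  words keeps the set of full measure, words being countable, and makes it stable under letters, so
  the chain rule can be iterated along a whole orbit.\<close>

definition typical :: "'x \<Rightarrow> bool" where
  "typical x \<longleftrightarrow> x \<in> space M \<and> (\<forall>w. set w \<subseteq> letters r \<longrightarrow> 0 < M.prob (cell w x))"

lemma AE_typical: "AE x in M. typical x"
proof -
  have "AE x in M. set w \<subseteq> letters r \<longrightarrow> 0 < M.prob (cell w x)" for w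
    using countable_cells.AE_cell_pos[OF countable_cells_cell, of w] by (cases "set w \<subseteq> letters r") auto
  then have "AE x in M. \<forall>w. set w \<subseteq> letters r \<longrightarrow> 0 < M.prob (cell w x)"
    by (simp add: AE_all_countable)
  then show ?thesis using AE_space by eventually_elim (simp add: typical_def)
qed

lemma prob_cell_Cons_le:
  assumes "a \<in> letters r" "set w \<subseteq> letters r" "x \<in> space M"
  shows "M.prob (cell (a # w) x) \<le> M.prob (cell w (act (inv_letter a) x))"
proof -
  have "M.prob (cell (a # w) x) \<le> M.prob (past (a # w) x)"
    using countable_cells.cell_sets[OF countable_cells_past, of "a # w" x] assms
    by (intro M.finite_measure_mono) (auto simp: past_def)
  then show ?thesis using prob_past_Cons[OF assms] by simp
qed

lemma typical_act:
  assumes "typical x" "a \<in> letters r"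
  shows "typical (act (inv_letter a) x)"
  unfolding typical_def
proof (intro conjI allI impI)
  show "act (inv_letter a) x \<in> space M" using assms by (simp add: typical_def act_space)
  fix w assume w: "set w \<subseteq> letters r"
  then have "0 < M.prob (cell (a # w) x)" using assms by (simp add: typical_def del: cell.simps)
  also have "\<dots> \<le> M.prob (cell w (act (inv_letter a) x))"
    using assms w by (intro prob_cell_Cons_le) (auto simp: typical_def)
  finally show "0 < M.prob (cell w (act (inv_letter a) x))" .
qed

text \<open>The past of a # w is the preimage, under a measure preserving letter, of the cell of w
  at the moved point. Multiplying and dividing by its mass separates the two logarithms.\<close>

lemma joint_info_Cons:
  assumes "typical x" "a \<in> letters r" "set w \<subseteq> letters r"
  shows "joint_info (a # w) x = cond_info (a # w) x + joint_info w (act (inv_letter a) x)"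
proof -
  have x: "x \<in> space M" using assms by (simp add: typical_def)
  have "0 < M.prob (cell (a # w) x)" "0 < M.prob (cell w (act (inv_letter a) x))"
    using assms typical_act[OF assms(1,2)] by (auto simp: typical_def simp del: cell.simps)
  then show ?thesis
    using prob_past_Cons[OF assms(2,3) x] cell_eq_past[OF x, of "a # w"]
    by (simp add: joint_info_def cond_info_def ln_div del: cell.simps)
qed

definition g :: "nat \<Rightarrow> (nat \<Rightarrow> letter) \<times> 'x \<Rightarrow> real" where
  "g n p = cond_info (map (fst p) [0..<n]) (snd p)"

definition J :: "nat \<Rightarrow> (nat \<Rightarrow> letter) \<times> 'x \<Rightarrow> real" where
  "J n p = joint_info (map (fst p) [0..<n]) (snd p)"

lemma measurable_prefix_function:
  assumes "\<And>w. set w \<subseteq> letters r \<Longrightarrow> f w \<in> borel_measurable M"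
  shows "(\<lambda>p. f (map (fst p) [0..<n]) (snd p)) \<in> borel_measurable Y"
proof (rule measurable_compose_countable'[where I = "{w. set w \<subseteq> letters r}" and f = "\<lambda>w p. f w (snd p)"])
  show "(\<lambda>p. f w (snd p)) \<in> borel_measurable Y" if "w \<in> {w. set w \<subseteq> letters r}" for w
    using that assms by (intro measurable_compose[OF measurable_snd]) simp
  show "(\<lambda>p. map (fst p) [0..<n]) \<in> measurable Y (count_space {w. set w \<subseteq> letters r})"
  proof (rule measurable_compose[OF measurable_fst])
    show "(\<lambda>\<xi>. map \<xi> [0..<n]) \<in> measurable \<nu> (count_space {w. set w \<subseteq> letters r})"
      using prefix_measurable[of n] boundary_prefix_letters by (auto simp: measurable_def)
  qed
  show "countable {w. set w \<subseteq> letters r}" by (rule countableI_type)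
qed

lemma g_measurable [measurable]: "g n \<in> borel_measurable Y"
  unfolding g_def[abs_def] by (rule measurable_prefix_function[OF cond_info_measurable])

lemma J_measurable [measurable]: "J n \<in> borel_measurable Y"
  unfolding J_def[abs_def] by (rule measurable_prefix_function[OF joint_info_measurable])

lemma g_0: "x \<in> space M \<Longrightarrow> g 0 (\<xi>, x) = J 0 (\<xi>, x)"
  using cell_eq_past[of x "[]"]
  by (simp add: g_def J_def cond_info_def joint_info_def past_def M.prob_space)

text \<open>Each application of the chain rule removes the first letter and moves the point by T, so
  the remaining prefix has length n - k at the k-th orbit point.\<close>

lemma J_eq_sum:
  assumes "typical x" "\<xi> \<in> boundary r"
  shows "J n (\<xi>, x) = (\<Sum>k\<le>n. g (n - k) ((T ^^ k) (\<xi>, x)))"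
  using assms
proof (induction n arbitrary: \<xi> x)
  case 0
  then show ?case by (simp add: g_0 typical_def)
next
  case (Suc n)
  have a: "\<xi> 0 \<in> letters r" using boundary_letter Suc by blast
  have T: "T (\<xi>, x) = (shift \<xi>, act (inv_letter (\<xi> 0)) x)" by (simp add: T_def)
  have "J (Suc n) (\<xi>, x) = g (Suc n) (\<xi>, x) + J n (T (\<xi>, x))"
    unfolding J_def g_def T fst_conv snd_conv prefix_Suc
    by (rule joint_info_Cons[OF Suc(2) a boundary_prefix_letters[OF shift_boundary[OF Suc(3)]]])
  also have "J n (T (\<xi>, x)) = (\<Sum>k\<le>n. g (n - k) ((T ^^ k) (T (\<xi>, x))))"
    unfolding T by (rule Suc.IH[OF typical_act[OF Suc(2) a] shift_boundary[OF Suc(3)]])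
  also have "g (Suc n) (\<xi>, x) + \<dots> = (\<Sum>k\<le>Suc n. g (Suc n - k) ((T ^^ k) (\<xi>, x)))"
    by (subst sum.atMost_Suc_shift) (simp add: funpow_swap1)
  finally show ?case .
qed

section \<open>Identifying cells with the atoms of the joins\<close>

lemma translate_Nil: "translate \<alpha> [] P = P"
proof -
  have "\<alpha> [] ` A = A" if "A \<in> P" for A
  proof -
    have "A \<subseteq> space M" using that partition_on_P by (auto simp: partition_on_def)
    then have "\<alpha> [] x = x" if "x \<in> A" for x using that \<alpha>_Nil by blast
    then show ?thesis by force
  qed
  then show ?thesis by (simp add: translate_def)
qed

lemma same_atom_translate_Cons:
  assumes "a # u \<in> reduced_words r" "x \<in> space M" "y \<in> space M"
  shows "same_atom (translate \<alpha> (a # u) P) x y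
    \<longleftrightarrow> same_atom (translate \<alpha> u P) (act (inv_letter a) x) (act (inv_letter a) y)"
proof -
  have a: "a \<in> letters r" "u \<in> reduced_words r" using assms by (auto simp: reduced_words_Cons)
  have "x \<in> \<alpha> (a # u) ` A \<longleftrightarrow> act (inv_letter a) x \<in> \<alpha> u ` A"
    if A: "A \<in> P" and x: "x \<in> space M" for A x
  proof -
    have As: "z \<in> space M" if "z \<in> A" for z using that A partition_on_P by (auto simp: partition_on_def)
    show ?thesis
    proof
      assume "x \<in> \<alpha> (a # u) ` A"
      then obtain z where z: "z \<in> A" "x = \<alpha> (a # u) z" by blast
      then have "act (inv_letter a) x = \<alpha> u z"
        using As \<alpha>_Cons[OF assms(1)] act_inv(1)[OF a(1)] \<alpha>_space[OF a(2)] by simp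
      then show "act (inv_letter a) x \<in> \<alpha> u ` A" using z by blast
    next
      assume "act (inv_letter a) x \<in> \<alpha> u ` A"
      then obtain z where z: "z \<in> A" "act (inv_letter a) x = \<alpha> u z" by blast
      then have "x = \<alpha> (a # u) z"
        using As \<alpha>_Cons[OF assms(1)] act_inv(2)[OF a(1) x] by simp
      then show "x \<in> \<alpha> (a # u) ` A" using z by blast
    qed
  qed
  then show ?thesis using assms(2,3) by (auto simp: same_atom_def translate_def)
qed

text \<open>Moving both points by the inverse of the first letter strips that letter from all
  nonempty prefixes; j = 0 contributes P itself.\<close>

lemma mem_cell_iff:
  "w \<in> reduced_words r \<Longrightarrow> x \<in> space M \<Longrightarrow>
    y \<in> cell w x \<longleftrightarrow> y \<in> space M \<and> (\<forall>j\<le>length w. same_atom (translate \<alpha> (take j w) P) x y)"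
proof (induction w arbitrary: x y)
  case Nil
  then show ?case using sets.sets_into_space[OF atom.cell_sets[of x]] by (auto simp: translate_Nil atom_def)
next
  case (Cons a w)
  have a: "inv_letter a \<in> letters r" "w \<in> reduced_words r" using Cons.prems by (auto simp: reduced_words_Cons)
  have red: "a # take j w \<in> reduced_words r" for j
    using reduced_words_take[OF Cons.prems(1), of "Suc j"] by simp
  have "y \<in> cell (a # w) x \<longleftrightarrow> y \<in> space M \<and> same_atom P x y \<and>
      (\<forall>j\<le>length w. same_atom (translate \<alpha> (take j w) P) (act (inv_letter a) x) (act (inv_letter a) y))"
    using Cons.IH[OF a(2) act_space[OF a(1) Cons.prems(2)]] act_space[OF a(1)] by (auto simp: atom_def)
  also have "\<dots> \<longleftrightarrow> y \<in> space M \<and> same_atom (translate \<alpha> (take 0 (a # w)) P) x y \<and>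
      (\<forall>j\<le>length w. same_atom (translate \<alpha> (take (Suc j) (a # w)) P) x y)"
    using same_atom_translate_Cons[OF red Cons.prems(2)] by (auto simp: translate_Nil)
  also have "\<dots> \<longleftrightarrow> y \<in> space M \<and> (\<forall>j\<le>length (a # w). same_atom (translate \<alpha> (take j (a # w)) P) x y)"
  proof -
    have "(\<forall>j\<le>Suc n. \<phi> j) \<longleftrightarrow> \<phi> 0 \<and> (\<forall>j\<le>n. \<phi> (Suc j))" for \<phi> and n :: nat
      using All_less_Suc2[of "Suc n" \<phi>] by (simp add: less_Suc_eq_le)
    then show ?thesis by (simp only: list.size add_0_right add_Suc_right)
  qed
  finally show ?case .
qed

lemma partition_on_translate:
  assumes "w \<in> reduced_words r"
  shows "partition_on (space M) (translate \<alpha> w P)"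
proof -
  have w: "w \<in> carrier (free_group r)" using assms by simp
  have ne: "{} \<notin> (`) (\<alpha> w) ` P" using partition_on_P by (auto simp: partition_on_def)
  have "partition_on (\<alpha> w ` space M) ((`) (\<alpha> w) ` P - {{}})"
    by (rule partition_on_inj_image[OF partition_on_P \<alpha>.inj_prop[OF w]])
  then show ?thesis using ne by (simp add: translate_def \<alpha>.surj_prop[OF w])
qed

lemma same_atom_space:
  assumes "partition_on (space M) Q" "same_atom Q x y"
  shows "y \<in> space M"
  using assms by (auto simp: same_atom_def partition_on_def)

text \<open>Information depends on a partition through its relation alone. Hence the nested join
  over a sphere word and the flat join over the prefixes of a ray are covered by the same
  statement.\<close>

lemma information_eq_joint_info:
  assumes w: "w \<in> reduced_words r" and Q: "partition_on (space M) Q" and x: "x \<in> space M"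
    and same: "\<And>y. y \<in> space M \<Longrightarrow> same_atom Q x y \<longleftrightarrow> (\<forall>j\<le>length w. same_atom (translate \<alpha> (take j w) P) x y)"
  shows "{y. same_atom Q x y} = cell w x" "information M Q x = joint_info w x"
proof -
  show *: "{y. same_atom Q x y} = cell w x"
    using same same_atom_space[OF Q] mem_cell_iff[OF w x] by blast
  show "information M Q x = joint_info w x"
    using information_eq[OF Q x, of M] by (simp add: * joint_info_def)
qed

text \<open>For n \<ge> 1 the inner join runs over a nonempty family and is again a partition of the
  space; adjoining P supplies the index j = 0. Excluding n = 0 does not affect a limit.\<close>

lemma information_sphere:
  assumes w: "w \<in> reduced_words r" and n: "length w = n" "1 \<le> n" and x: "x \<in> space M"
  shows "information M (common_refinement {P, common_refinement ((\<lambda>j. translate \<alpha> (take j w) P) ` {1..n})}) x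
    = joint_info w x"
proof (rule information_eq_joint_info(2)[OF w _ x])
  let ?R = "common_refinement ((\<lambda>j. translate \<alpha> (take j w) P) ` {1..n})"
  have ne: "(\<lambda>j. translate \<alpha> (take j w) P) ` {1..n} \<noteq> {}" using n by auto
  have "partition_on (space M) ?R"
    using partition_on_translate[OF reduced_words_take[OF w]] ne by (intro partition_on_common_refinement) auto
  then show "partition_on (space M) (common_refinement {P, ?R})"
    using partition_on_P by (intro partition_on_common_refinement) auto
  fix y
  have "same_atom (common_refinement {P, ?R}) x y \<longleftrightarrow> same_atom P x y \<and> (\<forall>j\<in>{1..n}. same_atom (translate \<alpha> (take j w) P) x y)"
    using same_atom_common_refinement[OF ne, of x y] same_atom_common_refinement[of "{P, ?R}" x y] by auto
  also have "\<dots> \<longleftrightarrow> (\<forall>j\<le>length w. same_atom (translate \<alpha> (take j w) P) x y)"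
  proof -
    have "j = 0 \<or> j \<in> {1..n}" if "j \<le> length w" for j using that n by auto
    then show ?thesis using n(1) translate_Nil by (metis atLeastAtMost_iff le0 take0)
  qed
  finally show "same_atom (common_refinement {P, ?R}) x y \<longleftrightarrow> (\<forall>j\<le>length w. same_atom (translate \<alpha> (take j w) P) x y)" .
qed

lemma translates_join_prefixes:
  assumes \<xi>: "\<xi> \<in> boundary r"
  defines "Q n \<equiv> translates_join \<alpha> P (word_prefixes \<xi> n)"
  shows "partition_on (space M) (Q n)"
    and "x \<in> space M \<Longrightarrow> {y. same_atom (Q n) x y} = cell (map \<xi> [0..<n]) x"
    and "x \<in> space M \<Longrightarrow> information M (Q n) x = J n (\<xi>, x)"
proof -
  have ne: "(\<lambda>g. translate \<alpha> g P) ` word_prefixes \<xi> n \<noteq> {}" by (auto simp: word_prefixes_def)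
  show p: "partition_on (space M) (Q n)"
    unfolding Q_def translates_join_def using ne
    by (intro partition_on_common_refinement)
      (auto simp: word_prefixes_def intro!: partition_on_translate prefix_reduced \<xi>)
  have same: "same_atom (Q n) x y \<longleftrightarrow> (\<forall>j\<le>length (map \<xi> [0..<n]). same_atom (translate \<alpha> (take j (map \<xi> [0..<n])) P) x y)" for x y
  proof -
    have "take j (map \<xi> [0..<n]) = map \<xi> [0..<j]" if "j \<le> n" for j using that by (simp add: take_map)
    then show ?thesis
      unfolding Q_def translates_join_def same_atom_common_refinement[OF ne] by (auto simp: word_prefixes_def)
  qed
  show "x \<in> space M \<Longrightarrow> {y. same_atom (Q n) x y} = cell (map \<xi> [0..<n]) x"
    by (rule information_eq_joint_info(1)[OF prefix_reduced[OF \<xi>] p _ same])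
  show "x \<in> space M \<Longrightarrow> information M (Q n) x = J n (\<xi>, x)"
    unfolding J_def fst_conv snd_conv
    by (rule information_eq_joint_info(2)[OF prefix_reduced[OF \<xi>] p _ same])
qed

text \<open>Entropy is the integral of information, grouped by atoms; as an \<open>ennreal\<close>
  identity it presupposes no finiteness.\<close>

lemma partition_entropy_prefixes:
  assumes \<xi>: "\<xi> \<in> boundary r"
  shows "partition_entropy M (translates_join \<alpha> P (word_prefixes \<xi> n)) = (\<integral>\<^sup>+x. ennreal (J n (\<xi>, x)) \<partial>M)"
proof -
  let ?w = "map \<xi> [0..<n]"
  interpret C: countable_cells M "cell ?w" by (rule countable_cells_cell[OF boundary_prefix_letters[OF \<xi>]])
  have "translates_join \<alpha> P (word_prefixes \<xi> n)
      = (\<lambda>x. {y. same_atom (translates_join \<alpha> P (word_prefixes \<xi> n)) x y}) ` space M"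
    by (rule partition_on_eq_atoms[OF translates_join_prefixes(1)[OF \<xi>]])
  also have "\<dots> = cell ?w ` space M"
    by (rule image_cong[OF refl]) (rule translates_join_prefixes(2)[OF \<xi>])
  finally have "partition_entropy M (translates_join \<alpha> P (word_prefixes \<xi> n))
      = (\<Sum>\<^sub>\<infinity>A\<in>cell ?w ` space M. ennreal (- ln (M.prob A)) * emeasure M A)"
    unfolding partition_entropy_def
  proof (simp only:, intro infsum_cong)
    fix A
    have "0 \<le> - ln (M.prob A)" by (cases "M.prob A = 0") (auto simp: zero_less_measure_iff)
    then show "ennreal (- (M.prob A * ln (M.prob A))) = ennreal (- ln (M.prob A)) * emeasure M A"
      by (simp add: M.emeasure_eq_measure ennreal_mult[symmetric] mult.commute)
  qed
  also have "\<dots> = (\<integral>\<^sup>+x. ennreal (- ln (M.prob (cell ?w x))) \<partial>M)"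
    by (rule C.nn_integral_cell_function[symmetric])
  finally show ?thesis by (simp add: J_def joint_info_def)
qed

end

section \<open>The limit theorem\<close>

context partitioned_action
begin

sublocale Y: ergodic_map Y T
  by unfold_locales (use distr_T ergodic_T in auto)

lemma AE_snd:
  assumes "AE x in M. Q x"
  shows "AE p in Y. Q (snd p)"
proof -
  obtain N where N: "{x \<in> space M. \<not> Q x} \<subseteq> N" "emeasure M N = 0" "N \<in> sets M"
    using assms by (rule AE_E)
  show ?thesis
  proof (rule AE_I[of _ _ "boundary r \<times> N"])
    show "{p \<in> space Y. \<not> Q (snd p)} \<subseteq> boundary r \<times> N"
      using N(1) by (auto simp: space_pair_measure)
    have b: "boundary r \<in> sets \<nu>" using sets.top[of \<nu>] by simp
    then show "boundary r \<times> N \<in> sets Y" using N(3) by (rule pair_measureI)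
    show "emeasure Y (boundary r \<times> N) = 0"
      using M.emeasure_pair_measure_Times[OF b N(3)] N(2) by simp
  qed
qed

text \<open>Spherical averages fix x and integrate over \<xi>, the order opposite to the one in
  which Y is built. Passing first to a measurable null set \<open>N\<close> meets the measurability
  requirement for exchanging the quantifiers.\<close>

lemma AE_swap:
  assumes "AE p in Y. Q p"
  shows "AE x in M. AE \<xi> in \<nu>. Q (\<xi>, x)"
proof -
  obtain N where N: "{p \<in> space Y. \<not> Q p} \<subseteq> N" "emeasure Y N = 0" "N \<in> sets Y"
    using assms by (rule AE_E)
  have "AE p in Y. p \<notin> N" using N by (intro AE_not_in) (auto simp: null_sets_def)
  then have "AE \<xi> in \<nu>. AE x in M. (\<xi>, x) \<notin> N" by (rule Y.AE_pair)
  moreover have "{p \<in> space Y. (fst p, snd p) \<notin> N} \<in> sets Y"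
    using sets.Diff[OF sets.top N(3)] by (simp add: set_diff_eq)
  ultimately have "AE x in M. AE \<xi> in \<nu>. (\<xi>, x) \<notin> N"
    using Y.AE_commute[of "\<lambda>\<xi> x. (\<xi>, x) \<notin> N"] by simp
  then show ?thesis using AE_space
  proof eventually_elim
    case (elim x)
    from elim(1) AE_space show ?case
      by eventually_elim (use N(1) elim(2) in \<open>auto simp: space_pair_measure\<close>)
  qed
qed

lemma g_eq_info:
  assumes "\<xi> \<in> boundary r"
  shows "g n (\<xi>, x) = partition_cell_filtration.info M (\<lambda>n. past (map \<xi> [0..<n])) atom n x"
proof -
  interpret F: partition_cell_filtration M "\<lambda>n. past (map \<xi> [0..<n])" atom
    by (rule partition_cell_filtration_past[OF assms])
  show ?thesis by (simp add: g_def cond_info_def F.info_def F.cells.cond_prob_cell_def)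
qed

lemma g_nonneg: "0 \<le> g n p"
  by (simp add: g_def cond_info_nonneg)

lemma J_nonneg: "0 \<le> J n p"
  by (simp add: J_def joint_info_nonneg)

text \<open>The filtration of pasts depends on \<xi>, so martingale convergence is used fibre by
  fibre; measurability of the convergence set, read as a Cauchy condition, glues the fibres
  together.\<close>

lemma AE_g_convergent: "AE p in Y. convergent (\<lambda>n. g n p)"
proof (rule Y.AE_pair_measure)
  show "{p \<in> space Y. convergent (\<lambda>n. g n p)} \<in> sets Y"
    unfolding Cauchy_convergent_iff[symmetric] by measurable
  show "AE \<xi> in \<nu>. AE x in M. convergent (\<lambda>n. g n (\<xi>, x))"
  proof (rule AE_I2)
    fix \<xi> assume "\<xi> \<in> space \<nu>"
    then have \<xi>: "\<xi> \<in> boundary r" by simp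
    show "AE x in M. convergent (\<lambda>n. g n (\<xi>, x))"
      using partition_cell_filtration.info_convergent[OF partition_cell_filtration_past[OF \<xi>]]
      by (simp add: g_eq_info[OF \<xi>])
  qed
qed

text \<open>On every fibre the p-th moment of the supremum is at most the same \<open>K\<close>, so
  it survives integration over \<xi>. F is the p-th root of the supremum of the p-th powers, and F
  \<le> 1 + F^p gives integrability.\<close>

lemma maximal_information:
  assumes p: "1 < p"
    and moment: "(\<Sum>\<^sub>\<infinity>A\<in>P. ennreal (M.prob A * (- ln (M.prob A)) powr p)) < \<infinity>"
  obtains F where "integrable Y F" "\<And>y. 0 \<le> F y" "integrable Y (\<lambda>y. F y powr p)"
    "AE y in Y. \<forall>n. g n y \<le> F y"
proof -
  define S where "S = (\<integral>\<^sup>+x. ennreal ((- ln (M.prob (atom x))) powr p) \<partial>M)"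
  have "S = (\<Sum>\<^sub>\<infinity>A\<in>P. ennreal ((- ln (M.prob A)) powr p) * emeasure M A)"
    using atom.nn_integral_cell_function[of "\<lambda>A. ennreal ((- ln (M.prob A)) powr p)"]
    by (simp only: S_def atoms_eq)
  also have "\<dots> = (\<Sum>\<^sub>\<infinity>A\<in>P. ennreal (M.prob A * (- ln (M.prob A)) powr p))"
    by (intro infsum_cong) (simp add: M.emeasure_eq_measure ennreal_mult[symmetric] mult.commute)
  finally have S: "S < \<infinity>" using moment by simp
  define K where "K = ennreal (2 powr p) * (S + ennreal ((2 * p) powr p) * (\<Sum>j. ennreal (exp (1 - real j / 2))))"
  have K: "K < \<infinity>"
    using S suminf_exp_half_finite unfolding K_def infinity_ennreal_def
    by (intro ennreal_mult_less_top[THEN iffD2]) (simp add: ennreal_mult_less_top)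
  define U where "U y = (SUP n. ennreal (g n y powr p))" for y
  have [measurable]: "U \<in> borel_measurable Y" unfolding U_def[abs_def] by measurable
  have "(\<integral>\<^sup>+y. U y \<partial>Y) = (\<integral>\<^sup>+\<xi>. \<integral>\<^sup>+x. U (\<xi>, x) \<partial>M \<partial>\<nu>)"
    by (rule M.nn_integral_fst[symmetric]) measurable
  also have "\<dots> \<le> (\<integral>\<^sup>+\<xi>. K \<partial>\<nu>)"
  proof (rule nn_integral_mono)
    fix \<xi> assume "\<xi> \<in> space \<nu>"
    then have \<xi>: "\<xi> \<in> boundary r" by simp
    show "(\<integral>\<^sup>+x. U (\<xi>, x) \<partial>M) \<le> K"
      using partition_cell_filtration.nn_integral_sup_info[OF partition_cell_filtration_past[OF \<xi>] p]
      by (simp only: U_def g_eq_info[OF \<xi>] K_def S_def)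
  qed
  also have "\<dots> = K" using \<nu>.emeasure_space_1 by simp
  finally have UI: "(\<integral>\<^sup>+y. U y \<partial>Y) < \<infinity>" using K by (rule order_le_less_trans)
  then have Ufin: "AE y in Y. U y \<noteq> \<infinity>"
    by (intro nn_integral_PInf_AE) auto
  define F where "F y = enn2real (U y) powr (1 / p)" for y
  have [measurable]: "F \<in> borel_measurable Y" unfolding F_def[abs_def] by measurable
  have F0: "0 \<le> F y" for y by (simp add: F_def)
  have Fp: "F y powr p = enn2real (U y)" for y
    using p by (simp add: F_def powr_powr)
  have iFp: "integrable Y (\<lambda>y. F y powr p)"
  proof (rule integrableI_bounded)
    have "(\<integral>\<^sup>+y. ennreal (norm (F y powr p)) \<partial>Y) = (\<integral>\<^sup>+y. U y \<partial>Y)"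
      using Ufin by (intro nn_integral_cong_AE) (auto simp: Fp less_top)
    then show "(\<integral>\<^sup>+y. ennreal (norm (F y powr p)) \<partial>Y) < \<infinity>" using UI by simp
  qed measurable
  have iF: "integrable Y F"
  proof (rule Bochner_Integration.integrable_bound)
    show "integrable Y (\<lambda>y. 1 + F y powr p)" using iFp by simp
    have "F y \<le> 1 + F y powr p" for y
    proof (cases "F y \<le> 1")
      case False
      then have "F y powr 1 \<le> F y powr p" using p by (intro powr_mono) auto
      then show ?thesis using False by simp
    qed (simp add: add_increasing2)
    then show "AE y in Y. norm (F y) \<le> norm (1 + F y powr p)"
      using F0 by (intro AE_I2) (simp add: add_nonneg_nonneg)
  qed measurable
  have "AE y in Y. \<forall>n. g n y \<le> F y"
    using Ufin
  proof eventually_elim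
    case (elim y)
    show ?case
    proof
      fix n
      have "ennreal (g n y powr p) \<le> U y" unfolding U_def by (rule SUP_upper) simp
      also have "U y = ennreal (F y powr p)" using elim by (simp add: Fp less_top)
      finally have "g n y powr p \<le> F y powr p" by simp
      then have "(g n y powr p) powr (1 / p) \<le> (F y powr p) powr (1 / p)"
        using p powr_mono2[of "1 / p" "g n y powr p" "F y powr p"] by simp
      then show "g n y \<le> F y" using p g_nonneg[of n y] F0[of y] by (simp add: powr_powr)
    qed
  qed
  with iF F0 iFp show thesis by (rule that)
qed

text \<open>One majorant F of all g_n is used twice: its integrability feeds
  \<open>maker_ergodic_theorem\<close>, and integrability of F^p makes its ergodic maximal function
  the majorant \<open>W\<close> of the quotients.\<close>

theorem joint_info_limit:
  assumes p: "1 < p"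
    and moment: "(\<Sum>\<^sub>\<infinity>A\<in>P. ennreal (M.prob A * (- ln (M.prob A)) powr p)) < \<infinity>"
  obtains h W where "0 \<le> h" "AE y in Y. (\<lambda>n. J n y / real (Suc n)) \<longlonglongrightarrow> h"
    "integrable Y W" "AE y in Y. \<forall>n. J n y / real (Suc n) \<le> W y"
proof -
  obtain F where F: "integrable Y F" "\<And>y. 0 \<le> F y" "integrable Y (\<lambda>y. F y powr p)"
    "AE y in Y. \<forall>n. g n y \<le> F y"
    using maximal_information[OF p moment] by blast
  obtain h where h: "0 \<le> h"
    "AE y in Y. (\<lambda>n. (\<Sum>k\<le>n. g (n - k) ((T ^^ k) y)) / real (Suc n)) \<longlonglongrightarrow> h"
    using Y.maker_ergodic_theorem[OF g_measurable g_nonneg AE_g_convergent F(1,2,4)] by blast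
  obtain W where W: "integrable Y W" "\<And>y. 0 \<le> W y" "AE y in Y. \<forall>n. Y.bsum F n y \<le> real n * W y"
    using Y.maximal_function_integrable[OF F(1,2) p F(3)] by blast
  have sum: "AE y in Y. \<forall>n. J n y = (\<Sum>k\<le>n. g (n - k) ((T ^^ k) y))"
    using AE_snd[OF AE_typical] AE_space
  proof eventually_elim
    case (elim y)
    then show ?case using J_eq_sum[of "snd y" "fst y"] by (auto simp: space_pair_measure)
  qed
  have "AE y in Y. \<forall>k n. g n ((T ^^ k) y) \<le> F ((T ^^ k) y)"
    by (subst AE_all_countable) (intro allI Y.AE_T_pow F)
  then have "AE y in Y. \<forall>n. J n y / real (Suc n) \<le> W y"
    using sum W(3)
  proof eventually_elim
    case (elim y)
    show ?case
    proof
      fix n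
      have "J n y \<le> (\<Sum>k\<le>n. F ((T ^^ k) y))"
        using elim(1,2) by (auto intro!: sum_mono)
      also have "\<dots> = Y.bsum F (Suc n) y" by (simp only: Y.bsum_def lessThan_Suc_atMost)
      also have "\<dots> \<le> real (Suc n) * W y" using elim(3) by blast
      finally show "J n y / real (Suc n) \<le> W y" by (simp add: divide_le_eq mult.commute)
    qed
  qed
  moreover have "AE y in Y. (\<lambda>n. J n y / real (Suc n)) \<longlonglongrightarrow> h"
    using h(2) sum by eventually_elim simp
  ultimately show thesis using h(1) W(1) that by blast
qed

end

theorem corollary2p2:
  fixes r :: nat and M :: "'x measure" and \<alpha> :: "letter list \<Rightarrow> 'x \<Rightarrow> 'x"
    and P :: "'x set set" and \<epsilon>\<^sub>0 :: real
  assumes "r \<ge> 2"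
    and "prob_space M" and "standard_borel_space M"
    and "pmp_action (free_group r) M \<alpha>" and "ergodic_action (free_group r) M \<alpha>"
    and "countable_measurable_partition M P"
    and "partition_entropy M P < \<infinity>"
    and "\<epsilon>\<^sub>0 > 0"
    and "(\<Sum>\<^sub>\<infinity>A\<in>P. ennreal (measure M A * (- ln (measure M A)) powr (1 + \<epsilon>\<^sub>0))) < \<infinity>"
  shows "\<exists>h::real. h \<ge> 0 \<and>
     (AE x in M.
        (\<lambda>n. (\<Sum>g\<in>word_sphere r n.
                information M
                  (common_refinement
                     {P, common_refinement ((\<lambda>j. translate \<alpha> (take j g) P) ` {1..n})}) x
                / real (n + 1))
             / real (card (word_sphere r n))) \<longlonglongrightarrow> h) \<and>
     (\<lambda>n. \<integral>\<^sup>+\<xi>. partition_entropy M (translates_join \<alpha> P (word_prefixes \<xi> n)) / of_nat (n + 1)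
            \<partial>boundary_measure r) \<longlonglongrightarrow> ennreal h \<and>
     (AE p in boundary_measure r \<Otimes>\<^sub>M M.
        (\<lambda>n. information M (translates_join \<alpha> P (word_prefixes (fst p) n)) (snd p) / real (n + 1))
          \<longlonglongrightarrow> h)"
proof -
  interpret M: prob_space M by fact
  interpret partitioned_action r M \<alpha> P
    by unfold_locales (use assms in auto)
  obtain h W where h: "0 \<le> h" and lim: "AE y in Y. (\<lambda>n. J n y / real (Suc n)) \<longlonglongrightarrow> h"
    and W: "integrable Y W" and bound: "AE y in Y. \<forall>n. J n y / real (Suc n) \<le> W y"
    using joint_info_limit[of "1 + \<epsilon>\<^sub>0"] assms by auto
  have [measurable]: "W \<in> borel_measurable Y" using W by simp
  have norm_bound: "AE y in Y. norm (J n y / real (Suc n)) \<le> W y" for n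
    using bound by eventually_elim (use J_nonneg in \<open>simp add: abs_of_nonneg\<close>)
  have Jint: "integrable Y (\<lambda>y. J n y / real (Suc n))" for n
    by (rule Bochner_Integration.integrable_bound[OF W]) (use norm_bound[of n] in \<open>auto elim!: AE_mp\<close>)
  have "(\<lambda>n. \<integral>y. J n y / real (Suc n) \<partial>Y) \<longlonglongrightarrow> (\<integral>y. h \<partial>Y)"
    by (rule integral_dominated_convergence[where w = W]) (use W lim norm_bound in auto)
  then have intlim: "(\<lambda>n. \<integral>y. J n y / real (Suc n) \<partial>Y) \<longlonglongrightarrow> h" by (simp add: Y.prob_space)
  \<comment> \<open>By Fubini almost every section of \<open>W\<close> is integrable, which is what
    dominated convergence over \<xi> at a fixed x asks for.\<close>
  have "AE x in M. integrable \<nu> (\<lambda>\<xi>. W (\<xi>, x))"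
    by (rule Y.AE_integrable_snd) (use W in simp)
  then have sphere: "AE x in M.
        (\<lambda>n. (\<Sum>g\<in>word_sphere r n.
                information M
                  (common_refinement
                     {P, common_refinement ((\<lambda>j. translate \<alpha> (take j g) P) ` {1..n})}) x
                / real (n + 1))
             / real (card (word_sphere r n))) \<longlonglongrightarrow> h"
    using AE_swap[OF lim] AE_swap[OF bound] AE_space
  proof eventually_elim
    case (elim x)
    note x = elim(4)
    have [measurable]: "(\<lambda>\<xi>. J n (\<xi>, x)) \<in> borel_measurable \<nu>" for n
      by (rule measurable_compose[OF measurable_Pair2'[OF x] J_measurable])
    have "(\<lambda>n. \<integral>\<xi>. J n (\<xi>, x) / real (Suc n) \<partial>\<nu>) \<longlonglongrightarrow> (\<integral>\<xi>. h \<partial>\<nu>)"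
    proof (rule integral_dominated_convergence[where w = "\<lambda>\<xi>. W (\<xi>, x)"])
      show "AE \<xi> in \<nu>. norm (J n (\<xi>, x) / real (Suc n)) \<le> W (\<xi>, x)" for n
        using elim(3) by eventually_elim (use J_nonneg in \<open>simp add: abs_of_nonneg\<close>)
    qed (use elim in auto)
    then have "(\<lambda>n. \<integral>\<xi>. J n (\<xi>, x) / real (Suc n) \<partial>\<nu>) \<longlonglongrightarrow> h"
      using \<nu>.prob_space by simp
    \<comment> \<open>The integrand sees only the first n letters, so \<open>integral_prefix\<close>
      turns it into the spherical average; \<open>information_sphere\<close> requires n \<ge> 1,
      hence the eventual equality.\<close>
    moreover have "eventually (\<lambda>n. (\<integral>\<xi>. J n (\<xi>, x) / real (Suc n) \<partial>\<nu>) = (\<Sum>g\<in>word_sphere r n.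
                information M
                  (common_refinement
                     {P, common_refinement ((\<lambda>j. translate \<alpha> (take j g) P) ` {1..n})}) x
                / real (n + 1))
             / real (card (word_sphere r n))) sequentially"
      using eventually_ge_at_top[of 1]
    proof eventually_elim
      case (elim n)
      have "(\<integral>\<xi>. J n (\<xi>, x) / real (Suc n) \<partial>\<nu>)
          = (\<Sum>g\<in>word_sphere r n. joint_info g x / real (Suc n)) / real (card (word_sphere r n))"
        unfolding J_def fst_conv snd_conv by (rule integral_prefix)
      also have "(\<Sum>g\<in>word_sphere r n. joint_info g x / real (Suc n))
          = (\<Sum>g\<in>word_sphere r n. information M (common_refinement
              {P, common_refinement ((\<lambda>j. translate \<alpha> (take j g) P) ` {1..n})}) x / real (n + 1))"
        using information_sphere[OF _ _ elim x] by (intro sum.cong) (auto simp: word_sphere_eq)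
      finally show ?case .
    qed
    ultimately show ?case by (rule Lim_transform_eventually)
  qed
  \<comment> \<open>The entropies are integrated as \<open>ennreal\<close> values; Tonelli and
    integrability of \<open>J n\<close> over Y identify the result with a real integral, whose limit
    is already known.\<close>
  have entropy: "(\<integral>\<^sup>+\<xi>. partition_entropy M (translates_join \<alpha> P (word_prefixes \<xi> n)) / of_nat (n + 1) \<partial>\<nu>)
      = ennreal (\<integral>y. J n y / real (Suc n) \<partial>Y)" for n
  proof -
    have "(\<integral>\<^sup>+\<xi>. partition_entropy M (translates_join \<alpha> P (word_prefixes \<xi> n)) / of_nat (n + 1) \<partial>\<nu>)
        = (\<integral>\<^sup>+\<xi>. \<integral>\<^sup>+x. ennreal (J n (\<xi>, x) / real (Suc n)) \<partial>M \<partial>\<nu>)"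
    proof (rule nn_integral_cong)
      fix \<xi> assume "\<xi> \<in> space \<nu>"
      then have \<xi>: "\<xi> \<in> boundary r" by simp
      have [measurable]: "(\<lambda>x. J n (\<xi>, x)) \<in> borel_measurable M"
        using \<xi> by (intro measurable_compose[OF measurable_Pair1' J_measurable]) simp
      have "ennreal (J n (\<xi>, x) / real (Suc n)) = ennreal (J n (\<xi>, x)) / of_nat (n + 1)" for x
        using divide_ennreal[OF J_nonneg, of "real (Suc n)" n "(\<xi>, x)"]
        by (simp add: ennreal_of_nat_eq_real_of_nat)
      then show "partition_entropy M (translates_join \<alpha> P (word_prefixes \<xi> n)) / of_nat (n + 1)
          = (\<integral>\<^sup>+x. ennreal (J n (\<xi>, x) / real (Suc n)) \<partial>M)"
        by (simp only: partition_entropy_prefixes[OF \<xi>]) (rule nn_integral_divide[symmetric], measurable)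
    qed
    also have "\<dots> = (\<integral>\<^sup>+y. ennreal (J n y / real (Suc n)) \<partial>Y)"
      by (rule M.nn_integral_fst) measurable
    also have "\<dots> = ennreal (\<integral>y. J n y / real (Suc n) \<partial>Y)"
      by (rule nn_integral_eq_integral[OF Jint]) (use J_nonneg in auto)
    finally show ?thesis .
  qed
  have "AE p in Y. (\<lambda>n. information M (translates_join \<alpha> P (word_prefixes (fst p) n)) (snd p) / real (n + 1)) \<longlonglongrightarrow> h"
    using lim AE_space
  proof eventually_elim
    case (elim p)
    then show ?case
      using translates_join_prefixes(3)[of "fst p" "snd p"] by (auto simp: space_pair_measure)
  qed
  with h sphere tendsto_ennrealI[OF intlim] show ?thesis unfolding entropy[symmetric] by blast
qed

end
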